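(* Let $X\subseteq\mathbb{P}^n$ be a projective hypersurface of degree $d$, not a hyperplane, admitting an induced additive action, let $(A,U)$ be the corresponding $H$-pair with maximal ideal $\mathfrak{m}$, and identify $\mathbb{P}^n$ with $\mathbb{P}(A)$ so that $X$ is given by $$f(z_0,z_1,\ldots,z_n)=z_0^d\,\pi\left(\ln\Bigl(1+\frac{z}{z_0}\Bigr)\right)=0,$$ where $z_1,\ldots,z_n$ are linear coordinates of $z\in\mathfrak{m}$. Write $f=\sum_{k=1}^d z_0^{d-k}f_k(z_1,\ldots,z_n)$ with $f_k$ homogeneous of degree $k$. If the polynomial $f_d$ is square-free, then the hypersurface $X$ is normal.
   Context: The base field $\mathbb{K}$ is algebraically closed of characteristic zero; all varieties are over $\mathbb{K}$; $\mathbb{G}_a^m=(\mathbb{K}^m,+)$. An additive action on an (irreducible) variety $X$ is an effective regular action of $\mathbb{G}_a^m$ on $X$ with an open orbit. An additive action $\mathbb{G}_a^{n-1}\times X\to X$ on a projective hypersurface $X\subseteq\mathbb{P}^n$ is called induced if it extends to a regular action of $\mathbb{G}_a^{n-1}$ on $\mathbb{P}^n$. All algebras are commutative, associative and unital. An $H$-pair is a pair $(A,U)$, where $A$ is a local finite-dimensional $\mathbb{K}$-algebra with maximal ideal $\mathfrak{m}$ (so $A=\mathbb{K}\oplus\mathfrak{m}$) and $U\subseteq\mathfrak{m}$ is a hyperplane generating $A$ as a unital algebra. It is known (generalized Hassett–Tschinkel correspondence) that induced additive actions on hypersurfaces in $\mathbb{P}^n$ other than hyperplanes correspond bijectively, up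 to equivalence, to $H$-pairs $(A,U)$ with $\dim A=n+1$: identifying $\mathbb{P}^n$ with $\mathbb{P}(A)$ by a suitable linear isomorphism and denoting by $p\colon A\setminus\{0\}\to\mathbb{P}(A)$ the canonical projection, $X=p(\overline{\mathbb{K}^\times\exp U})$ (Zariski closure in $A\setminus\{0\}$), and $\mathbb{G}_a^{n-1}\cong\exp U$ acts by multiplication. Let $\pi\colon\mathfrak{m}\to\mathfrak{m}/U\cong\mathbb{K}$ be the canonical projection, and let $d$ be the greatest positive integer with $\mathfrak{m}^d\nsubseteq U$. Then it is known that $X$ is irreducible of degree $d\ge 2$ and is given by $z_0^d\pi(\ln(1+z/z_0))=0$ for $z_0+z\in A=\mathbb{K}\oplus\mathfrak{m}$, $z_0\in\mathbb{K}$, $z\in\mathfrak{m}$; the open orbit of the action is the set of points of $X$ with $z_0\ne0$. *)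

theory Defs
  imports
    "HOL-Library.Poly_Mapping"
    "HOL-Computational_Algebra.Computational_Algebra"
    "HOL-Algebra.QuotRing"
begin

section \<open>Polynomials in the variables \<open>z\<^sub>0, z\<^sub>1, \<dots>\<close>\<close>

text \<open>
  Exponent vectors are finitely supported functions \<^typ>\<open>nat \<Rightarrow>\<^sub>0 nat\<close>; multiplication is the
  convolution product. There are infinitely many variables, but a divisor of a nonzero polynomial
  in some of the variables only involves those variables, so that \<^const>\<open>squarefree\<close> has the
  same meaning as in the polynomial ring in finitely many variables.
\<close>

type_synonym 'k mpoly = "(nat \<Rightarrow>\<^sub>0 nat) \<Rightarrow>\<^sub>0 'k"

definition Var :: "nat \<Rightarrow> 'k::comm_ring_1 mpoly" where
  "Var i = Poly_Mapping.single (Poly_Mapping.single i 1) 1"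

definition peval :: "'k::comm_ring_1 mpoly \<Rightarrow> (nat \<Rightarrow> 'k) \<Rightarrow> 'k" where
  "peval p v = (\<Sum>m\<in>Poly_Mapping.keys p. Poly_Mapping.lookup p m *
      (\<Prod>i\<in>Poly_Mapping.keys m. v i ^ Poly_Mapping.lookup m i))"

definition in_vars :: "nat set \<Rightarrow> 'k::comm_ring_1 mpoly \<Rightarrow> bool" where
  "in_vars V p \<longleftrightarrow> (\<forall>m\<in>Poly_Mapping.keys p. Poly_Mapping.keys m \<subseteq> V)"

text \<open>Homogeneity of degree \<open>k\<close> in the variables from \<open>V\<close>; the other variables count as
  coefficients. The zero polynomial is homogeneous of every degree.\<close>

definition homogeneous_in :: "nat set \<Rightarrow> nat \<Rightarrow> 'k::comm_ring_1 mpoly \<Rightarrow> bool" where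
  "homogeneous_in V k p \<longleftrightarrow>
     (\<forall>m\<in>Poly_Mapping.keys p. (\<Sum>i\<in>Poly_Mapping.keys m \<inter> V. Poly_Mapping.lookup m i) = k)"

definition forms :: "nat set \<Rightarrow> nat \<Rightarrow> 'k::comm_ring_1 mpoly set" where
  "forms V k = {p. in_vars V p \<and> homogeneous_in V k p}"


section \<open>Affine and projective space\<close>

definition aff :: "nat \<Rightarrow> (nat \<Rightarrow> 'k::field) set" where
  "aff m = {v. \<forall>i\<ge>m. v i = 0}"

definition hvecs :: "nat \<Rightarrow> (nat \<Rightarrow> 'k::field) set" where
  "hvecs n = aff (n + 1) - {\<lambda>_. 0}"

type_synonym 'k ppoint = "(nat \<Rightarrow> 'k) set"

definition pt :: "(nat \<Rightarrow> 'k::field) \<Rightarrow> 'k ppoint" where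
  "pt v = {\<lambda>i. c * v i | c. c \<noteq> 0}"

definition proj_space :: "nat \<Rightarrow> 'k::field ppoint set" where
  "proj_space n = pt ` hvecs n"

definition proj_zeros :: "nat \<Rightarrow> 'k::field mpoly set \<Rightarrow> 'k ppoint set" where
  "proj_zeros n S = pt ` {v \<in> hvecs n. \<forall>F\<in>S. peval F v = 0}"

definition zariski_closed :: "nat \<Rightarrow> 'k::field ppoint set \<Rightarrow> bool" where
  "zariski_closed n Y \<longleftrightarrow> (\<exists>S \<subseteq> (\<Union>k. forms {..n} k). Y = proj_zeros n S)"

definition irreducible_closed :: "nat \<Rightarrow> 'k::field ppoint set \<Rightarrow> bool" where
  "irreducible_closed n X \<longleftrightarrow> zariski_closed n X \<and> X \<noteq> {} \<and>
     (\<forall>Y Z. zariski_closed n Y \<and> zariski_closed n Z \<and> X = Y \<union> Z \<longrightarrow> X = Y \<or> X = Z)"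

text \<open>The degree of a hypersurface is the degree of its reduced equation.\<close>

definition hypersurface :: "nat \<Rightarrow> nat \<Rightarrow> 'k::field ppoint set \<Rightarrow> bool" where
  "hypersurface n d X \<longleftrightarrow>
     d \<ge> 1 \<and> (\<exists>F\<in>forms {..n} d. squarefree F \<and> X = proj_zeros n {F})"

definition hyperplane :: "nat \<Rightarrow> 'k::field ppoint set \<Rightarrow> bool" where
  "hyperplane n X \<longleftrightarrow> (\<exists>F\<in>forms {..n} 1. F \<noteq> 0 \<and> X = proj_zeros n {F})"

definition affine_zariski_closure :: "nat \<Rightarrow> (nat \<Rightarrow> 'k::field) set \<Rightarrow> (nat \<Rightarrow> 'k) set" where
  "affine_zariski_closure m S =
     {v \<in> aff m. \<forall>p. in_vars {..<m} p \<and> (\<forall>w\<in>S. peval p w = 0) \<longrightarrow> peval p v = 0}"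


section \<open>Additive actions\<close>

definition join :: "nat \<Rightarrow> (nat \<Rightarrow> 'k) \<Rightarrow> (nat \<Rightarrow> 'k) \<Rightarrow> nat \<Rightarrow> 'k" where
  "join n x s i = (if i \<le> n then x i else s (i - (n + 1)))"

text \<open>
  A map \<open>\<alpha>\<close> from \<open>\<bbbK>\<^sup>m \<times> Y\<close> to \<open>\<bbbP>\<^sup>n\<close>, where \<open>Y \<subseteq> \<bbbP>\<^sup>n\<close>, is regular if near every point it is given by
  \<open>n + 1\<close> polynomials in the coordinates of both arguments, homogeneous of the same degree in the
  homogeneous coordinates and without common zero at that point. Multiplying these polynomials by
  a form in the homogeneous coordinates and the affine coordinates that vanishes off the given
  neighbourhood, one may ask that they compute \<open>\<alpha>\<close> wherever they do not all vanish.
\<close>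

definition regular_map :: "nat \<Rightarrow> nat \<Rightarrow> 'k::field ppoint set
    \<Rightarrow> ((nat \<Rightarrow> 'k) \<Rightarrow> 'k ppoint \<Rightarrow> 'k ppoint) \<Rightarrow> bool" where
  "regular_map m n Y \<alpha> \<longleftrightarrow>
     (\<forall>s\<^sub>0\<in>aff m. \<forall>x\<^sub>0\<in>hvecs n. pt x\<^sub>0 \<in> Y \<longrightarrow>
       (\<exists>k F. (\<forall>i\<le>n. in_vars {..n + m} (F i) \<and> homogeneous_in {..n} k (F i)) \<and>
          (\<exists>i\<le>n. peval (F i) (join n x\<^sub>0 s\<^sub>0) \<noteq> 0) \<and>
          (\<forall>s\<in>aff m. \<forall>x\<in>hvecs n.
             pt x \<in> Y \<and> (\<exists>i\<le>n. peval (F i) (join n x s) \<noteq> 0) \<longrightarrow>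
             \<alpha> s (pt x) = pt (\<lambda>i. if i \<le> n then peval (F i) (join n x s) else 0))))"

definition regular_Ga_action :: "nat \<Rightarrow> nat \<Rightarrow> 'k::field ppoint set
    \<Rightarrow> ((nat \<Rightarrow> 'k) \<Rightarrow> 'k ppoint \<Rightarrow> 'k ppoint) \<Rightarrow> bool" where
  "regular_Ga_action m n Y \<alpha> \<longleftrightarrow>
     (\<forall>s\<in>aff m. \<forall>x\<in>Y. \<alpha> s x \<in> Y) \<and>
     (\<forall>x\<in>Y. \<alpha> (\<lambda>_. 0) x = x) \<and>
     (\<forall>s\<in>aff m. \<forall>t\<in>aff m. \<forall>x\<in>Y. \<alpha> (\<lambda>i. s i + t i) x = \<alpha> s (\<alpha> t x)) \<and>
     regular_map m n Y \<alpha>"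

definition additive_action :: "nat \<Rightarrow> nat \<Rightarrow> 'k::field ppoint set
    \<Rightarrow> ((nat \<Rightarrow> 'k) \<Rightarrow> 'k ppoint \<Rightarrow> 'k ppoint) \<Rightarrow> bool" where
  "additive_action m n X \<alpha> \<longleftrightarrow>
     irreducible_closed n X \<and> regular_Ga_action m n X \<alpha> \<and>
     (\<forall>s\<in>aff m. (\<forall>x\<in>X. \<alpha> s x = x) \<longrightarrow> s = (\<lambda>_. 0)) \<and>
     (\<exists>x\<in>X. zariski_closed n (X - (\<lambda>s. \<alpha> s x) ` aff m))"

definition induced_additive_action :: "nat \<Rightarrow> 'k::field ppoint set
    \<Rightarrow> ((nat \<Rightarrow> 'k) \<Rightarrow> 'k ppoint \<Rightarrow> 'k ppoint) \<Rightarrow> bool" where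
  "induced_additive_action n X \<alpha> \<longleftrightarrow>
     additive_action (n - 1) n X \<alpha> \<and>
     (\<exists>\<beta>. regular_Ga_action (n - 1) n (proj_space n) \<beta> \<and>
        (\<forall>s\<in>aff (n - 1). \<forall>x\<in>X. \<beta> s x = \<alpha> s x))"


section \<open>\<open>H\<close>-pairs\<close>

definition is_ideal :: "'a::comm_ring_1 set \<Rightarrow> bool" where
  "is_ideal I \<longleftrightarrow> 0 \<in> I \<and> (\<forall>x\<in>I. \<forall>y\<in>I. x + y \<in> I) \<and> (\<forall>a. \<forall>x\<in>I. a * x \<in> I)"

definition is_maximal_ideal :: "'a::comm_ring_1 set \<Rightarrow> bool" where
  "is_maximal_ideal M \<longleftrightarrow> is_ideal M \<and> M \<noteq> UNIV \<and>
     (\<forall>I. is_ideal I \<and> M \<subseteq> I \<longrightarrow> I = M \<or> I = UNIV)"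

locale fin_dim_algebra = vector_space scale
  for scale :: "'k::field \<Rightarrow> 'a::comm_ring_1 \<Rightarrow> 'a" +
  assumes scale_mult: "scale c x * y = scale c (x * y)"
    and finite_spanning_set: "\<exists>B. finite B \<and> span B = UNIV"
begin

definition subalgebra :: "'a set \<Rightarrow> bool" where
  "subalgebra B \<longleftrightarrow> subspace B \<and> 1 \<in> B \<and> (\<forall>x\<in>B. \<forall>y\<in>B. x * y \<in> B)"

end

locale H_pair = fin_dim_algebra scale
  for scale :: "'k::field \<Rightarrow> 'a::comm_ring_1 \<Rightarrow> 'a" +
  fixes M U :: "'a set"
  assumes maximal_ideal: "is_maximal_ideal M"
    and local_ring: "is_maximal_ideal M' \<Longrightarrow> M' = M"
    and subspace_U: "subspace U"
    and U_subset: "U \<subseteq> M"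
    and hyperplane_U: "dim M = dim U + 1"
    and generating: "subalgebra B \<Longrightarrow> U \<subseteq> B \<Longrightarrow> B = UNIV"

text \<open>The exponential and logarithm series; for nilpotent \<open>x\<close> the sums are finite.\<close>

definition nil_exp :: "('k::field_char_0 \<Rightarrow> 'a::comm_ring_1 \<Rightarrow> 'a) \<Rightarrow> 'a \<Rightarrow> 'a" where
  "nil_exp scale x = (\<Sum>k | x ^ k \<noteq> 0. scale (1 / fact k) (x ^ k))"

definition nil_ln1p :: "('k::field_char_0 \<Rightarrow> 'a::comm_ring_1 \<Rightarrow> 'a) \<Rightarrow> 'a \<Rightarrow> 'a" where
  "nil_ln1p scale x = (\<Sum>k | k \<ge> 1 \<and> x ^ k \<noteq> 0. scale ((-1) ^ (k - 1) / of_nat k) (x ^ k))"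

text \<open>A basis \<open>e 1, \<dots>, e n\<close> of the maximal ideal gives coordinates \<open>z\<^sub>1, \<dots>, z\<^sub>n\<close> on it, and
  together with the unit it gives the identification \<open>from_coords\<close> of \<open>\<bbbK>\<^bsup>n + 1\<^esup>\<close> with the algebra.\<close>

definition basis_of :: "('k::field \<Rightarrow> 'a::comm_ring_1 \<Rightarrow> 'a) \<Rightarrow> nat \<Rightarrow> (nat \<Rightarrow> 'a) \<Rightarrow> 'a set \<Rightarrow> bool"
  where "basis_of scale n e M \<longleftrightarrow>
     inj_on e {1..n} \<and> \<not> module.dependent scale (e ` {1..n}) \<and> module.span scale (e ` {1..n}) = M"

definition ideal_part :: "('k \<Rightarrow> 'a::comm_ring_1 \<Rightarrow> 'a) \<Rightarrow> nat \<Rightarrow> (nat \<Rightarrow> 'a) \<Rightarrow> (nat \<Rightarrow> 'k) \<Rightarrow> 'a"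
  where "ideal_part scale n e v = (\<Sum>i=1..n. scale (v i) (e i))"

definition from_coords :: "('k \<Rightarrow> 'a::comm_ring_1 \<Rightarrow> 'a) \<Rightarrow> nat \<Rightarrow> (nat \<Rightarrow> 'a) \<Rightarrow> (nat \<Rightarrow> 'k) \<Rightarrow> 'a"
  where "from_coords scale n e v = scale (v 0) 1 + ideal_part scale n e v"

text \<open>The pair \<open>(X, \<alpha>)\<close> is the one given by the \<open>H\<close>-pair \<open>(A, U)\<close>: \<open>X\<close> is the projectivization of
  the closure of \<open>\<bbbK>\<^sup>\<times> exp U\<close>, and \<open>\<alpha>\<close> becomes multiplication by \<open>exp U\<close> under a linear
  isomorphism \<open>\<tau>\<close> of the acting group with \<open>U\<close>.\<close>

definition corresponds_to_H_pair :: "('k::field_char_0 \<Rightarrow> 'a::comm_ring_1 \<Rightarrow> 'a) \<Rightarrow> nat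
    \<Rightarrow> (nat \<Rightarrow> 'a) \<Rightarrow> 'a set \<Rightarrow> 'k ppoint set
    \<Rightarrow> ((nat \<Rightarrow> 'k) \<Rightarrow> 'k ppoint \<Rightarrow> 'k ppoint) \<Rightarrow> bool" where
  "corresponds_to_H_pair scale n e U X \<alpha> \<longleftrightarrow>
     X = pt ` (affine_zariski_closure (n + 1)
           {v \<in> hvecs n. \<exists>c u. c \<noteq> 0 \<and> u \<in> U \<and>
              from_coords scale n e v = scale c (nil_exp scale u)} \<inter> hvecs n) \<and>
     (\<exists>\<tau>. bij_betw \<tau> (aff (n - 1)) U \<and>
        (\<forall>s\<in>aff (n - 1). \<forall>t\<in>aff (n - 1). \<tau> (\<lambda>i. s i + t i) = \<tau> s + \<tau> t) \<and>
        (\<forall>c. \<forall>s\<in>aff (n - 1). \<tau> (\<lambda>i. c * s i) = scale c (\<tau> s)) \<and>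
        (\<forall>s\<in>aff (n - 1). \<forall>v\<in>hvecs n. \<forall>w\<in>hvecs n. pt v \<in> X \<and>
           from_coords scale n e w = nil_exp scale (\<tau> s) * from_coords scale n e v \<longrightarrow>
           \<alpha> s (pt v) = pt w))"

text \<open>The projection \<open>\<pi>\<close> of \<open>M\<close> onto \<open>M / U\<close>, the latter identified with \<open>\<bbbK>\<close>; only its values
  on \<open>M\<close> matter.\<close>

definition quotient_projection :: "('k::field \<Rightarrow> 'a::comm_ring_1 \<Rightarrow> 'a) \<Rightarrow> 'a set \<Rightarrow> 'a set
    \<Rightarrow> ('a \<Rightarrow> 'k) \<Rightarrow> bool" where
  "quotient_projection scale M U \<pi> \<longleftrightarrow>
     (\<forall>x\<in>M. \<forall>y\<in>M. \<pi> (x + y) = \<pi> x + \<pi> y) \<and> (\<forall>c. \<forall>x\<in>M. \<pi> (scale c x) = c * \<pi> x) \<and>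
     \<pi> ` M = UNIV \<and> {x \<in> M. \<pi> x = 0} = U"


section \<open>Normality\<close>

definition nonvanishing_on :: "nat \<Rightarrow> 'k::field ppoint set \<Rightarrow> 'k mpoly \<Rightarrow> bool" where
  "nonvanishing_on n Z G \<longleftrightarrow> (\<exists>v\<in>hvecs n. pt v \<in> Z \<and> peval G v \<noteq> 0)"

text \<open>Functions on \<open>X\<close> that are given by a quotient of two forms of equal degree wherever the
  denominator, which does not vanish identically on \<open>Z\<close>, is nonzero. For \<open>Z = X\<close> these are the
  rational functions on \<open>X\<close>, and for \<open>Z = {x}\<close> the rational functions that are regular at \<open>x\<close>; in
  both cases with arbitrary values outside a nonempty open set.\<close>

definition fractions :: "nat \<Rightarrow> 'k::field ppoint set \<Rightarrow> 'k ppoint set \<Rightarrow> ('k ppoint \<Rightarrow> 'k) set" where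
  "fractions n X Z = {h. \<exists>k. \<exists>F\<in>forms {..n} k. \<exists>G\<in>forms {..n} k. nonvanishing_on n Z G \<and>
     (\<forall>v\<in>hvecs n. pt v \<in> X \<and> peval G v \<noteq> 0 \<longrightarrow> h (pt v) = peval F v / peval G v)}"

definition rational_map_ring :: "nat \<Rightarrow> 'k::field ppoint set \<Rightarrow> ('k ppoint \<Rightarrow> 'k) ring" where
  "rational_map_ring n X =
     \<lparr>carrier = fractions n X X, mult = (\<lambda>g h x. g x * h x), one = (\<lambda>_. 1),
      zero = (\<lambda>_. 0), add = (\<lambda>g h x. g x + h x)\<rparr>"

definition generically_zero :: "nat \<Rightarrow> 'k::field ppoint set \<Rightarrow> ('k ppoint \<Rightarrow> 'k) set" where
  "generically_zero n X = {h \<in> fractions n X X. \<exists>k. \<exists>G\<in>forms {..n} k. nonvanishing_on n X G \<and>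
     (\<forall>v\<in>hvecs n. pt v \<in> X \<and> peval G v \<noteq> 0 \<longrightarrow> h (pt v) = 0)}"

text \<open>The field of rational functions of an irreducible \<open>X\<close>, and the local rings of \<open>X\<close> as
  subrings of it; it is the field of fractions of each of them.\<close>

definition function_field :: "nat \<Rightarrow> 'k::field ppoint set \<Rightarrow> ('k ppoint \<Rightarrow> 'k) set ring" where
  "function_field n X = rational_map_ring n X Quot generically_zero n X"

definition local_ring_at :: "nat \<Rightarrow> 'k::field ppoint set \<Rightarrow> 'k ppoint \<Rightarrow> ('k ppoint \<Rightarrow> 'k) set set"
  where "local_ring_at n X x =
     (\<lambda>h. generically_zero n X +>\<^bsub>rational_map_ring n X\<^esub> h) ` fractions n X {x}"

definition integral_over :: "('r, 'm) ring_scheme \<Rightarrow> 'r set \<Rightarrow> 'r \<Rightarrow> bool" where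
  "integral_over L S r \<longleftrightarrow> (\<exists>(N::nat) c. (\<forall>i<N. c i \<in> S) \<and>
     r [^]\<^bsub>L\<^esub> N \<oplus>\<^bsub>L\<^esub> (\<Oplus>\<^bsub>L\<^esub>i\<in>{..<N}. c i \<otimes>\<^bsub>L\<^esub> r [^]\<^bsub>L\<^esub> i) = \<zero>\<^bsub>L\<^esub>)"

definition integrally_closed_in :: "('r, 'm) ring_scheme \<Rightarrow> 'r set \<Rightarrow> bool" where
  "integrally_closed_in L S \<longleftrightarrow> (\<forall>r\<in>carrier L. integral_over L S r \<longrightarrow> r \<in> S)"

definition normal_variety :: "nat \<Rightarrow> 'k::field ppoint set \<Rightarrow> bool" where
  "normal_variety n X \<longleftrightarrow> irreducible_closed n X \<and>
     (\<forall>x\<in>X. integrally_closed_in (function_field n X) (local_ring_at n X x))"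

end

theory Submission
  imports Defs
begin

text \<open>
  The chart \<open>z\<^sub>0 = 1\<close> of \<open>X\<close> is isomorphic to \<open>U\<close> by the logarithm, so its coordinate ring is a polynomial
  ring, which is factorial and therefore integrally closed. Hence an element \<open>r\<close> of the function field
  that is integral over the local ring at a point \<open>x\<close> can be written as \<open>C / (z\<^sub>0\<^sup>k D)\<close> with \<open>D(x) \<noteq> 0\<close>. If
  \<open>k > 0\<close> and \<open>x\<close> lies at infinity, the integral equation gives \<open>E C\<^sup>N \<in> (z\<^sub>0, f)\<close> for some \<open>E\<close> with \<open>E(x) \<noteq> 0\<close>,
  that is, \<open>f\<^sub>d\<close> divides \<open>E C\<^sup>N\<close> modulo \<open>z\<^sub>0\<close>. Since \<open>f\<^sub>d\<close> is square-free, \<open>g C \<in> (z\<^sub>0, f)\<close> already for some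
  factor \<open>g\<close> of \<open>E\<close> modulo \<open>z\<^sub>0\<close>, so \<open>k\<close> can be lowered by one.
\<close>

section \<open>Multivariate polynomials\<close>

text \<open>The chart is polynomial because the maximal ideal is nilpotent: exp and ln are then
  finite sums, hence mutually inverse polynomial maps. On the chart f is \<pi> composed with ln, so
  in logarithmic coordinates whose first one is \<pi> the hypersurface becomes a coordinate
  hyperplane. No such chart is at hand near the points at infinity, so the question there is reduced
  to divisibility among forms. A form that vanishes on the chart is itself a multiple of f, and not
  merely after multiplication by a power of z_0, since f_d \<noteq> 0 keeps z_0 from dividing f. E
  is a common denominator of the coefficients of the integral equation. Once that equation is
  cleared of denominators, every term except E C^N carries a positive power of z_0, which is why
  only this term survives modulo z_0. If f_d had a repeated factor, divisibility of E C^N would say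
  too little about C itself.\<close>

definition Const :: "'k::comm_ring_1 \<Rightarrow> 'k mpoly" where
  "Const c = Poly_Mapping.single 0 c"

section \<open>Evaluation homomorphisms out of the polynomial ring\<close>

definition coeff_hom :: "('k::comm_ring_1 \<Rightarrow> 'b::comm_ring_1) \<Rightarrow> bool" where
  "coeff_hom c \<longleftrightarrow> c 0 = 0 \<and> c 1 = 1 \<and> (\<forall>a b. c (a + b) = c a + c b) \<and> (\<forall>a b. c (a * b) = c a * c b)"

definition monval :: "(nat \<Rightarrow> 'b::comm_ring_1) \<Rightarrow> (nat \<Rightarrow>\<^sub>0 nat) \<Rightarrow> 'b" where
  "monval v m = (\<Prod>i\<in>Poly_Mapping.keys m. v i ^ Poly_Mapping.lookup m i)"

text \<open>Universal property of the polynomial ring. \<open>peval\<close>, \<open>subst\<close>,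
  \<open>wrt\<close> and \<open>graded\<close> are all instances, so the homomorphism laws are
  proved once.\<close>

definition mev :: "('k::comm_ring_1 \<Rightarrow> 'b::comm_ring_1) \<Rightarrow> (nat \<Rightarrow> 'b) \<Rightarrow> 'k mpoly \<Rightarrow> 'b" where
  "mev c v p = (\<Sum>m\<in>Poly_Mapping.keys p. c (Poly_Mapping.lookup p m) * monval v m)"

lemma peval_eq_mev: "peval p v = mev id v p"
  by (simp add: peval_def mev_def monval_def)

lemma monval_superset:
  assumes "finite S" "Poly_Mapping.keys m \<subseteq> S"
  shows "monval v m = (\<Prod>i\<in>S. v i ^ Poly_Mapping.lookup m i)"
  unfolding monval_def using assms
  by (intro prod.mono_neutral_left) (auto simp: in_keys_iff)

lemma monval_0 [simp]: "monval v 0 = 1"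
  by (simp add: monval_def)

lemma monval_add: "monval v (m + m') = monval v m * monval v m'"
proof -
  let ?S = "Poly_Mapping.keys m \<union> Poly_Mapping.keys m'"
  have "Poly_Mapping.keys (m + m') \<subseteq> ?S" by (rule keys_add)
  then have "monval v (m + m') = (\<Prod>i\<in>?S. v i ^ Poly_Mapping.lookup (m + m') i)"
    by (intro monval_superset) auto
  also have "\<dots> = (\<Prod>i\<in>?S. v i ^ Poly_Mapping.lookup m i) * (\<Prod>i\<in>?S. v i ^ Poly_Mapping.lookup m' i)"
    by (simp add: lookup_add power_add prod.distrib)
  also have "\<dots> = monval v m * monval v m'"
    by (subst (1 2) monval_superset[of ?S]) auto
  finally show ?thesis .
qed

lemma monval_single [simp]: "monval v (Poly_Mapping.single i k) = v i ^ k"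
  by (cases "k = 0") (simp_all add: monval_def)

lemma mev_superset:
  assumes "coeff_hom c" "finite S" "Poly_Mapping.keys p \<subseteq> S"
  shows "mev c v p = (\<Sum>m\<in>S. c (Poly_Mapping.lookup p m) * monval v m)"
  unfolding mev_def using assms
  by (intro sum.mono_neutral_left) (auto simp: in_keys_iff coeff_hom_def)

lemma mev_0 [simp]: "mev c v 0 = 0"
  by (simp add: mev_def)

lemma mev_add: assumes "coeff_hom c" shows "mev c v (p + q) = mev c v p + mev c v q"
proof -
  let ?S = "Poly_Mapping.keys p \<union> Poly_Mapping.keys q"
  have "Poly_Mapping.keys (p + q) \<subseteq> ?S" by (rule keys_add)
  then have "mev c v (p + q) = (\<Sum>m\<in>?S. c (Poly_Mapping.lookup (p + q) m) * monval v m)"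
    by (intro mev_superset assms) auto
  also have "\<dots> = (\<Sum>m\<in>?S. c (Poly_Mapping.lookup p m) * monval v m)
      + (\<Sum>m\<in>?S. c (Poly_Mapping.lookup q m) * monval v m)"
    using assms by (simp add: lookup_add coeff_hom_def ring_distribs sum.distrib)
  also have "\<dots> = mev c v p + mev c v q"
    by (subst (1 2) mev_superset[of c ?S, OF assms]) auto
  finally show ?thesis .
qed

lemma mev_single:
  assumes "coeff_hom c" shows "mev c v (Poly_Mapping.single m a) = c a * monval v m"
  using assms by (cases "a = 0") (simp_all add: mev_def coeff_hom_def)

lemma mpoly_sum_single:
  "p = (\<Sum>m\<in>Poly_Mapping.keys p. Poly_Mapping.single m (Poly_Mapping.lookup p m))"
  by (rule poly_mapping_eqI)
    (simp add: lookup_sum lookup_single when_def in_keys_iff)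

lemma mpoly_induct_single [case_names zero add]:
  assumes "P 0" "\<And>m a p. P p \<Longrightarrow> P (p + Poly_Mapping.single m a)"
  shows "P (p :: 'k::comm_ring_1 mpoly)"
proof -
  have "P (\<Sum>m\<in>S. Poly_Mapping.single m (Poly_Mapping.lookup p m))" if "finite S" for S
    using that by induction (simp_all add: assms add.commute[of "Poly_Mapping.single _ _"])
  then show ?thesis by (subst mpoly_sum_single) simp
qed

lemma mev_mult: assumes c: "coeff_hom c" shows "mev c v (p * q) = mev c v p * mev c v q"
proof (induction p rule: mpoly_induct_single)
  case zero then show ?case by simp
next
  case (add m a p)
  have "mev c v (Poly_Mapping.single m a * q) = c a * monval v m * mev c v q" for m a
  proof (induction q rule: mpoly_induct_single)
    case zero then show ?case by simp
  next
    case (add m' b q)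
    have "mev c v (Poly_Mapping.single m a * Poly_Mapping.single m' b) = c a * monval v m * (c b * monval v m')"
      using c by (simp add: mult_single mev_single monval_add coeff_hom_def mult_ac)
    then show ?case using add by (simp add: ring_distribs mev_add[OF c] mev_single[OF c])
  qed
  then show ?case using add by (simp add: ring_distribs mev_add[OF c] mev_single[OF c])
qed

lemma mev_1: "coeff_hom c \<Longrightarrow> mev c v 1 = 1"
  using mev_single[of c v 0 1] by (simp add: coeff_hom_def)

lemma mev_Const: "coeff_hom c \<Longrightarrow> mev c v (Const a) = c a"
  by (simp add: Const_def mev_single)

lemma mev_Var: "coeff_hom c \<Longrightarrow> mev c v (Var i) = v i"
  by (simp add: Var_def mev_single coeff_hom_def)

lemma mev_diff: assumes c: "coeff_hom c" shows "mev c v (p - q) = mev c v p - mev c v q"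
  using mev_add[OF c, of v "p - q" q] by simp

lemma mev_power: "coeff_hom c \<Longrightarrow> mev c v (p ^ k) = mev c v p ^ k"
  by (induction k) (simp_all add: mev_1 mev_mult)

lemma mev_sum: "coeff_hom c \<Longrightarrow> mev c v (sum g S) = (\<Sum>s\<in>S. mev c v (g s))"
  by (induction S rule: infinite_finite_induct) (simp_all add: mev_add)

lemma mev_prod: "coeff_hom c \<Longrightarrow> mev c v (prod g S) = (\<Prod>s\<in>S. mev c v (g s))"
  by (induction S rule: infinite_finite_induct) (simp_all add: mev_1 mev_mult)

lemmas mev_simps = mev_add mev_mult mev_1 mev_Const mev_Var mev_diff mev_power mev_sum mev_prod

lemma monval_cong: "(\<And>i. i \<in> Poly_Mapping.keys m \<Longrightarrow> v i = w i) \<Longrightarrow> monval v m = monval w m"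
  by (simp add: monval_def)

lemma mev_cong:
  assumes "in_vars V p" "\<And>i. i \<in> V \<Longrightarrow> v i = w i"
  shows "mev c v p = mev c w p"
  unfolding mev_def using assms
  by (intro sum.cong arg_cong2[where f = "(*)"] monval_cong refl) (auto simp: in_vars_def)

lemma coeff_hom_id [simp]: "coeff_hom id"
  by (simp add: coeff_hom_def)

lemma Const_0 [simp]: "Const 0 = 0" and Const_1 [simp]: "Const 1 = 1"
  and Const_add: "Const (a + b) = Const a + Const b" and Const_mult: "Const (a * b) = Const a * Const b"
  by (simp_all add: Const_def single_add mult_single)

lemma coeff_hom_Const [simp]: "coeff_hom Const"
  by (simp add: coeff_hom_def Const_add Const_mult)

lemma coeff_hom_const_poly [simp]: "coeff_hom (\<lambda>a. [:Const a:])"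
  by (simp add: coeff_hom_def Const_add Const_mult)

lemma mev_hom_comp:
  assumes "coeff_hom c" "coeff_hom g"
  shows "g (mev c v p) = mev (g \<circ> c) (g \<circ> v) p"
proof -
  have gs: "g (sum a S) = (\<Sum>s\<in>S. g (a s))" for a and S :: "(nat \<Rightarrow>\<^sub>0 nat) set"
    using assms(2) by (induction S rule: infinite_finite_induct) (auto simp: coeff_hom_def)
  have gpow: "g (x ^ k) = g x ^ k" for x k
    using assms(2) by (induction k) (auto simp: coeff_hom_def)
  have gp: "g (prod a S) = (\<Prod>s\<in>S. g (a s))" for a and S :: "nat set"
    using assms(2) by (induction S rule: infinite_finite_induct) (auto simp: coeff_hom_def)
  have "g (a * b) = g a * g b" for a b using assms(2) by (simp add: coeff_hom_def)
  then show ?thesis by (simp add: mev_def gs monval_def gp gpow)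
qed

subsection \<open>Variables and substitution\<close>

lemma in_vars_0 [simp]: "in_vars V 0" and in_vars_1 [simp]: "in_vars V 1"
  and in_vars_Const [simp]: "in_vars V (Const a)"
  by (simp_all add: in_vars_def Const_def)

lemma in_vars_Var: "i \<in> V \<Longrightarrow> in_vars V (Var i)"
  by (simp add: in_vars_def Var_def)

lemma in_vars_mono: "in_vars V p \<Longrightarrow> V \<subseteq> W \<Longrightarrow> in_vars W p"
  by (auto simp: in_vars_def)

lemma in_vars_add: "in_vars V p \<Longrightarrow> in_vars V q \<Longrightarrow> in_vars V (p + q)"
  using keys_add[of p q] by (auto simp: in_vars_def)

lemma in_vars_uminus: "in_vars V p \<Longrightarrow> in_vars V (- p)"
  by (simp add: in_vars_def in_keys_iff)

lemma in_vars_diff: "in_vars V p \<Longrightarrow> in_vars V q \<Longrightarrow> in_vars V (p - q)"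
  using in_vars_add[OF _ in_vars_uminus, of V p q] by simp

lemma in_vars_mult: "in_vars V p \<Longrightarrow> in_vars V q \<Longrightarrow> in_vars V (p * q)"
  unfolding in_vars_def
proof
  fix m assume *: "\<forall>m\<in>Poly_Mapping.keys p. Poly_Mapping.keys m \<subseteq> V"
    "\<forall>m\<in>Poly_Mapping.keys q. Poly_Mapping.keys m \<subseteq> V" "m \<in> Poly_Mapping.keys (p * q)"
  then obtain a b where "m = a + b" "a \<in> Poly_Mapping.keys p" "b \<in> Poly_Mapping.keys q"
    using keys_mult[of p q] by blast
  then show "Poly_Mapping.keys m \<subseteq> V" using * keys_add[of a b] by blast
qed

lemma in_vars_power: "in_vars V p \<Longrightarrow> in_vars V (p ^ k)"
  by (induction k) (simp_all add: in_vars_mult)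

lemma in_vars_sum: "(\<And>s. s \<in> S \<Longrightarrow> in_vars V (g s)) \<Longrightarrow> in_vars V (sum g S)"
  by (induction S rule: infinite_finite_induct) (simp_all add: in_vars_add)

lemma in_vars_prod: "(\<And>s. s \<in> S \<Longrightarrow> in_vars V (g s)) \<Longrightarrow> in_vars V (prod g S)"
  by (induction S rule: infinite_finite_induct) (simp_all add: in_vars_mult)

lemma ex_finite_in_vars: "\<exists>V. finite V \<and> in_vars V p"
  by (rule exI[of _ "\<Union>(Poly_Mapping.keys ` Poly_Mapping.keys p)"]) (auto simp: in_vars_def)

abbreviation subst :: "(nat \<Rightarrow> 'k::comm_ring_1 mpoly) \<Rightarrow> 'k mpoly \<Rightarrow> 'k mpoly" where
  "subst \<equiv> mev Const"

lemma in_vars_subst: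
  assumes "in_vars V p" "\<And>i. i \<in> V \<Longrightarrow> in_vars W (\<sigma> i)"
  shows "in_vars W (subst \<sigma> p)"
  unfolding mev_def monval_def using assms
  by (intro in_vars_sum in_vars_mult in_vars_prod in_vars_power) (auto simp: in_vars_def[of V])

lemma peval_simps:
  "peval (p + q) v = peval p v + peval q v" "peval (p * q) v = peval p v * peval q v"
  "peval 0 v = 0" "peval 1 v = 1" "peval (Const a) v = a" "peval (Var i) v = v i"
  "peval (p - q) v = peval p v - peval q v" "peval (p ^ k) v = peval p v ^ k"
  by (simp_all add: peval_eq_mev mev_simps)

lemma Var_neq_0 [simp]: "Var i \<noteq> (0 :: 'k::comm_ring_1 mpoly)"
proof
  assume "Var i = (0 :: 'k mpoly)"
  then have "peval (Var i) (\<lambda>_. 1 :: 'k) = 0" by (simp only: peval_simps)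
  then show False by (simp add: peval_simps)
qed

lemma peval_sum: "peval (sum g S) v = (\<Sum>s\<in>S. peval (g s) v)"
  and peval_prod: "peval (prod g S) v = (\<Prod>s\<in>S. peval (g s) v)"
  by (simp_all add: peval_eq_mev mev_simps)

lemma peval_subst: "peval (subst \<sigma> p) v = peval p (\<lambda>i. peval (\<sigma> i) v)"
proof -
  have "coeff_hom (\<lambda>q. peval q v)" by (simp add: coeff_hom_def peval_simps)
  from mev_hom_comp[OF coeff_hom_Const this, of \<sigma> p]
  have "peval (subst \<sigma> p) v = mev (\<lambda>a. a) (\<lambda>i. peval (\<sigma> i) v) p"
    unfolding comp_def by (simp only: peval_simps)
  then show ?thesis by (simp only: peval_eq_mev[of p] id_def)
qed

lemma peval_cong: "in_vars V p \<Longrightarrow> (\<And>i. i \<in> V \<Longrightarrow> v i = w i) \<Longrightarrow> peval p v = peval p w"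
  unfolding peval_eq_mev by (rule mev_cong)

lemma mpoly_induct [case_names Const Var add mult]:
  fixes p :: "'k::comm_ring_1 mpoly"
  assumes C: "\<And>c. P (Const c)" and V: "\<And>i. P (Var i)"
    and add: "\<And>p q. P p \<Longrightarrow> P q \<Longrightarrow> P (p + q)" and mult: "\<And>p q. P p \<Longrightarrow> P q \<Longrightarrow> P (p * q)"
  shows "P p"
proof -
  have pow: "P (q ^ k)" if "P q" for q k
    using that C[of 1] by (induction k) (auto intro: mult)
  have single_power: "Poly_Mapping.single (Poly_Mapping.single i k) 1 = Var i ^ k" for i k
  proof (induction k)
    case (Suc k)
    have "Poly_Mapping.single i (Suc k) = Poly_Mapping.single i 1 + Poly_Mapping.single i k"
      by (simp flip: single_add)
    then show ?case
      by (simp only: power_Suc Suc[symmetric]) (simp add: Var_def mult_single)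
  qed simp
  have mon: "P (Poly_Mapping.single m 1)" for m
  proof -
    have "P (Poly_Mapping.single (\<Sum>i\<in>S. Poly_Mapping.single i (Poly_Mapping.lookup m i)) 1)" if "finite S" for S
      using that
    proof induction
      case empty then show ?case using C[of 1] by (simp add: Const_def)
    next
      case (insert i S)
      then have "P (Var i ^ Poly_Mapping.lookup m i * Poly_Mapping.single (\<Sum>i\<in>S. Poly_Mapping.single i (Poly_Mapping.lookup m i)) 1)"
        by (intro mult pow V)
      with insert show ?case by (simp add: mult_single flip: single_power)
    qed
    moreover have "m = (\<Sum>i\<in>Poly_Mapping.keys m. Poly_Mapping.single i (Poly_Mapping.lookup m i))"
      by (rule poly_mapping_eqI) (simp add: lookup_sum lookup_single when_def in_keys_iff)
    ultimately show ?thesis by (metis finite_keys)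
  qed
  have single: "P (Poly_Mapping.single m a)" for m a
    using mult[OF C[of a] mon[of m]] by (simp add: Const_def mult_single)
  show ?thesis
    by (induction p rule: mpoly_induct_single) (use C[of 0] in \<open>auto intro: add single\<close>)
qed

text \<open>Uniqueness half of the universal property. Here \<open>coeff_hom\<close> is applied to
  maps on polynomials, not only on coefficients; composites such as evaluation after
  \<open>wrt\<close> are identified by their values on constants and variables.\<close>

lemma hom_eqI:
  fixes g h :: "'k::comm_ring_1 mpoly \<Rightarrow> 'b::comm_ring_1"
  assumes "coeff_hom g" "coeff_hom h" "\<And>c. g (Const c) = h (Const c)" "\<And>i. g (Var i) = h (Var i)"
  shows "g p = h p"
  by (induction p rule: mpoly_induct) (use assms in \<open>auto simp: coeff_hom_def\<close>)

lemma coeff_hom_mev [simp]: "coeff_hom c \<Longrightarrow> coeff_hom (mev c v)"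
  by (simp add: coeff_hom_def[of "mev c v"] mev_simps)

lemma coeff_hom_comp: "coeff_hom g \<Longrightarrow> coeff_hom h \<Longrightarrow> coeff_hom (\<lambda>x. g (h x))"
  by (simp add: coeff_hom_def)

lemma coeff_hom_poly [simp]: "coeff_hom (\<lambda>q. poly q a)"
  by (simp add: coeff_hom_def)

lemma coeff_hom_pCons [simp]: "coeff_hom (\<lambda>q. [:q:])"
  by (simp add: coeff_hom_def)

lemma subst_Var_ident [simp]: "subst Var p = p"
  using hom_eqI[of "subst Var" "\<lambda>q. q" p] by (simp add: mev_simps coeff_hom_def[of "\<lambda>q. q"])

section \<open>Polynomials viewed in one distinguished variable\<close>

lemma in_vars_iff: "in_vars V p \<longleftrightarrow> (\<forall>x. x \<notin> V \<longrightarrow> in_vars (- {x}) p)"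
  unfolding in_vars_def by blast

text \<open>The other variables become coefficients, but the coefficient type remains that of all
  polynomials. \<open>in_vars_coeff_wrt\<close> records that x has disappeared from them, and
  putting \<open>Var x\<close> for the indeterminate recovers p.\<close>

definition wrt :: "nat \<Rightarrow> 'k::comm_ring_1 mpoly \<Rightarrow> 'k mpoly poly" where
  "wrt x = mev (\<lambda>a. [:Const a:]) (\<lambda>i. if i = x then [:0, 1:] else [:Var i:])"

lemma coeff_hom_wrt [simp]: "coeff_hom (wrt x)"
  by (simp add: wrt_def)

lemma wrt_mult: "wrt x (p * q) = wrt x p * wrt x q"
  and wrt_diff: "wrt x (p - q) = wrt x p - wrt x q"
  and wrt_0 [simp]: "wrt x 0 = 0"
  by (simp_all add: wrt_def mev_simps)

lemma wrt_Var_power: "wrt x (Var x ^ k) = monom 1 k"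
  by (simp add: wrt_def mev_simps monom_altdef)

lemma poly_wrt: "poly (wrt x p) q = subst (Var(x := q)) p"
  by (rule hom_eqI[OF coeff_hom_comp[OF coeff_hom_poly coeff_hom_wrt] coeff_hom_mev[OF coeff_hom_Const]])
    (simp_all add: wrt_def mev_simps)

lemma poly_wrt_Var [simp]: "poly (wrt x p) (Var x) = p"
  using poly_wrt[of x p "Var x"] by simp

lemma wrt_eq_0_iff [simp]: "wrt x p = 0 \<longleftrightarrow> p = 0"
  using poly_wrt_Var[of x p] by (metis wrt_0 poly_0)

lemma wrt_const: assumes "in_vars (- {x}) p" shows "wrt x p = [:p:]"
proof -
  have "wrt x p = mev (\<lambda>a. [:Const a:]) (\<lambda>i. [:Var i:]) p"
    unfolding wrt_def using assms by (rule mev_cong) auto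
  also have "\<dots> = [:p:]"
    by (rule hom_eqI[OF coeff_hom_mev[OF coeff_hom_const_poly] coeff_hom_pCons]) (simp_all add: mev_simps)
  finally show ?thesis .
qed

lemma in_vars_coeff_wrt:
  fixes p :: "'k::comm_ring_1 mpoly"
  assumes "in_vars V p" shows "in_vars (V - {x}) (coeff (wrt x p) j)"
proof -
  \<comment> \<open>The polynomials satisfying \<open>C\<close> form a subring, so it suffices that
    it contains the images of the constants and of the variables in \<open>V\<close>.\<close>
  define C where "C q \<longleftrightarrow> (\<forall>j. in_vars (V - {x}) (coeff q j))" for q :: "'k mpoly poly"
  have mult: "C (a * b)" if "C a" "C b" for a b
    using that by (auto simp: C_def coeff_mult intro!: in_vars_sum in_vars_mult)
  have one: "C 1" by (simp add: C_def coeff_1)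
  have power: "C (a ^ k)" if "C a" for a k
    using that by (induction k) (auto intro: mult one)
  have prod: "C (prod g S)" if "\<And>i. i \<in> S \<Longrightarrow> C (g i)" for g and S :: "nat set"
    using that by (induction S rule: infinite_finite_induct) (auto intro: mult one)
  have sum: "C (sum g S)" if "\<And>i. i \<in> S \<Longrightarrow> C (g i)" for g and S :: "(nat \<Rightarrow>\<^sub>0 nat) set"
    using that by (auto simp: C_def coeff_sum intro!: in_vars_sum)
  have const: "C [:q:]" if "in_vars (V - {x}) q" for q
    using that by (auto simp: C_def coeff_pCons split: nat.splits)
  have X: "C [:0, 1:]"
    by (auto simp: C_def coeff_pCons split: nat.splits)
  have "C (wrt x p)"
    unfolding wrt_def mev_def monval_def
    using assms by (intro sum mult prod power) (auto simp: in_vars_def[of V] intro!: X const in_vars_Var)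
  then show ?thesis by (simp add: C_def)
qed

lemma degree_wrt_eq_0_iff: "Polynomial.degree (wrt x p) = 0 \<longleftrightarrow> in_vars (- {x}) p"
proof
  assume "Polynomial.degree (wrt x p) = 0"
  then have "wrt x p = [:coeff (wrt x p) 0:]" using degree_0_id by metis
  then have "p = coeff (wrt x p) 0"
    using poly_wrt_Var[of x p] by (metis poly_pCons poly_0 mult_zero_right add.right_neutral)
  moreover have "in_vars (UNIV - {x}) (coeff (wrt x p) 0)"
    by (rule in_vars_coeff_wrt) (simp add: in_vars_def)
  ultimately show "in_vars (- {x}) p" by (simp add: Compl_eq_Diff_UNIV)
qed (simp add: wrt_const)

text \<open>Over a domain the degree in each single variable is additive, so a variable absent from
  a nonzero product is absent from its factors.\<close>

lemma in_vars_factor: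
  fixes p q :: "'k::idom mpoly"
  assumes "in_vars V (p * q)" "p * q \<noteq> 0" shows "in_vars V p"
proof (subst in_vars_iff, safe)
  fix x assume "x \<notin> V"
  then have "Polynomial.degree (wrt x (p * q)) = 0"
    using assms(1) in_vars_iff degree_wrt_eq_0_iff by blast
  moreover have "Polynomial.degree (wrt x (p * q)) = Polynomial.degree (wrt x p) + Polynomial.degree (wrt x q)"
    using assms(2) by (simp add: wrt_mult degree_mult_eq)
  ultimately show "in_vars (- {x}) p" by (simp add: degree_wrt_eq_0_iff)
qed

lemma in_vars_dvd:
  fixes p q :: "'k::idom mpoly"
  shows "in_vars V q \<Longrightarrow> q \<noteq> 0 \<Longrightarrow> p dvd q \<Longrightarrow> in_vars V p"
  by (auto simp: dvd_def intro: in_vars_factor)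

lemma Var_dvd_if_subst_0:
  assumes "subst (Var(x := 0)) p = 0" shows "Var x dvd p"
proof -
  have "poly (wrt x p) 0 = 0" using assms poly_wrt[of x p 0] by simp
  then obtain q where "wrt x p = [:0, 1:] * q" by (auto simp: poly_eq_0_iff_dvd)
  then have "p = Var x * poly q (Var x)" using poly_wrt_Var[of x p] by simp
  then show ?thesis by (metis dvd_triv_left)
qed

text \<open>Induction on the number of variables: fix the others at a point where the leading
  coefficient in x does not vanish. The resulting univariate polynomial has finitely many roots,
  while a field of characteristic zero is infinite.\<close>

lemma mpoly_eq_0_if_peval_eq_0:
  fixes p :: "'k::field_char_0 mpoly"
  assumes "\<And>v. peval p v = 0" shows "p = 0"
proof -
  obtain V where "finite V" "in_vars V p" using ex_finite_in_vars by blast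
  moreover have "\<exists>v. peval p v \<noteq> 0" if "finite V" "in_vars V p" "p \<noteq> 0" for V and p :: "'k mpoly"
    using that
  proof (induction arbitrary: p)
    case empty
    have p0: "p = subst (\<lambda>_. 0) p"
      using mev_cong[OF empty(1), of Var "\<lambda>_. 0" Const] by simp
    also have "\<dots> = Const (peval p (\<lambda>_. 0))"
      using hom_eqI[OF coeff_hom_mev[OF coeff_hom_Const],
          of "\<lambda>q. Const (peval q (\<lambda>_. 0))" "\<lambda>_. 0" p]
      by (simp add: mev_simps peval_simps coeff_hom_def[of "\<lambda>q. Const (peval q (\<lambda>_. 0))"] Const_add Const_mult)
    finally show ?case using empty(2) by (metis Const_0)
  next
    case (insert x V)
    define q where "q = wrt x p"
    have cf: "in_vars V (coeff q i)" for i
      unfolding q_def using in_vars_coeff_wrt[OF insert.prems(1), of x] insert(2) by simp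
    have "lead_coeff q \<noteq> 0" using insert.prems by (simp add: q_def)
    then obtain v where v: "peval (lead_coeff q) v \<noteq> 0" using insert.IH cf by blast
    define r where "r = (\<Sum>i\<le>Polynomial.degree q. monom (peval (coeff q i) v) i)"
    have "coeff r (Polynomial.degree q) = peval (lead_coeff q) v"
      by (simp add: r_def coeff_sum)
    with v have "r \<noteq> 0" by auto
    then have "finite {t. poly r t = 0}" by (rule poly_roots_finite)
    then obtain t where t: "poly r t \<noteq> 0"
      using infinite_UNIV_char_0[where ?'a='k] by (metis (mono_tags, lifting) UNIV_I finite_subset mem_Collect_eq subsetI)
    have "peval p (v(x := t)) = peval (poly q (Var x)) (v(x := t))" by (simp add: q_def)
    also have "\<dots> = (\<Sum>i\<le>Polynomial.degree q. peval (coeff q i) (v(x := t)) * t ^ i)"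
      by (simp add: poly_altdef peval_sum peval_simps)
    also have "\<dots> = (\<Sum>i\<le>Polynomial.degree q. peval (coeff q i) v * t ^ i)"
      using insert(2) by (intro sum.cong arg_cong2[where f = "(*)"] peval_cong[OF cf]) auto
    also have "\<dots> = poly r t" by (simp add: r_def poly_sum poly_monom)
    finally show ?case using t by metis
  qed
  ultimately show ?thesis using assms by blast
qed

lemma mpoly_eqI:
  fixes p q :: "'k::field_char_0 mpoly"
  assumes "in_vars V p" "in_vars V q" "\<And>v. (\<And>i. i \<notin> V \<Longrightarrow> v i = 0) \<Longrightarrow> peval p v = peval q v"
  shows "p = q"
proof -
  have "peval (p - q) v = 0" for v
  proof -
    let ?v = "\<lambda>i. if i \<in> V then v i else 0"
    have "peval (p - q) v = peval (p - q) ?v"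
      by (rule peval_cong[OF in_vars_diff[OF assms(1,2)]]) simp
    also have "\<dots> = 0" using assms(3)[of ?v] by (simp add: peval_simps)
    finally show ?thesis .
  qed
  from mpoly_eq_0_if_peval_eq_0[OF this] show ?thesis by simp
qed

subsection \<open>Homogeneous components\<close>

definition mdeg :: "(nat \<Rightarrow>\<^sub>0 nat) \<Rightarrow> nat" where
  "mdeg m = (\<Sum>i\<in>Poly_Mapping.keys m. Poly_Mapping.lookup m i)"

text \<open>The coefficient of \<open>t\<^sup>k\<close> in \<open>p(t z\<^sub>0, t z\<^sub>1, \<dots>)\<close> is the homogeneous component of degree \<open>k\<close>.\<close>

definition graded :: "'k::comm_ring_1 mpoly \<Rightarrow> 'k mpoly poly" where
  "graded = mev (\<lambda>a. [:Const a:]) (\<lambda>i. monom (Var i) 1)"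

lemma coeff_hom_graded [simp]: "coeff_hom graded"
  by (simp add: graded_def)

lemma graded_mult: "graded (p * q) = graded p * graded q"
  and graded_add: "graded (p + q) = graded p + graded q"
  and graded_diff: "graded (p - q) = graded p - graded q"
  and graded_0 [simp]: "graded 0 = 0"
  and graded_1 [simp]: "graded 1 = 1"
  and graded_Var: "graded (Var i) = monom (Var i) 1"
  and graded_Const: "graded (Const c) = [:Const c:]"
  by (simp_all add: graded_def mev_simps)

lemma poly_graded: "poly (graded p) q = subst (\<lambda>i. Var i * q) p"
  by (rule hom_eqI[OF coeff_hom_comp[OF coeff_hom_poly coeff_hom_graded] coeff_hom_mev[OF coeff_hom_Const]])
    (simp_all add: graded_def mev_simps poly_monom)

lemma poly_graded_1 [simp]: "poly (graded p) 1 = p"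
  by (simp add: poly_graded)

lemma graded_eq_0_iff [simp]: "graded p = 0 \<longleftrightarrow> p = 0"
  using poly_graded_1[of p] by (metis graded_0 poly_0)

lemma single_eq_monval: "Poly_Mapping.single m a = Const a * monval Var m"
proof -
  have "Poly_Mapping.single m a = subst Var (Poly_Mapping.single m a)" by simp
  also have "\<dots> = Const a * monval Var m" by (rule mev_single) simp
  finally show ?thesis .
qed

lemma graded_single: "graded (Poly_Mapping.single m a) = monom (Poly_Mapping.single m a) (mdeg m)"
proof -
  have pw: "monom (Var i :: 'a mpoly) 1 ^ k = monom (Var i ^ k) k" for i k
    by (induction k) (simp_all add: mult_monom one_pCons monom_0)
  have "(\<Prod>i\<in>S. monom (h i) (k i)) = monom (\<Prod>i\<in>S. h i) (\<Sum>i\<in>S. k i)"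
    for h :: "nat \<Rightarrow> 'a mpoly" and k and S :: "nat set"
    by (induction S rule: infinite_finite_induct) (simp_all add: mult_monom one_pCons monom_0)
  then have "monval (\<lambda>i. monom (Var i :: 'a mpoly) 1) m = monom (monval Var m) (mdeg m)"
    by (simp only: monval_def mdeg_def pw)
  moreover have "graded (Poly_Mapping.single m a) = [:Const a:] * monval (\<lambda>i. monom (Var i) 1) m"
    unfolding graded_def by (rule mev_single) simp
  ultimately show ?thesis
    by (simp add: single_eq_monval[of m a] smult_monom)
qed

lemma lookup_coeff_graded:
  "Poly_Mapping.lookup (coeff (graded p) k) m = (if mdeg m = k then Poly_Mapping.lookup p m else 0)"
proof -
  have "graded p = (\<Sum>m\<in>Poly_Mapping.keys p. graded (Poly_Mapping.single m (Poly_Mapping.lookup p m)))"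
    by (subst mpoly_sum_single) (simp add: graded_def mev_sum)
  then have "Poly_Mapping.lookup (coeff (graded p) k) m =
      (\<Sum>m'\<in>Poly_Mapping.keys p. if mdeg m' = k then (Poly_Mapping.lookup p m' when m' = m) else 0)"
    by (simp add: graded_single coeff_sum lookup_sum lookup_single if_distrib
        if_distribR cong: if_cong)
  also have "\<dots> = (\<Sum>m'\<in>Poly_Mapping.keys p. if m' = m then (if mdeg m = k then Poly_Mapping.lookup p m else 0) else 0)"
    by (intro sum.cong) (auto simp: when_def)
  also have "\<dots> = (if mdeg m = k then Poly_Mapping.lookup p m else 0)"
    by (simp add: in_keys_iff)
  finally show ?thesis .
qed

lemma in_vars_coeff_graded: "in_vars V p \<Longrightarrow> in_vars V (coeff (graded p) k)"
  by (auto simp: in_vars_def in_keys_iff lookup_coeff_graded split: if_splits)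

lemma graded_eq_monom_iff: "graded p = monom p k \<longleftrightarrow> (\<forall>m\<in>Poly_Mapping.keys p. mdeg m = k)"
proof
  assume "graded p = monom p k"
  then have "coeff (graded p) k = p" by simp
  then show "\<forall>m\<in>Poly_Mapping.keys p. mdeg m = k"
    by (metis lookup_coeff_graded in_keys_iff)
next
  assume *: "\<forall>m\<in>Poly_Mapping.keys p. mdeg m = k"
  have "Poly_Mapping.lookup (coeff (graded p) j) m = Poly_Mapping.lookup (coeff (monom p k) j) m" for j m
    using * by (auto simp: lookup_coeff_graded in_keys_iff)
  then show "graded p = monom p k" by (intro poly_eqI poly_mapping_eqI)
qed

text \<open>Homogeneity becomes an equation for the ring homomorphism \<open>graded\<close>. Closure
  properties of forms are then calculations with monomials, and through \<open>monom_factor\<close>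
  factors of forms turn out to be forms.\<close>

lemma forms_iff: "p \<in> forms V k \<longleftrightarrow> in_vars V p \<and> graded p = monom p k"
proof -
  have "(\<Sum>i\<in>Poly_Mapping.keys m \<inter> V. Poly_Mapping.lookup m i) = mdeg m"
    if "in_vars V p" "m \<in> Poly_Mapping.keys p" for m
    unfolding mdeg_def using that by (intro sum.cong) (auto simp: in_vars_def)
  then show ?thesis by (auto simp: forms_def homogeneous_in_def graded_eq_monom_iff)
qed

lemma forms_in_vars: "p \<in> forms V k \<Longrightarrow> in_vars V p"
  by (simp add: forms_iff)

lemma forms_mono: "p \<in> forms V k \<Longrightarrow> V \<subseteq> W \<Longrightarrow> p \<in> forms W k"
  by (auto simp: forms_iff intro: in_vars_mono)

lemma coeff_graded_in_forms: "in_vars V p \<Longrightarrow> coeff (graded p) k \<in> forms V k"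
  by (auto simp: forms_iff graded_eq_monom_iff in_vars_coeff_graded in_keys_iff lookup_coeff_graded split: if_splits)

lemma forms_0 [simp]: "0 \<in> forms V k"
  by (simp add: forms_iff)

lemma forms_1 [simp]: "1 \<in> forms V 0"
  by (simp add: forms_iff one_pCons monom_0)

lemma forms_Const [simp]: "Const c \<in> forms V 0"
  by (simp add: forms_iff graded_Const monom_0)

lemma forms_Var: "i \<in> V \<Longrightarrow> Var i \<in> forms V 1"
  by (simp add: forms_iff in_vars_Var graded_Var)

lemma forms_add: "p \<in> forms V k \<Longrightarrow> q \<in> forms V k \<Longrightarrow> p + q \<in> forms V k"
  by (simp add: forms_iff in_vars_add graded_add add_monom)

lemma forms_diff: "p \<in> forms V k \<Longrightarrow> q \<in> forms V k \<Longrightarrow> p - q \<in> forms V k"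
  by (simp add: forms_iff in_vars_diff graded_diff diff_monom)

lemma forms_mult: "p \<in> forms V k \<Longrightarrow> q \<in> forms V l \<Longrightarrow> p * q \<in> forms V (k + l)"
  by (simp add: forms_iff in_vars_mult graded_mult mult_monom)

lemma forms_power: "p \<in> forms V k \<Longrightarrow> p ^ j \<in> forms V (j * k)"
  by (induction j) (auto dest: forms_mult)

lemma forms_sum: "(\<And>s. s \<in> S \<Longrightarrow> g s \<in> forms V k) \<Longrightarrow> sum g S \<in> forms V k"
  by (induction S rule: infinite_finite_induct) (simp_all add: forms_add)

lemma forms_prod:
  "(\<And>s. s \<in> S \<Longrightarrow> g s \<in> forms V (k s)) \<Longrightarrow> prod g S \<in> forms V (sum k S)"
  by (induction S rule: infinite_finite_induct) (simp_all add: forms_mult)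

lemma peval_form_scale:
  assumes "p \<in> forms V k" shows "peval p (\<lambda>i. c * v i) = c ^ k * peval p v"
proof -
  have "subst (\<lambda>i. Var i * Const c) p = p * Const c ^ k"
    using poly_graded[of p "Const c"] assms by (simp add: forms_iff poly_monom)
  then have "peval (subst (\<lambda>i. Var i * Const c) p) v = peval p v * c ^ k"
    by (simp add: peval_simps)
  then show ?thesis by (simp add: peval_subst peval_simps mult.commute)
qed

text \<open>The order at 0 and the degree are additive on products, agree on a monomial, and the
  order never exceeds the degree. Hence they agree on each factor.\<close>

lemma monom_factor:
  fixes a b :: "'b::idom poly"
  assumes "a * b = monom c k" "c \<noteq> 0" shows "a = monom (lead_coeff a) (Polynomial.degree a)"
proof -
  have nz: "a \<noteq> 0" "b \<noteq> 0" using assms by auto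
  have ord: "Polynomial.order 0 (monom c k) = k"
    using assms(2) by (simp add: order_0_monom)
  have "Polynomial.order 0 a + Polynomial.order 0 b = k"
    using Polynomial.order_mult[of a b 0] nz assms ord by simp
  moreover have "Polynomial.degree a + Polynomial.degree b = k"
    using degree_mult_eq[OF nz] assms by (simp add: degree_monom_eq)
  ultimately have eq: "Polynomial.order 0 a = Polynomial.degree a"
    using Polynomial.order_degree[OF nz(1), of 0] Polynomial.order_degree[OF nz(2), of 0] by linarith
  obtain q where q: "a = [:0, 1:] ^ Polynomial.degree a * q"
    using Polynomial.order_1[of 0 a] eq by (auto simp: dvd_def)
  then have "Polynomial.degree q = 0"
    using nz by (metis add_cancel_left_right degree_linear_power degree_mult_eq mult_eq_0_iff)
  then obtain s where "q = [:s:]" by (metis degree_eq_zeroE)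
  with q have "a = monom s (Polynomial.degree a)"
    by (simp only: monom_altdef) simp
  then show ?thesis by (metis lead_coeff_monom)
qed

lemma forms_factor:
  fixes p q :: "'k::idom mpoly"
  assumes "p * q \<in> forms V k" "p * q \<noteq> 0"
  obtains j where "p \<in> forms V j"
proof -
  have "graded p * graded q = monom (p * q) k"
    using assms(1) by (simp add: forms_iff graded_mult)
  from monom_factor[OF this assms(2)] obtain j c where "graded p = monom c j" by blast
  moreover from this have "c = p" using poly_graded_1[of p] by (simp add: poly_monom)
  ultimately show ?thesis
    using that[of j] in_vars_factor[of V p q] assms by (simp add: forms_iff)
qed

section \<open>Total degree and homogenization\<close>

definition tdeg :: "'k::comm_ring_1 mpoly \<Rightarrow> nat" where
  "tdeg p = Polynomial.degree (graded p)"

lemma tdeg_mult: "p \<noteq> 0 \<Longrightarrow> q \<noteq> 0 \<Longrightarrow> tdeg (p * q) = tdeg p + tdeg (q :: 'k::idom mpoly)"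
  by (simp add: tdeg_def graded_mult degree_mult_eq)

lemma tdeg_eq_0: assumes "tdeg p = 0" shows "p = Const (peval p (\<lambda>_. 0))"
proof -
  have "graded p = [:coeff (graded p) 0:]" using assms degree_0_id unfolding tdeg_def by metis
  then have "poly (graded p) 0 = poly (graded p) 1"
    by (metis poly_pCons mult_zero_left poly_0 mult_zero_right)
  then have "p = subst (\<lambda>_. 0) p" by (simp add: poly_graded)
  also have "\<dots> = Const (peval p (\<lambda>_. 0))"
    by (rule hom_eqI[OF coeff_hom_mev[OF coeff_hom_Const]])
      (simp_all add: mev_simps peval_simps coeff_hom_def Const_add Const_mult)
  finally show ?thesis .
qed

lemma tdeg_eq_0_unit:
  fixes p :: "'k::field mpoly"
  assumes "p \<noteq> 0" "tdeg p = 0" shows "p dvd 1"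
proof -
  obtain a where a: "p = Const a" using tdeg_eq_0[OF assms(2)] by blast
  with assms(1) have "p * Const (inverse a) = 1"
    by (metis Const_0 Const_1 Const_mult right_inverse)
  then show ?thesis by (metis dvd_triv_left)
qed

text \<open>Powers of z_0 fill up the difference between \<open>K\<close> and the degrees of the
  components of p. That \<open>K\<close> may be any bound on the degree allows degrees of forms to
  be matched later.\<close>

lemma homogenize:
  assumes "in_vars {1..n} p" "tdeg p \<le> K"
  obtains q where "q \<in> forms {..n} K"
    "\<And>v. v 0 \<noteq> (0::'k::field) \<Longrightarrow> peval q v = v 0 ^ K * peval p (\<lambda>i. v i / v 0)"
proof
  let ?q = "\<Sum>j\<le>K. coeff (graded p) j * Var 0 ^ (K - j)"
  have "coeff (graded p) j * Var 0 ^ (K - j) \<in> forms {..n} (j + (K - j) * 1)" for j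
    by (intro forms_mult forms_mono[OF coeff_graded_in_forms[OF assms(1)]] forms_power forms_Var) auto
  then have "coeff (graded p) j * Var 0 ^ (K - j) \<in> forms {..n} K" if "j \<le> K" for j
    using that by (metis le_add_diff_inverse mult.right_neutral)
  then show "?q \<in> forms {..n} K" by (intro forms_sum) auto
  fix v :: "nat \<Rightarrow> 'k" assume v: "v 0 \<noteq> 0"
  have p: "p = (\<Sum>j\<le>K. coeff (graded p) j)"
  proof -
    have "p = (\<Sum>j\<le>Polynomial.degree (graded p). coeff (graded p) j)"
      using poly_graded_1[of p] by (simp add: poly_altdef)
    also have "\<dots> = (\<Sum>j\<le>K. coeff (graded p) j)"
      using assms(2) by (intro sum.mono_neutral_left) (auto simp: tdeg_def coeff_eq_0)
    finally show ?thesis .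
  qed
  have "peval (coeff (graded p) j) v * v 0 ^ (K - j)
      = v 0 ^ K * peval (coeff (graded p) j) (\<lambda>i. v i / v 0)" if "j \<le> K" for j
  proof -
    have "peval (coeff (graded p) j) v = peval (coeff (graded p) j) (\<lambda>i. v 0 * (v i / v 0))"
      using v by simp
    also have "\<dots> = v 0 ^ j * peval (coeff (graded p) j) (\<lambda>i. v i / v 0)"
      by (rule peval_form_scale[OF coeff_graded_in_forms[OF assms(1)]])
    finally show ?thesis using that by (simp add: power_add[symmetric])
  qed
  then have "peval ?q v = v 0 ^ K * peval (\<Sum>j\<le>K. coeff (graded p) j) (\<lambda>i. v i / v 0)"
    by (simp add: peval_sum peval_simps sum_distrib_left)
  then show "peval ?q v = v 0 ^ K * peval p (\<lambda>i. v i / v 0)" using p by simp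
qed

subsection \<open>Unique factorization\<close>

lemma in_vars_unit: "p dvd 1 \<Longrightarrow> in_vars V (p :: 'k::idom mpoly)"
  by (rule in_vars_dvd[of V 1]) auto

lemma in_vars_empty_unit:
  fixes p :: "'k::field mpoly"
  assumes "in_vars {} p" "p \<noteq> 0" shows "p dvd 1"
proof -
  have "graded p = monom p 0"
    using assms(1) by (auto simp: graded_eq_monom_iff in_vars_def mdeg_def)
  then show ?thesis by (intro tdeg_eq_0_unit assms) (simp add: tdeg_def monom_0)
qed

text \<open>Nonzero constants are units, so nonunits have positive total degree and splitting off
  factors terminates.\<close>

lemma ex_irreducible_factor:
  fixes p :: "'k::field mpoly"
  assumes "p \<noteq> 0" "\<not> p dvd 1" shows "\<exists>r. irreducible r \<and> r dvd p"
  using assms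
proof (induction "tdeg p" arbitrary: p rule: less_induct)
  case less
  show ?case
  proof (cases "irreducible p")
    case False
    then obtain a b where ab: "p = a * b" "\<not> a dvd 1" "\<not> b dvd 1"
      using less.prems by (auto simp: irreducible_def)
    with less.prems have nz: "a \<noteq> 0" "b \<noteq> 0" by auto
    then have "tdeg b \<noteq> 0" using tdeg_eq_0_unit ab by blast
    then have "tdeg a < tdeg p" using ab nz by (simp add: tdeg_mult)
    then show ?thesis using less.hyps[of a] nz ab by (metis dvd_mult2)
  qed auto
qed

lemma irreducible_factor_induct [consumes 1, case_names unit mult]:
  fixes p :: "'k::field mpoly"
  assumes "p \<noteq> 0" "\<And>u. u dvd 1 \<Longrightarrow> P u" "\<And>r a. irreducible r \<Longrightarrow> a \<noteq> 0 \<Longrightarrow> P a \<Longrightarrow> P (r * a)"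
  shows "P p"
  using assms(1)
proof (induction "tdeg p" arbitrary: p rule: less_induct)
  case less
  show ?case
  proof (cases "p dvd 1")
    case False
    then obtain r a where r: "irreducible r" "p = r * a"
      using ex_irreducible_factor[OF less.prems] by (metis dvdE)
    with less.prems have nz: "a \<noteq> 0" "r \<noteq> 0" by auto
    then have "tdeg r \<noteq> 0" using tdeg_eq_0_unit r by (auto simp: irreducible_def)
    then have "tdeg a < tdeg p" using r nz by (simp add: tdeg_mult)
    then show ?thesis using less.hyps[of a] nz r assms(3) by blast
  qed (rule assms(2))
qed

section \<open>Gauss's lemma and primality of irreducible polynomials\<close>

definition primitive_over :: "nat set \<Rightarrow> 'k::field mpoly \<Rightarrow> bool" where
  "primitive_over V h \<longleftrightarrow> (\<forall>r. irreducible r \<and> in_vars V r \<longrightarrow> \<not> r dvd h)"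

lemma primitive_decomposition:
  fixes h :: "'k::field mpoly"
  assumes "h \<noteq> 0"
  obtains a h' where "h = a * h'" "in_vars V a" "primitive_over V h'"
proof -
  have "\<exists>a h'. h = a * h' \<and> in_vars V a \<and> primitive_over V h'" using assms
  proof (induction "tdeg h" arbitrary: h rule: less_induct)
    case less
    show ?case
    proof (cases "primitive_over V h")
      case True
      then show ?thesis by (intro exI[of _ 1] exI[of _ h]) simp
    next
      case False
      then obtain r k where r: "irreducible r" "in_vars V r" "h = r * k"
        by (auto simp: primitive_over_def dvd_def)
      with less.prems have nz: "k \<noteq> 0" "r \<noteq> 0" by auto
      then have "tdeg r \<noteq> 0" using tdeg_eq_0_unit r by (auto simp: irreducible_def)
      then have "tdeg k < tdeg h" using r nz by (simp add: tdeg_mult)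
      then obtain a h' where "k = a * h'" "in_vars V a" "primitive_over V h'"
        using less.hyps[of k] nz by blast
      then show ?thesis
        using r by (intro exI[of _ "r * a"] exI[of _ h']) (simp add: in_vars_mult mult.assoc)
    qed
  qed
  then show ?thesis using that by blast
qed

text \<open>Primality relative to the variables in \<open>V\<close>, in the form carried through the
  induction on the number of variables. The \<open>itself\<close> argument fixes the coefficient
  field, which \<open>V\<close> does not determine.\<close>

definition irreducibles_prime_in :: "'k::field itself \<Rightarrow> nat set \<Rightarrow> bool" where
  "irreducibles_prime_in T V \<longleftrightarrow> (\<forall>r f g :: 'k mpoly. irreducible r \<and> in_vars V r \<and> in_vars V f \<and> in_vars V g
     \<and> r dvd f * g \<longrightarrow> r dvd f \<or> r dvd g)"

lemma dvd_iff_dvd_coeff_wrt: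
  fixes r :: "'k::idom mpoly"
  assumes "in_vars (- {x}) r" shows "r dvd h \<longleftrightarrow> (\<forall>i. r dvd coeff (wrt x h) i)"
proof -
  have "r dvd h \<longleftrightarrow> [:r:] dvd wrt x h"
  proof
    assume "[:r:] dvd wrt x h"
    then obtain q where "wrt x h = [:r:] * q" by (auto simp: dvd_def)
    then have "h = r * poly q (Var x)" using poly_wrt_Var[of x h] by simp
    then show "r dvd h" by simp
  qed (auto simp: dvd_def wrt_mult wrt_const[OF assms])
  then show ?thesis by (simp only: const_poly_dvd_iff)
qed

text \<open>Let i and j be the first indices at which r fails to divide the coefficients of f and g
  in x. In the coefficient of index i + j of f g every other summand is divisible by r, so r divides
  the product of these two, against primality over \<open>V\<close>.\<close>

lemma gauss:
  fixes r :: "'k::field mpoly"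
  assumes V: "irreducibles_prime_in TYPE('k) V" "x \<notin> V" and r: "irreducible r" "in_vars V r"
    and fg: "in_vars (insert x V) f" "in_vars (insert x V) g" "r dvd f * g"
  shows "r dvd f \<or> r dvd g"
proof (rule ccontr)
  have rx: "in_vars (- {x}) r" using r(2) V(2) by (auto intro: in_vars_mono)
  define F G where "F = coeff (wrt x f)" and "G = coeff (wrt x g)"
  assume "\<not> ?thesis"
  then have ex: "\<exists>i. \<not> r dvd F i" "\<exists>i. \<not> r dvd G i"
    using dvd_iff_dvd_coeff_wrt[OF rx, of f] dvd_iff_dvd_coeff_wrt[OF rx, of g]
    unfolding F_def G_def by blast+
  define i j where "i = (LEAST i. \<not> r dvd F i)" and "j = (LEAST j. \<not> r dvd G j)"
  have i: "\<not> r dvd F i" "\<And>k. k < i \<Longrightarrow> r dvd F k"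
    unfolding i_def using LeastI_ex[OF ex(1)] not_less_Least by auto
  have j: "\<not> r dvd G j" "\<And>k. k < j \<Longrightarrow> r dvd G k"
    unfolding j_def using LeastI_ex[OF ex(2)] not_less_Least by auto
  have "r dvd coeff (wrt x (f * g)) (i + j)" using fg(3) dvd_iff_dvd_coeff_wrt[OF rx] by blast
  then have "r dvd (\<Sum>k\<le>i + j. F k * G (i + j - k))"
    by (simp add: wrt_mult coeff_mult F_def G_def)
  also have "(\<Sum>k\<le>i + j. F k * G (i + j - k)) = F i * G j + (\<Sum>k\<in>{..i + j} - {i}. F k * G (i + j - k))"
    by (subst sum.remove[of _ i]) auto
  finally have "r dvd F i * G j + (\<Sum>k\<in>{..i + j} - {i}. F k * G (i + j - k))" .
  moreover have "r dvd (\<Sum>k\<in>{..i + j} - {i}. F k * G (i + j - k))"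
  proof (rule dvd_sum)
    fix k assume "k \<in> {..i + j} - {i}"
    then have "k < i \<or> i + j - k < j" by auto
    then show "r dvd F k * G (i + j - k)" using i(2) j(2) by (auto intro: dvd_mult dvd_mult2)
  qed
  ultimately have "r dvd F i * G j" using dvd_add_left_iff by blast
  moreover have "in_vars V (F i)" "in_vars V (G j)"
    using in_vars_coeff_wrt[OF fg(1), of x] in_vars_coeff_wrt[OF fg(2), of x] V(2) by (simp_all add: F_def G_def)
  ultimately show False using V(1) r i(1) j(1) unfolding irreducibles_prime_in_def by blast
qed

text \<open>The irreducible factors r of c are removed one at a time: with q the cofactor of h, r
  divides h q but not the primitive h, so by \<open>gauss\<close> it divides q and cancels.\<close>

lemma primitive_dvd_cancel:
  fixes c :: "'k::field mpoly"
  assumes V: "irreducibles_prime_in TYPE('k) V" "x \<notin> V"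
    and h: "primitive_over V h" "in_vars (insert x V) h"
    and "c \<noteq> 0" "in_vars V c" "in_vars (insert x V) s" "h dvd c * s"
  shows "h dvd s"
  using assms(5-)
proof (induction c arbitrary: s rule: irreducible_factor_induct)
  case (unit u)
  then obtain v where "1 = u * v" by (auto simp: dvd_def)
  then have "s = v * (u * s)" by (metis mult.assoc mult.commute mult_1_left)
  then show ?case using unit by (metis dvd_mult)
next
  case (mult r a)
  show ?case
  proof (cases "s = 0")
    case False
    obtain q where q: "r * a * s = h * q" using mult.prems by (auto simp: dvd_def)
    have nz: "r * a \<noteq> 0" "r \<noteq> 0" using mult.hyps by (auto simp: irreducible_def)
    have r: "in_vars V r" and a: "in_vars V a"
      using in_vars_factor[of V r a] in_vars_factor[of V a r] mult.prems nz by (simp_all add: mult.commute)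
    have "in_vars (insert x V) (q * h)"
      using q in_vars_mult[OF in_vars_mono[OF mult.prems(1)], of "insert x V" s] mult.prems(2) by (auto simp: mult.commute)
    then have "in_vars (insert x V) q"
      using in_vars_factor[of _ q h] q nz False by (metis mult.commute mult_eq_0_iff)
    moreover have "r dvd h * q" by (metis q dvd_triv_left mult.assoc)
    ultimately have "r dvd q"
      using gauss[OF V mult.hyps(1) r h(2)] h(1) mult.hyps(1) r by (auto simp: primitive_over_def)
    then obtain q' where "q = r * q'" by (auto simp: dvd_def)
    with q have "r * (a * s) = r * (h * q')" by (simp add: mult_ac)
    then have "a * s = h * q'" using nz(2) by (metis mult_cancel_left)
    then show ?thesis using mult.IH[OF a mult.prems(2)] by simp
  qed simp
qed

text \<open>Pseudo-division in place of division over the fraction field of the coefficients: after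
  multiplication by the leading coefficient of h, the leading term of s can be cancelled within
  \<open>I\<close>. By minimality of h the process ends with remainder 0, and c collects the
  multipliers.\<close>

lemma pseudo_dvd_minimal:
  fixes h :: "'k::field mpoly"
  assumes x: "x \<notin> V" and h: "h \<noteq> 0" "h \<in> I"
    and I_vars: "\<And>s. s \<in> I \<Longrightarrow> in_vars (insert x V) s"
    and I_closed: "\<And>s a b. s \<in> I \<Longrightarrow> in_vars (insert x V) a \<Longrightarrow> in_vars (insert x V) b \<Longrightarrow> a * s - b * h \<in> I"
    and minimal: "\<And>s. s \<in> I \<Longrightarrow> s \<noteq> 0 \<Longrightarrow> Polynomial.degree (wrt x h) \<le> Polynomial.degree (wrt x s)"
    and s: "s \<in> I"
  shows "\<exists>c. c \<noteq> 0 \<and> in_vars V c \<and> h dvd c * s"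
  using s
proof (induction "Polynomial.degree (wrt x s)" arbitrary: s rule: less_induct)
  case less
  show ?case
  proof (cases "s = 0")
    case True
    then show ?thesis by (intro exI[of _ 1]) simp
  next
    case False
    define lh ls k where "lh = lead_coeff (wrt x h)" and "ls = lead_coeff (wrt x s)"
      and "k = Polynomial.degree (wrt x s) - Polynomial.degree (wrt x h)"
    have deg: "Polynomial.degree (wrt x s) = Polynomial.degree (wrt x h) + k"
      using minimal[OF less.prems False] by (simp add: k_def)
    have V: "in_vars V lh" "in_vars V ls"
      using in_vars_coeff_wrt[OF I_vars[OF h(2)], of x] in_vars_coeff_wrt[OF I_vars[OF less.prems], of x] x
      by (simp_all add: lh_def ls_def)
    then have Vx: "in_vars (- {x}) lh" "in_vars (- {x}) ls" using x by (auto intro: in_vars_mono)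
    define s' where "s' = lh * s - (ls * Var x ^ k) * h"
    have "s' \<in> I" unfolding s'_def
      using V less.prems by (intro I_closed in_vars_mult in_vars_power in_vars_Var) (auto intro: in_vars_mono)
    have lh0: "lh \<noteq> 0" using h by (simp add: lh_def)
    have w: "wrt x s' = smult lh (wrt x s) - smult ls (monom 1 k * wrt x h)"
      by (simp add: s'_def wrt_diff wrt_mult wrt_const[OF Vx(1)] wrt_const[OF Vx(2)] wrt_Var_power)
    have "Polynomial.degree (wrt x s') \<le> Polynomial.degree (wrt x s)"
      unfolding w using degree_mult_le[of "monom 1 k" "wrt x h"] degree_monom_le[of "1 :: 'k mpoly" k] deg
      by (intro degree_diff_le order.trans[OF degree_smult_le]) linarith+
    moreover have "coeff (wrt x s') (Polynomial.degree (wrt x s)) = 0"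
      unfolding w by (simp add: coeff_monom_mult deg lh_def) (simp add: ls_def deg)
    ultimately consider "s' = 0" | "Polynomial.degree (wrt x s') < Polynomial.degree (wrt x s)"
      using eq_zero_or_degree_less[of "wrt x s'"] by auto
    then obtain c where c: "c \<noteq> 0" "in_vars V c" "h dvd c * s'"
    proof cases
      case 1
      then show ?thesis using that[of 1] by simp
    next
      case 2
      then show ?thesis using that less.hyps[OF 2 \<open>s' \<in> I\<close>] by blast
    qed
    have "c * lh * s = c * s' + c * (ls * Var x ^ k) * h" by (simp add: s'_def algebra_simps)
    then have "h dvd c * lh * s" using c(3) by simp
    then show ?thesis using c lh0 V by (intro exI[of _ "c * lh"]) (simp add: in_vars_mult)
  qed
qed

text \<open>Bezout's argument over the fraction field of the polynomials in \<open>V\<close>, with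
  denominators cleared. If p does not divide f, let h have least x-degree in the ideal (p, f). Its
  primitive part divides p and f, so it is a unit, and h is in essence an element of the coefficient
  ring.\<close>

lemma irreducibles_prime_in_insert:
  assumes V: "irreducibles_prime_in TYPE('k::field) V" and x: "x \<notin> V"
  shows "irreducibles_prime_in TYPE('k) (insert x V)"
  unfolding irreducibles_prime_in_def
proof (intro allI impI, elim conjE)
  fix p f g :: "'k mpoly"
  assume p: "irreducible p" "in_vars (insert x V) p" and f: "in_vars (insert x V) f"
    and g: "in_vars (insert x V) g" and dvd: "p dvd f * g"
  show "p dvd f \<or> p dvd g"
  proof (cases "in_vars V p")
    case True
    then show ?thesis using gauss[OF V x p(1) True f g dvd] by blast
  next
    case False
    \<comment> \<open>A factor of p in the variables \<open>V\<close> would leave a unit as cofactor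
      and thus put p itself into these variables.\<close>
    have prim: "primitive_over V p"
      unfolding primitive_over_def
    proof (intro allI impI notI, elim conjE)
      fix r assume r: "irreducible r" "in_vars V r" "r dvd p"
      then obtain q where q: "p = r * q" by (auto simp: dvd_def)
      then have "q dvd 1" using p(1) r(1) by (auto simp: irreducible_def)
      then show False using q r(2) False in_vars_mult in_vars_unit by blast
    qed
    have "p dvd g" if nf: "\<not> p dvd f"
    proof -
      define I where "I = {s. \<exists>a b. in_vars (insert x V) a \<and> in_vars (insert x V) b \<and> s = a * p + b * f}"
      have pI: "p \<in> I" and fI: "f \<in> I"
        unfolding I_def using in_vars_0 in_vars_1 by (force intro: exI[of _ 1] exI[of _ 0])+
      have p0: "p \<noteq> 0" using p(1) by (auto simp: irreducible_def)
      obtain h where h: "h \<in> I" "h \<noteq> 0"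
        and minimal: "\<And>s. s \<in> I \<Longrightarrow> s \<noteq> 0 \<Longrightarrow> Polynomial.degree (wrt x h) \<le> Polynomial.degree (wrt x s)"
        using ex_has_least_nat[of "\<lambda>s. s \<in> I \<and> s \<noteq> 0" p "\<lambda>s. Polynomial.degree (wrt x s)"] pI p0 by blast
      have I_vars: "in_vars (insert x V) s" if "s \<in> I" for s
        using that p(2) f by (auto simp: I_def intro!: in_vars_add in_vars_mult)
      have I_closed: "a * s - b * h \<in> I"
        if s: "s \<in> I" and ab: "in_vars (insert x V) a" "in_vars (insert x V) b" for s a b
      proof -
        obtain u v u' v' where
          uv: "in_vars (insert x V) u" "in_vars (insert x V) v" "s = u * p + v * f"
          "in_vars (insert x V) u'" "in_vars (insert x V) v'" "h = u' * p + v' * f"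
          using s h(1) unfolding I_def mem_Collect_eq by metis
        have "a * s - b * h = (a * u - b * u') * p + (a * v - b * v') * f"
          unfolding uv(3,6) by (simp add: algebra_simps)
        moreover have "in_vars (insert x V) (a * u - b * u')" "in_vars (insert x V) (a * v - b * v')"
          using uv ab by (simp_all add: in_vars_diff in_vars_mult)
        ultimately show ?thesis unfolding I_def mem_Collect_eq by metis
      qed
      have pseudo: "\<exists>c. c \<noteq> 0 \<and> in_vars V c \<and> h dvd c * s" if "s \<in> I" for s
        by (rule pseudo_dvd_minimal[OF x h(2,1) _ _ _ that]; (rule I_vars I_closed minimal; assumption))
      obtain a h' where ah: "h = a * h'" "in_vars V a" "primitive_over V h'"
        using primitive_decomposition[OF h(2)] by blast
      have h'V: "in_vars (insert x V) h'"
        using in_vars_factor[of _ h' a] I_vars[OF h(1)] h(2) ah(1) by (simp add: mult.commute)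
      have common: "h' dvd s" if "s \<in> I" for s
      proof -
        obtain c where "c \<noteq> 0" "in_vars V c" "h dvd c * s" using pseudo[OF \<open>s \<in> I\<close>] by blast
        then show ?thesis
          using primitive_dvd_cancel[OF V x ah(3) h'V _ _ I_vars[OF \<open>s \<in> I\<close>], of c] ah(1) by (metis dvd_mult_right)
      qed
      obtain q where q: "p = h' * q" using common[OF pI] by (auto simp: dvd_def)
      have "h' dvd 1"
      proof (rule ccontr)
        assume "\<not> h' dvd 1"
        then have "q dvd 1" using q p(1) by (auto simp: irreducible_def)
        then obtain t where "1 = q * t" by (auto simp: dvd_def)
        then have "h' = p * t" using q by (metis mult.assoc mult.right_neutral)
        then have "p dvd f" using common[OF fI] by (metis dvd_mult_left)
        then show False using nf by simp
      qed
      then obtain t where t: "1 = h' * t" by (auto simp: dvd_def)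
      obtain u v where "h = u * p + v * f" using h(1) by (auto simp: I_def)
      \<comment> \<open>The Bezout relation times g has both terms divisible by p. Up to the unit
        \<open>h'\<close> this gives p dividing a g, and a cancels since p is primitive.\<close>
      then have "h * g = p * (u * g) + v * (f * g)" by (simp add: algebra_simps)
      then have "p dvd h * g" using dvd by simp
      then have "p dvd h * g * t" by (rule dvd_mult2)
      also have "h * g * t = a * g * (h' * t)" by (simp only: ah(1) mult_ac)
      also have "\<dots> = a * g" by (simp flip: t)
      finally have "p dvd a * g" .
      then show ?thesis
        using primitive_dvd_cancel[OF V x prim p(2) _ ah(2) g] h(2) ah(1) by auto
    qed
    then show ?thesis by blast
  qed
qed

lemma irreducible_imp_prime_elem_mpoly:
  fixes r :: "'k::field mpoly"
  assumes "irreducible r" shows "prime_elem r"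
proof -
  have fin: "irreducibles_prime_in TYPE('k) V" if "finite V" for V
    using that
  proof induction
    case empty
    then show ?case
      using in_vars_empty_unit by (auto simp: irreducibles_prime_in_def irreducible_def)
  qed (rule irreducibles_prime_in_insert)
  have "r dvd f \<or> r dvd g" if "r dvd f * g" for f g
  proof -
    obtain A B C where "finite A" "in_vars A r" "finite B" "in_vars B f" "finite C" "in_vars C g"
      using ex_finite_in_vars by metis
    moreover from this have "in_vars (A \<union> B \<union> C) r" "in_vars (A \<union> B \<union> C) f" "in_vars (A \<union> B \<union> C) g"
      by (auto intro: in_vars_mono)
    ultimately show ?thesis
      using fin[of "A \<union> B \<union> C"] assms that unfolding irreducibles_prime_in_def by blast
  qed
  then show ?thesis using assms by (auto simp: prime_elem_def irreducible_def)
qed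

text \<open>The hypothesis is an integral equation of P / Q multiplied by Q^N. A prime factor r of Q
  divides all terms but P^N, hence also P; cancelling r^N leaves an equation of the same shape with
  one factor fewer in Q.\<close>

lemma mpoly_integrally_closed:
  fixes P Q :: "'k::field mpoly"
  assumes "Q \<noteq> 0" "P ^ N + (\<Sum>i<N. c i * P ^ i * Q ^ (N - i)) = 0"
  shows "Q dvd P"
  using assms
proof (induction Q arbitrary: P rule: irreducible_factor_induct)
  case (unit u)
  then show ?case by (metis dvd_trans one_dvd)
next
  case (mult r a)
  have r: "prime_elem r" by (rule irreducible_imp_prime_elem_mpoly[OF mult.hyps(1)])
  have "r dvd (\<Sum>i<N. c i * P ^ i * (r * a) ^ (N - i))"
  proof (rule dvd_sum)
    fix i assume "i \<in> {..<N}"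
    then have "r * a dvd (r * a) ^ (N - i)" by (intro dvd_power) auto
    then show "r dvd c i * P ^ i * (r * a) ^ (N - i)" by (metis dvd_mult dvd_mult_left)
  qed
  moreover have "P ^ N = - (\<Sum>i<N. c i * P ^ i * (r * a) ^ (N - i))"
    using mult.prems by (simp only: eq_neg_iff_add_eq_0)
  ultimately have "r dvd P ^ N" by (simp only: dvd_minus_iff)
  then have "r dvd P" using r prime_elem_dvd_power by blast
  then obtain P' where P: "P = r * P'" by (auto simp: dvd_def)
  have eq: "c i * P ^ i * (r * a) ^ (N - i) = r ^ N * (c i * P' ^ i * a ^ (N - i))" if "i < N" for i
  proof -
    have "r ^ N = r ^ i * r ^ (N - i)" using that by (simp flip: power_add)
    then show ?thesis by (simp add: P power_mult_distrib mult_ac)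
  qed
  have "r ^ N * (P' ^ N + (\<Sum>i<N. c i * P' ^ i * a ^ (N - i)))
      = P ^ N + (\<Sum>i<N. c i * P ^ i * (r * a) ^ (N - i))"
    unfolding ring_distribs sum_distrib_left
    by (intro arg_cong2[where f = "(+)"] sum.cong) (simp_all only: eq lessThan_iff, simp add: P power_mult_distrib)
  also have "\<dots> = 0" by (rule mult.prems)
  finally have "r ^ N * (P' ^ N + (\<Sum>i<N. c i * P' ^ i * a ^ (N - i))) = 0" .
  moreover have "r ^ N \<noteq> 0" using r by auto
  ultimately have "a dvd P'" using mult.IH by (meson mult_eq_0_iff)
  then show ?case by (simp add: P)
qed

text \<open>The prime factors r of f are distributed one by one. If r divides the part of G not yet
  used, it goes to g. Otherwise square-freeness keeps r from dividing the part h already taken from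
  A, so r divides the rest of A and goes to h.\<close>

lemma squarefree_dvd_split:
  fixes f G A :: "'k::field mpoly"
  assumes "squarefree f" "f dvd G * A ^ N"
  obtains g h where "f = g * h" "g dvd G" "h dvd A"
proof -
  have "f \<noteq> 0" using assms(1) by auto
  then have "\<exists>g h. f = g * h \<and> g dvd G \<and> h dvd A" using assms
  proof (induction f rule: irreducible_factor_induct)
    case (unit u)
    then show ?case by (intro exI[of _ u] exI[of _ 1]) (auto intro: dvd_trans)
  next
    case (mult r a)
    have r: "prime_elem r" by (rule irreducible_imp_prime_elem_mpoly[OF mult.hyps(1)])
    have "a dvd G * A ^ N" using mult.prems(2) by (rule dvd_mult_right)
    then obtain g h G' A' where gh: "a = g * h" "G = g * G'" "A = h * A'"
      using mult.IH mult.prems(1) squarefree_multD(2)[of r a] by (auto simp: dvd_def)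
    show ?case
    proof (cases "r dvd G'")
      case True
      then show ?thesis using gh by (intro exI[of _ "r * g"] exI[of _ h]) (auto simp: mult_ac)
    next
      case False
      have "\<not> r dvd h"
      proof
        assume "r dvd h"
        then have "r ^ 2 dvd r * a" using gh by (auto simp: power2_eq_square)
        then have "r dvd 1" using mult.prems(1) squarefreeD by blast
        then show False using r by (simp add: prime_elem_def)
      qed
      \<comment> \<open>For N = 0 all of f divides G, and r would divide \<open>G'\<close>.\<close>
      have N: "N \<noteq> 0"
      proof
        assume "N = 0"
        then have "g * (r * h) dvd g * G'" using mult.prems(2) gh by (simp add: mult_ac)
        then have "r * h dvd G'" using mult.hyps(2) gh by (metis dvd_mult_cancel_left mult_eq_0_iff)
        then show False using False by (metis dvd_mult_left)
      qed
      then have "A ^ N = h * (h ^ (N - 1) * A' ^ N)"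
        using gh by (cases N) (auto simp: power_mult_distrib mult_ac)
      then have "(g * h) * r dvd (g * h) * (G' * (h ^ (N - 1) * A' ^ N))"
        using mult.prems(2) gh by (simp add: mult_ac)
      then have "r dvd G' * (h ^ (N - 1) * A' ^ N)"
        using mult.hyps(2) gh by (metis dvd_mult_cancel_left)
      then have "r dvd A'"
        using False \<open>\<not> r dvd h\<close> prime_elem_dvd_mult_iff[OF r] prime_elem_dvd_power[OF r] by blast
      then show ?thesis using gh by (intro exI[of _ g] exI[of _ "r * h"]) (auto simp: mult_ac)
    qed
  qed
  then show ?thesis using that by blast
qed

section \<open>Clearing powers of \<open>z\<^sub>0\<close> from a denominator\<close>

text \<open>
  The map \<open>\<phi>\<close> restricts a form to the affine chart \<open>z\<^sub>0 = 1\<close> of the hypersurface \<open>f = 0\<close>, whose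
  coordinate ring is assumed to be the polynomial ring in the variables from \<open>W\<close>.
\<close>

locale polynomial_chart =
  fixes n d :: nat and f :: "'k::field_char_0 mpoly" and W :: "nat set" and \<phi> :: "'k mpoly \<Rightarrow> 'k mpoly"
  assumes hom: "coeff_hom \<phi>"
    and phi_Var_0: "\<phi> (Var 0) = 1"
    and phi_in_vars: "in_vars {..n} H \<Longrightarrow> in_vars W (\<phi> H)"
    and phi_surj: "in_vars W R \<Longrightarrow> \<exists>K\<^sub>0. \<forall>K\<ge>K\<^sub>0. \<exists>C\<in>forms {..n} K. \<phi> C = R"
    and f_form: "f \<in> forms {..n} d"
    and phi_f: "\<phi> f = 0"
    and kernel: "H \<in> forms {..n} k \<Longrightarrow> \<phi> H = 0 \<Longrightarrow> f dvd H"
    and squarefree_at_infinity: "squarefree (subst (Var(0 := 0)) f)"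
begin

lemma phi_simps [simp]:
  "\<phi> (p + q) = \<phi> p + \<phi> q" "\<phi> (p * q) = \<phi> p * \<phi> q" "\<phi> 0 = 0" "\<phi> 1 = 1"
  using hom by (simp_all add: coeff_hom_def)

lemma phi_diff [simp]: "\<phi> (p - q) = \<phi> p - \<phi> q"
  using phi_simps(1)[of "p - q" q] by (simp del: phi_simps)

lemma phi_power [simp]: "\<phi> (p ^ k) = \<phi> p ^ k"
  by (induction k) simp_all

lemma phi_sum [simp]: "\<phi> (sum g S) = (\<Sum>s\<in>S. \<phi> (g s))"
  by (induction S rule: infinite_finite_induct) simp_all

lemma phi_prod [simp]: "\<phi> (prod g S) = (\<Prod>s\<in>S. \<phi> (g s))"
  by (induction S rule: infinite_finite_induct) simp_all

abbreviation at_infinity :: "'k mpoly \<Rightarrow> 'k mpoly" where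
  "at_infinity \<equiv> subst (Var(0 := 0))"

lemma at_infinity_in_vars: "in_vars {..n} p \<Longrightarrow> in_vars ({..n} - {0}) (at_infinity p)"
  by (rule in_vars_subst) (auto intro: in_vars_Var)

lemma at_infinity_ident: "in_vars ({..n} - {0}) p \<Longrightarrow> at_infinity p = p"
  using mev_cong[of "{..n} - {0}" p "Var(0 := 0)" Var Const] by simp

lemma peval_at_infinity: "x 0 = 0 \<Longrightarrow> peval (at_infinity p) x = peval p x"
  by (auto simp: peval_subst peval_simps intro!: arg_cong[of _ _ "peval p"])

text \<open>
  Reducing the integral equation modulo \<open>z\<^sub>0\<close> shows that the reduced equation \<open>f = 0\<close> at infinity
  divides \<open>E C\<^sup>N\<close>; as it is square-free, a factor of \<open>E\<close> suffices to make \<open>C\<close> divisible by \<open>z\<^sub>0\<close>.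
\<close>

lemma lower_z0_power:
  assumes x: "x 0 = 0" "peval E x \<noteq> 0"
    and E: "E \<in> forms {..n} m" and c: "\<And>i. i < N \<Longrightarrow> c i \<in> forms {..n} m"
    and C: "C \<in> forms {..n} (Suc k + l)" and D: "D \<in> forms {..n} l"
    and eq: "\<phi> E * \<phi> C ^ N + (\<Sum>i<N. \<phi> (c i) * \<phi> C ^ i * \<phi> D ^ (N - i)) = 0"
  obtains g C' j where "g \<in> forms {..n} j" "peval g x \<noteq> 0" "C' \<in> forms {..n} (k + l + j)" "\<phi> (g * C) = \<phi> C'"
proof -
  define e where "e = Suc k + l"
  \<comment> \<open>The equation for C / (z_0^(k+1) D), cleared of denominators; it is homogeneous
    because numerator and denominator share the degree \<open>e\<close>. As \<phi> sends z_0 to 1,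
    the image of \<open>H\<close> is the left side of \<open>eq\<close>.\<close>
  define H where "H = E * C ^ N + (\<Sum>i<N. c i * C ^ i * (Var 0 ^ Suc k * D) ^ (N - i))"
  have zD: "Var 0 ^ Suc k * D \<in> forms {..n} e"
    using forms_mult[OF forms_power[OF forms_Var] D, of 0 "Suc k"] by (simp add: e_def)
  have "c i * C ^ i * (Var 0 ^ Suc k * D) ^ (N - i) \<in> forms {..n} (m + N * e)" if "i < N" for i
  proof -
    have "c i * C ^ i * (Var 0 ^ Suc k * D) ^ (N - i) \<in> forms {..n} (m + i * e + (N - i) * e)"
      using C by (intro forms_mult forms_power zD c that) (simp add: e_def)
    also have "m + i * e + (N - i) * e = m + N * e"
      using that by (simp add: add.assoc flip: add_mult_distrib)
    finally show ?thesis .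
  qed
  moreover have "E * C ^ N \<in> forms {..n} (m + N * e)"
    unfolding e_def by (intro forms_mult E forms_power C)
  ultimately have "H \<in> forms {..n} (m + N * e)"
    unfolding H_def by (intro forms_add forms_sum) auto
  moreover have "\<phi> H = 0" using eq by (simp add: H_def phi_Var_0 del: power_Suc)
  ultimately have "f dvd H" using kernel by blast
  then have "at_infinity f dvd at_infinity H" by (auto simp: dvd_def mev_simps)
  moreover have "at_infinity H = at_infinity E * at_infinity C ^ N"
  proof -
    \<comment> \<open>The exponent \<open>N - i\<close> is positive, so each summand keeps a factor
      z_0.\<close>
    have "at_infinity (c i * C ^ i * (Var 0 ^ Suc k * D) ^ (N - i)) = 0" if "i < N" for i
      using that by (simp add: mev_simps power_0_left)
    then have "(\<Sum>i<N. at_infinity (c i * C ^ i * (Var 0 ^ Suc k * D) ^ (N - i))) = 0"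
      by (intro sum.neutral) simp
    then show ?thesis by (simp only: H_def mev_add mev_sum coeff_hom_Const) (simp add: mev_simps)
  qed
  ultimately obtain g h where gh: "at_infinity f = g * h" "g dvd at_infinity E" "h dvd at_infinity C"
    using squarefree_dvd_split[OF squarefree_at_infinity] by metis
  have f0: "at_infinity f \<noteq> 0" using squarefree_at_infinity by auto
  have fV: "in_vars ({..n} - {0}) (at_infinity f)"
    by (rule at_infinity_in_vars[OF forms_in_vars[OF f_form]])
  have f_form': "at_infinity f \<in> forms {..n} d"
  proof -
    \<comment> \<open>Setting z_0 = 0 commutes with taking homogeneous components; \<open>r\<close>
      is this substitution applied to each coefficient.\<close>
    have keys: "graded (at_infinity f) = monom (at_infinity f) d"
    proof -
      define r where "r = (\<lambda>q. map_poly at_infinity q)"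
      have r: "coeff (r q) i = at_infinity (coeff q i)" for q i
        by (simp add: r_def coeff_map_poly)
      have r_hom: "coeff_hom r"
        unfolding coeff_hom_def
        by (auto intro!: poly_eqI simp: r mev_simps coeff_mult coeff_1)
      have "graded (at_infinity f) = r (graded f)"
      proof (rule hom_eqI)
        show "coeff_hom (\<lambda>p. graded (at_infinity p))" "coeff_hom (\<lambda>p. r (graded p))"
          using r_hom by (auto intro: coeff_hom_comp)
      qed (auto intro!: poly_eqI simp: r graded_Const graded_Var mev_simps coeff_pCons split: nat.splits)
      also have "\<dots> = monom (at_infinity f) d"
        using f_form by (auto intro!: poly_eqI simp: r forms_iff)
      finally show ?thesis .
    qed
    then show ?thesis using fV by (auto simp: forms_iff intro: in_vars_mono)
  qed
  obtain j where g: "g \<in> forms {..n} j" using forms_factor[of g h "{..n}" d] f_form' f0 gh(1) by metis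
  have h0: "h \<noteq> 0" using f0 gh(1) by auto
  have hg_ident: "at_infinity g = g" "at_infinity h = h"
    using fV f0 gh(1) in_vars_dvd[OF fV f0] by (auto intro!: at_infinity_ident)
  have "peval (at_infinity E) x \<noteq> 0" using x by (simp add: peval_at_infinity)
  then have gx: "peval g x \<noteq> 0" using gh(2) by (auto simp: dvd_def peval_simps)
  obtain t where t: "at_infinity C = h * t" using gh(3) by (auto simp: dvd_def)
  have CV: "in_vars ({..n} - {0}) (at_infinity C)"
    by (rule at_infinity_in_vars[OF forms_in_vars[OF C]])
  have tV: "in_vars ({..n} - {0}) t"
    using in_vars_dvd[OF CV, of t] t h0 by (cases "t = 0") auto
  \<comment> \<open>Modulo z_0 both products equal g h t. So g C is z_0 s up to a multiple of f, and
    \<phi> kills that multiple and turns z_0 into 1.\<close>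
  have "at_infinity (g * C - f * t) = 0"
    by (simp add: mev_simps hg_ident at_infinity_ident[OF tV] t gh(1) mult_ac)
  then have "Var 0 dvd g * C - f * t" by (rule Var_dvd_if_subst_0)
  then obtain s where s: "g * C - f * t = Var 0 * s" by (auto simp: dvd_def)
  have "in_vars {..n} (s * Var 0)"
    unfolding mult.commute[of s] s[symmetric] using g C f_form in_vars_mono[OF tV, of "{..n}"]
    by (intro in_vars_diff in_vars_mult) (auto dest: forms_in_vars)
  then have sV: "in_vars {..n} s" using in_vars_factor[of _ s "Var 0"] by (cases "s = 0") auto
  \<comment> \<open>Comparing only the components of degree \<open>j + e\<close> avoids having to
    show that t and s are homogeneous.\<close>
  have "coeff (graded (g * C)) (j + e) = coeff (graded (Var 0 * s)) (j + e) + coeff (graded (f * t)) (j + e)"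
    unfolding s[symmetric] by (simp add: graded_diff)
  moreover have "coeff (graded (g * C)) (j + e) = g * C"
    using forms_mult[OF g C] by (simp add: forms_iff e_def)
  moreover have "coeff (graded (Var 0 * s)) (j + e) = Var 0 * coeff (graded s) (k + l + j)"
    by (simp add: graded_mult graded_Var coeff_monom_mult e_def add_ac)
  moreover have "\<phi> (coeff (graded (f * t)) (j + e)) = 0"
    using f_form by (simp add: forms_iff graded_mult coeff_monom_mult phi_f)
  ultimately have "\<phi> (g * C) = \<phi> (coeff (graded s) (k + l + j))"
    by (metis phi_simps(1,2) phi_Var_0 add.right_neutral mult_1_left)
  with that[OF g gx coeff_graded_in_forms[OF sV]] show ?thesis .
qed

lemma integral_fraction_regular:
  assumes x: "peval f x = 0" "peval E x \<noteq> 0"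
    and E: "E \<in> forms {..n} m" and c: "\<And>i. i < N \<Longrightarrow> c i \<in> forms {..n} m"
    and Q: "\<phi> Q \<noteq> 0" "in_vars {..n} Q" and P: "in_vars {..n} P"
    and eq: "\<phi> E * \<phi> P ^ N + (\<Sum>i<N. \<phi> (c i) * \<phi> P ^ i * \<phi> Q ^ (N - i)) = 0"
  obtains C D l where "C \<in> forms {..n} l" "D \<in> forms {..n} l" "peval D x \<noteq> 0" "\<phi> P * \<phi> D = \<phi> Q * \<phi> C"
proof -
  \<comment> \<open>f vanishes at x and E does not, so f cannot divide E.\<close>
  have E0: "\<phi> E \<noteq> 0"
    using kernel[OF E] x by (auto simp: dvd_def peval_simps)
  have N: "N > 0"
    using eq E0 by (cases "N = 0") auto
  \<comment> \<open>Multiplication by E^(N-1) makes the equation monic in E P.\<close>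
  have "(\<phi> E * \<phi> P) ^ N + (\<Sum>i<N. (\<phi> (c i) * \<phi> E ^ (N - 1 - i)) * (\<phi> E * \<phi> P) ^ i * \<phi> Q ^ (N - i))
     = \<phi> E ^ (N - 1) * (\<phi> E * \<phi> P ^ N + (\<Sum>i<N. \<phi> (c i) * \<phi> P ^ i * \<phi> Q ^ (N - i)))"
    unfolding ring_distribs sum_distrib_left
  proof (intro arg_cong2[where f = "(+)"] sum.cong refl)
    show "(\<phi> E * \<phi> P) ^ N = \<phi> E ^ (N - 1) * (\<phi> E * \<phi> P ^ N)"
      using N by (cases N) (simp_all add: power_mult_distrib mult_ac)
    fix i assume "i \<in> {..<N}"
    then have "\<phi> E ^ (N - 1) = \<phi> E ^ (N - 1 - i) * \<phi> E ^ i" by (simp flip: power_add)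
    then show "\<phi> (c i) * \<phi> E ^ (N - 1 - i) * (\<phi> E * \<phi> P) ^ i * \<phi> Q ^ (N - i) =
        \<phi> E ^ (N - 1) * (\<phi> (c i) * \<phi> P ^ i * \<phi> Q ^ (N - i))"
      by (simp only: power_mult_distrib mult_ac)
  qed
  also have "\<dots> = 0" using eq by simp
  finally have "\<phi> Q dvd \<phi> E * \<phi> P"
    using mpoly_integrally_closed[OF Q(1), of "\<phi> E * \<phi> P" N "\<lambda>i. \<phi> (c i) * \<phi> E ^ (N - 1 - i)"] by simp
  then obtain R where R: "\<phi> E * \<phi> P = \<phi> Q * R" by (auto simp: dvd_def)
  have RV: "in_vars W R"
  proof (cases "R = 0")
    case False
    have "in_vars W (R * \<phi> Q)"
      using R phi_in_vars[OF in_vars_mult[OF forms_in_vars[OF E] P]] by (simp add: mult.commute)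
    then show ?thesis using in_vars_factor False Q(1) by (metis mult_eq_0_iff)
  qed simp
  obtain K\<^sub>0 where K0: "\<And>K. K \<ge> K\<^sub>0 \<Longrightarrow> \<exists>C\<in>forms {..n} K. \<phi> C = R"
    using phi_surj[OF RV] by blast
  \<comment> \<open>Descent on the excess k of the degree of C over that of D. On the chart P / Q is
    C / D; as a quotient of forms of equal degree it is C / (z_0^k D).\<close>
  have "\<exists>C D l. C \<in> forms {..n} l \<and> D \<in> forms {..n} l \<and> peval D x \<noteq> 0 \<and> \<phi> P * \<phi> D = \<phi> Q * \<phi> C"
    if "C \<in> forms {..n} (k + l)" "D \<in> forms {..n} l" "peval D x \<noteq> 0" "\<phi> P * \<phi> D = \<phi> Q * \<phi> C" for C D k l
    using that
  proof (induction k arbitrary: C D l)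
    case 0
    then show ?case by auto
  next
    case (Suc k)
    show ?case
    proof (cases "x 0 = 0")
      case False
      \<comment> \<open>Away from infinity the power of z_0 is harmless in the denominator.\<close>
      have "Var 0 ^ Suc k * D \<in> forms {..n} (Suc k + l)"
        using forms_mult[OF forms_power[OF forms_Var] Suc.prems(2), of 0 "Suc k"] by simp
      moreover have "peval (Var 0 ^ Suc k * D) x \<noteq> 0"
        using False Suc.prems by (simp add: peval_simps del: power_Suc)
      moreover have "\<phi> P * \<phi> (Var 0 ^ Suc k * D) = \<phi> Q * \<phi> C"
        using Suc.prems by (simp add: phi_Var_0)
      ultimately show ?thesis using Suc.prems(1) by blast
    next
      case True
      \<comment> \<open>As P D = Q C on the chart, the equation for P / Q turns into one for C / D
        when the factor Q^N is exchanged for D^N.\<close>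
      have "\<phi> Q ^ N * (\<phi> E * \<phi> C ^ N + (\<Sum>i<N. \<phi> (c i) * \<phi> C ^ i * \<phi> D ^ (N - i)))
        = \<phi> D ^ N * (\<phi> E * \<phi> P ^ N + (\<Sum>i<N. \<phi> (c i) * \<phi> P ^ i * \<phi> Q ^ (N - i)))"
        unfolding ring_distribs sum_distrib_left
      proof (intro arg_cong2[where f = "(+)"] sum.cong refl)
        have "\<phi> Q ^ N * \<phi> C ^ N = \<phi> P ^ N * \<phi> D ^ N"
          using Suc.prems(4) by (simp flip: power_mult_distrib)
        then show "\<phi> Q ^ N * (\<phi> E * \<phi> C ^ N) = \<phi> D ^ N * (\<phi> E * \<phi> P ^ N)"
          by (simp add: mult_ac)
        fix i assume "i \<in> {..<N}"
        then have pw: "a ^ N = a ^ i * a ^ (N - i)" for a :: "'k mpoly" by (simp flip: power_add)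
        have PD: "\<phi> Q ^ i * \<phi> C ^ i = \<phi> P ^ i * \<phi> D ^ i"
          using Suc.prems(4) by (simp flip: power_mult_distrib)
        have "\<phi> Q ^ N * (\<phi> (c i) * \<phi> C ^ i * \<phi> D ^ (N - i))
           = (\<phi> Q ^ i * \<phi> C ^ i) * (\<phi> Q ^ (N - i) * \<phi> (c i) * \<phi> D ^ (N - i))"
          by (simp only: pw[of "\<phi> Q"] mult_ac)
        also have "\<dots> = \<phi> D ^ N * (\<phi> (c i) * \<phi> P ^ i * \<phi> Q ^ (N - i))"
          unfolding PD by (simp only: pw[of "\<phi> D"] mult_ac)
        finally show "\<phi> Q ^ N * (\<phi> (c i) * \<phi> C ^ i * \<phi> D ^ (N - i))
           = \<phi> D ^ N * (\<phi> (c i) * \<phi> P ^ i * \<phi> Q ^ (N - i))" .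
      qed
      then have eqC: "\<phi> E * \<phi> C ^ N + (\<Sum>i<N. \<phi> (c i) * \<phi> C ^ i * \<phi> D ^ (N - i)) = 0"
        using Q(1) unfolding eq by simp
      obtain g C' j where g: "g \<in> forms {..n} j" "peval g x \<noteq> 0"
        "C' \<in> forms {..n} (k + l + j)" "\<phi> (g * C) = \<phi> C'"
        using lower_z0_power[OF True x(2) E c Suc.prems(1,2) eqC] by blast
      have "\<phi> P * \<phi> (D * g) = \<phi> Q * \<phi> C'"
        unfolding g(4)[symmetric] phi_simps mult.assoc[symmetric] Suc.prems(4) by (simp only: mult_ac)
      moreover have "D * g \<in> forms {..n} (l + j)" by (rule forms_mult[OF Suc.prems(2) g(1)])
      moreover have "C' \<in> forms {..n} (k + (l + j))" using g(3) by (simp add: add.assoc)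
      moreover have "peval (D * g) x \<noteq> 0" using Suc.prems(3) g(2) by (simp add: peval_simps)
      ultimately show ?thesis using Suc.IH[of C' "l + j" "D * g"] by blast
    qed
  qed
  \<comment> \<open>Taking the degree at least \<open>m\<close> lets E serve as the initial
    denominator D.\<close>
  moreover obtain C where "C \<in> forms {..n} (max K\<^sub>0 m)" "\<phi> C = R" using K0[of "max K\<^sub>0 m"] by auto
  moreover have "max K\<^sub>0 m = (max K\<^sub>0 m - m) + m" by simp
  moreover have "\<phi> P * \<phi> E = \<phi> Q * R" using R by (simp add: mult.commute)
  ultimately show ?thesis using that E x(2) by metis
qed

end

section \<open>Rational functions on a hypersurface with a polynomial chart\<close>

lemma pt_eqD: assumes "pt v = pt w" obtains c where "c \<noteq> 0" "w = (\<lambda>i. c * v i)"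
proof -
  have "w \<in> pt w" unfolding pt_def by (rule CollectI, rule exI[of _ 1]) simp
  then have "w \<in> pt v" using assms by simp
  then show ?thesis using that by (auto simp: pt_def)
qed

text \<open>Rational functions are functions on points, so a representative has to be chosen. By
  \<open>ratio_pt\<close> the choice does not matter for forms of equal degree.\<close>

definition ratio :: "nat \<Rightarrow> 'k::field mpoly \<Rightarrow> 'k mpoly \<Rightarrow> 'k ppoint \<Rightarrow> 'k" where
  "ratio n F G p = (let v = SOME v. v \<in> hvecs n \<and> pt v = p in peval F v / peval G v)"

lemma ratio_pt:
  assumes "F \<in> forms {..n} k" "G \<in> forms {..n} k" "v \<in> hvecs n"
  shows "ratio n F G (pt v) = peval F v / peval G v"
proof -
  define w where "w = (SOME w. w \<in> hvecs n \<and> pt w = pt v)"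
  have "w \<in> hvecs n \<and> pt w = pt v" unfolding w_def by (rule someI[of _ v]) (simp add: assms)
  then obtain c where "c \<noteq> 0" "v = (\<lambda>i. c * w i)" by (metis pt_eqD)
  then have "peval F v / peval G v = peval F w / peval G w"
    using assms by (simp add: peval_form_scale)
  then show ?thesis by (simp add: ratio_def w_def Let_def)
qed

text \<open>Bridge between values at points, by which rational functions are defined, and the
  polynomial ring of the chart. As that ring is a domain, a product of forms that do not vanish
  identically on \<open>X\<close> does not vanish identically either.\<close>

locale hypersurface_chart = polynomial_chart n d f W \<phi>
  for n d :: nat and f :: "'k::field_char_0 mpoly" and W and \<phi> +
  fixes X :: "'k ppoint set"
  assumes vanishing: "H \<in> forms {..n} k \<Longrightarrow> (\<forall>v\<in>hvecs n. pt v \<in> X \<longrightarrow> peval H v = 0) \<longleftrightarrow> \<phi> H = 0"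
begin

lemma nonvanishing_iff: "G \<in> forms {..n} k \<Longrightarrow> nonvanishing_on n X G \<longleftrightarrow> \<phi> G \<noteq> 0"
  using vanishing[of G k] by (auto simp: nonvanishing_on_def)

abbreviation "Rat \<equiv> rational_map_ring n X"

lemma fractionsE:
  assumes "h \<in> fractions n X X"
  obtains k F G where "F \<in> forms {..n} k" "G \<in> forms {..n} k" "\<phi> G \<noteq> 0"
    "\<And>v. v \<in> hvecs n \<Longrightarrow> pt v \<in> X \<Longrightarrow> peval G v \<noteq> 0 \<Longrightarrow> h (pt v) = peval F v / peval G v"
proof -
  obtain k F G where *: "F \<in> forms {..n} k" "G \<in> forms {..n} k" "nonvanishing_on n X G"
    "\<forall>v\<in>hvecs n. pt v \<in> X \<and> peval G v \<noteq> 0 \<longrightarrow> h (pt v) = peval F v / peval G v"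
    using assms unfolding fractions_def by blast
  show ?thesis by (rule that[OF *(1,2)]) (use * nonvanishing_iff in auto)
qed

lemma fractionsI:
  assumes "F \<in> forms {..n} k" "G \<in> forms {..n} k" "\<phi> G \<noteq> 0"
    "\<And>v. v \<in> hvecs n \<Longrightarrow> pt v \<in> X \<Longrightarrow> peval G v \<noteq> 0 \<Longrightarrow> h (pt v) = peval F v / peval G v"
  shows "h \<in> fractions n X X"
proof -
  have "nonvanishing_on n X G" using assms(2,3) nonvanishing_iff by blast
  then show ?thesis using assms unfolding fractions_def by blast
qed

lemma fractions_add:
  assumes "g \<in> fractions n X X" "h \<in> fractions n X X"
  shows "(\<lambda>x. g x + h x) \<in> fractions n X X"
proof -
  obtain k F G where g: "F \<in> forms {..n} k" "G \<in> forms {..n} k" "\<phi> G \<noteq> 0"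
    "\<And>v. v \<in> hvecs n \<Longrightarrow> pt v \<in> X \<Longrightarrow> peval G v \<noteq> 0 \<Longrightarrow> g (pt v) = peval F v / peval G v"
    by (rule fractionsE[OF assms(1)], rule that)
  obtain l F' G' where h: "F' \<in> forms {..n} l" "G' \<in> forms {..n} l" "\<phi> G' \<noteq> 0"
    "\<And>v. v \<in> hvecs n \<Longrightarrow> pt v \<in> X \<Longrightarrow> peval G' v \<noteq> 0 \<Longrightarrow> h (pt v) = peval F' v / peval G' v"
    by (rule fractionsE[OF assms(2)], rule that)
  show ?thesis
  proof (rule fractionsI)
    show "F * G' + G * F' \<in> forms {..n} (k + l)" by (intro forms_add forms_mult g h)
    show "G * G' \<in> forms {..n} (k + l)" by (intro forms_mult g h)
    show "\<phi> (G * G') \<noteq> 0" unfolding phi_simps using g(3) h(3) by (rule no_zero_divisors)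
    fix v assume v: "v \<in> hvecs n" "pt v \<in> X" "peval (G * G') v \<noteq> 0"
    then have nz: "peval G v \<noteq> 0" "peval G' v \<noteq> 0" unfolding peval_simps by simp_all
    show "g (pt v) + h (pt v) = peval (F * G' + G * F') v / peval (G * G') v"
      unfolding g(4)[OF v(1,2) nz(1)] h(4)[OF v(1,2) nz(2)] using nz by (simp add: peval_simps add_frac_eq mult.commute)
  qed
qed

lemma fractions_mult:
  assumes "g \<in> fractions n X X" "h \<in> fractions n X X"
  shows "(\<lambda>x. g x * h x) \<in> fractions n X X"
proof -
  obtain k F G where g: "F \<in> forms {..n} k" "G \<in> forms {..n} k" "\<phi> G \<noteq> 0"
    "\<And>v. v \<in> hvecs n \<Longrightarrow> pt v \<in> X \<Longrightarrow> peval G v \<noteq> 0 \<Longrightarrow> g (pt v) = peval F v / peval G v"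
    by (rule fractionsE[OF assms(1)], rule that)
  obtain l F' G' where h: "F' \<in> forms {..n} l" "G' \<in> forms {..n} l" "\<phi> G' \<noteq> 0"
    "\<And>v. v \<in> hvecs n \<Longrightarrow> pt v \<in> X \<Longrightarrow> peval G' v \<noteq> 0 \<Longrightarrow> h (pt v) = peval F' v / peval G' v"
    by (rule fractionsE[OF assms(2)], rule that)
  show ?thesis
  proof (rule fractionsI)
    show "F * F' \<in> forms {..n} (k + l)" by (intro forms_mult g h)
    show "G * G' \<in> forms {..n} (k + l)" by (intro forms_mult g h)
    show "\<phi> (G * G') \<noteq> 0" unfolding phi_simps using g(3) h(3) by (rule no_zero_divisors)
    fix v assume v: "v \<in> hvecs n" "pt v \<in> X" "peval (G * G') v \<noteq> 0"
    then have nz: "peval G v \<noteq> 0" "peval G' v \<noteq> 0" unfolding peval_simps by simp_all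
    show "g (pt v) * h (pt v) = peval (F * F') v / peval (G * G') v"
      unfolding g(4)[OF v(1,2) nz(1)] h(4)[OF v(1,2) nz(2)] using nz by (simp add: peval_simps)
  qed
qed

lemma fractions_const: "(\<lambda>x. c) \<in> fractions n X X"
  by (rule fractionsI[of "Const c" 0 1]) (simp_all add: peval_simps)

lemma fractions_uminus: "h \<in> fractions n X X \<Longrightarrow> (\<lambda>x. - h x) \<in> fractions n X X"
  using fractions_mult[OF fractions_const[of "-1"], of h] by simp

lemma Rat_simps [simp]:
  "carrier Rat = fractions n X X" "(g \<otimes>\<^bsub>Rat\<^esub> h) = (\<lambda>x. g x * h x)" "\<one>\<^bsub>Rat\<^esub> = (\<lambda>x. 1)"
  "\<zero>\<^bsub>Rat\<^esub> = (\<lambda>x. 0)" "(g \<oplus>\<^bsub>Rat\<^esub> h) = (\<lambda>x. g x + h x)"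
  by (simp_all add: rational_map_ring_def)

lemma cring_Rat: "cring Rat"
proof (rule cringI)
  show "abelian_group Rat"
  proof (rule abelian_groupI)
    fix x assume "x \<in> carrier Rat"
    then show "\<exists>y\<in>carrier Rat. y \<oplus>\<^bsub>Rat\<^esub> x = \<zero>\<^bsub>Rat\<^esub>"
      by (intro bexI[of _ "\<lambda>p. - x p"]) (simp_all add: fractions_uminus)
  qed (simp_all add: fractions_add fractions_const add_ac)
  show "comm_monoid Rat"
    by (rule comm_monoidI) (simp_all add: fractions_mult fractions_const mult_ac)
qed (simp add: ring_distribs)

lemma ring_Rat: "ring Rat"
  by (rule cring.axioms(1)[OF cring_Rat])

section \<open>The ideal of generically zero functions\<close>

lemma generically_zeroE:
  assumes "h \<in> generically_zero n X"
  obtains k G where "G \<in> forms {..n} k" "\<phi> G \<noteq> 0"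
    "\<And>v. v \<in> hvecs n \<Longrightarrow> pt v \<in> X \<Longrightarrow> peval G v \<noteq> 0 \<Longrightarrow> h (pt v) = 0"
proof -
  obtain k G where *: "G \<in> forms {..n} k" "nonvanishing_on n X G"
    "\<forall>v\<in>hvecs n. pt v \<in> X \<and> peval G v \<noteq> 0 \<longrightarrow> h (pt v) = 0"
    using assms unfolding generically_zero_def by blast
  show ?thesis by (rule that[OF *(1)]) (use * nonvanishing_iff in auto)
qed

lemma generically_zeroI:
  assumes "h \<in> fractions n X X" "G \<in> forms {..n} k" "\<phi> G \<noteq> 0"
    "\<And>v. v \<in> hvecs n \<Longrightarrow> pt v \<in> X \<Longrightarrow> peval G v \<noteq> 0 \<Longrightarrow> h (pt v) = 0"
  shows "h \<in> generically_zero n X"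
proof -
  have "nonvanishing_on n X G" using assms(2,3) nonvanishing_iff by blast
  then show ?thesis using assms unfolding generically_zero_def by blast
qed

lemma generically_zero_subset: "h \<in> generically_zero n X \<Longrightarrow> h \<in> fractions n X X"
  by (simp add: generically_zero_def)

lemma generically_zero_add:
  assumes "g \<in> generically_zero n X" "h \<in> generically_zero n X"
  shows "(\<lambda>x. g x + h x) \<in> generically_zero n X"
proof -
  obtain k G where g: "G \<in> forms {..n} k" "\<phi> G \<noteq> 0"
    "\<And>v. v \<in> hvecs n \<Longrightarrow> pt v \<in> X \<Longrightarrow> peval G v \<noteq> 0 \<Longrightarrow> g (pt v) = 0"
    by (rule generically_zeroE[OF assms(1)], rule that)
  obtain l H where h: "H \<in> forms {..n} l" "\<phi> H \<noteq> 0"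
    "\<And>v. v \<in> hvecs n \<Longrightarrow> pt v \<in> X \<Longrightarrow> peval H v \<noteq> 0 \<Longrightarrow> h (pt v) = 0"
    by (rule generically_zeroE[OF assms(2)], rule that)
  show ?thesis
  proof (rule generically_zeroI)
    show "G * H \<in> forms {..n} (k + l)" by (intro forms_mult g h)
  qed (use g h assms in \<open>auto simp: peval_simps intro: fractions_add generically_zero_subset\<close>)
qed

lemma generically_zero_mult:
  assumes "g \<in> fractions n X X" "h \<in> generically_zero n X"
  shows "(\<lambda>x. g x * h x) \<in> generically_zero n X"
proof -
  obtain l H where h: "H \<in> forms {..n} l" "\<phi> H \<noteq> 0"
    "\<And>v. v \<in> hvecs n \<Longrightarrow> pt v \<in> X \<Longrightarrow> peval H v \<noteq> 0 \<Longrightarrow> h (pt v) = 0"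
    by (rule generically_zeroE[OF assms(2)], rule that)
  show ?thesis
    by (rule generically_zeroI[OF _ h(1,2)]) (use h assms in \<open>auto intro: fractions_mult generically_zero_subset\<close>)
qed

lemma ideal_generically_zero: "ideal (generically_zero n X) Rat"
proof (rule idealI[OF ring_Rat])
  interpret ring Rat by (rule ring_Rat)
  show "subgroup (generically_zero n X) (add_monoid Rat)"
  proof (rule add.subgroupI)
    have "(\<lambda>_. 0) \<in> generically_zero n X"
      by (rule generically_zeroI[of _ 1 0]) (simp_all add: fractions_const)
    then show "generically_zero n X \<noteq> {}" by blast
    fix a assume a: "a \<in> generically_zero n X"
    have "\<ominus>\<^bsub>Rat\<^esub> a = (\<lambda>x. - a x)"
      by (rule minus_equality) (simp_all add: fractions_uminus generically_zero_subset a)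
    then show "\<ominus>\<^bsub>Rat\<^esub> a \<in> generically_zero n X"
      using generically_zero_mult[OF fractions_const[of "-1"] a] by simp
  qed (auto simp: generically_zero_add generically_zero_subset)
  fix a x assume "a \<in> generically_zero n X" "x \<in> carrier Rat"
  then show "x \<otimes>\<^bsub>Rat\<^esub> a \<in> generically_zero n X" "a \<otimes>\<^bsub>Rat\<^esub> x \<in> generically_zero n X"
    using generically_zero_mult[of x a] by (simp_all add: mult.commute)
qed

lemma Rat_pow: "h [^]\<^bsub>Rat\<^esub> (N::nat) = (\<lambda>x. h x ^ N)"
  by (induction N) (simp_all add: nat_pow_def mult.commute)

lemma Rat_finsum:
  assumes "\<And>i::nat. i < N \<Longrightarrow> a i \<in> fractions n X X"
  shows "(\<Oplus>\<^bsub>Rat\<^esub>i\<in>{..<N}. a i) = (\<lambda>x. \<Sum>i<N. a i x)"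
  using assms
proof (induction N)
  interpret ring Rat by (rule ring_Rat)
  {
    case 0
    show ?case by simp
  next
    case (Suc N)
    then have "a \<in> {..<N} \<rightarrow> carrier Rat" "a N \<in> carrier Rat" by auto
    with Suc show ?case by (simp add: lessThan_Suc Pi_def add.commute)
  }
qed

lemma fractions_point_subset:
  assumes "p \<in> X" "h \<in> fractions n X {p}" shows "h \<in> fractions n X X"
  using assms by (fastforce simp: fractions_def nonvanishing_on_def)

text \<open>The integral equation between values of functions is turned into one between polynomials
  on the chart, to which \<open>integral_fraction_regular\<close> applies. The forms C and D
  obtained there define \<open>h'\<close>.\<close>

lemma local_ring_integrally_closed:
  assumes p: "p \<in> X"
    and h: "h \<in> fractions n X X" and a: "\<And>i. i < N \<Longrightarrow> a i \<in> fractions n X {p}"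
    and integral: "(\<lambda>x. h x ^ N + (\<Sum>i<N. a i x * h x ^ i)) \<in> generically_zero n X"
  obtains h' where "h' \<in> fractions n X {p}" "(\<lambda>x. h x - h' x) \<in> generically_zero n X"
proof -
  obtain k P Q where PQ: "P \<in> forms {..n} k" "Q \<in> forms {..n} k" "\<phi> Q \<noteq> 0"
    "\<And>v. v \<in> hvecs n \<Longrightarrow> pt v \<in> X \<Longrightarrow> peval Q v \<noteq> 0 \<Longrightarrow> h (pt v) = peval P v / peval Q v"
    by (rule fractionsE[OF h], rule that)
  have "\<forall>i. i < N \<longrightarrow> (\<exists>k F G. F \<in> forms {..n} k \<and> G \<in> forms {..n} k \<and> nonvanishing_on n {p} G \<and>
     (\<forall>v\<in>hvecs n. pt v \<in> X \<and> peval G v \<noteq> 0 \<longrightarrow> a i (pt v) = peval F v / peval G v))"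
    using a unfolding fractions_def by blast
  then obtain l F G where FG: "\<And>i. i < N \<Longrightarrow> F i \<in> forms {..n} (l i)" "\<And>i. i < N \<Longrightarrow> G i \<in> forms {..n} (l i)"
    "\<And>i. i < N \<Longrightarrow> nonvanishing_on n {p} (G i)"
    "\<And>i v. i < N \<Longrightarrow> v \<in> hvecs n \<Longrightarrow> pt v \<in> X \<Longrightarrow> peval (G i) v \<noteq> 0 \<Longrightarrow>
       a i (pt v) = peval (F i) v / peval (G i) v"
    by metis
  obtain e T where T: "T \<in> forms {..n} e" "\<phi> T \<noteq> 0"
    "\<And>v. v \<in> hvecs n \<Longrightarrow> pt v \<in> X \<Longrightarrow> peval T v \<noteq> 0 \<Longrightarrow> h (pt v) ^ N + (\<Sum>i<N. a i (pt v) * h (pt v) ^ i) = 0"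
    by (rule generically_zeroE[OF integral], rule that)
  \<comment> \<open>The points of \<open>X\<close> are not assumed to come from
    \<open>hvecs n\<close>, so a representative of p is taken from a denominator of a coefficient.
    For N = 0 there is none, but then the equation reads 1 = 0 generically.\<close>
  obtain x where x: "x \<in> hvecs n" "pt x = p"
  proof -
    show ?thesis
    proof (cases "N = 0")
      case True
      have "\<phi> T = 0"
        using vanishing[OF T(1)] T(3) True by auto
      then show ?thesis using T(2) by simp
    next
      case False
      then show ?thesis using FG(3)[of 0] that by (auto simp: nonvanishing_on_def)
    qed
  qed
  have Gx: "peval (G i) x \<noteq> 0" if i: "i < N" for i
  proof -
    obtain v where v: "v \<in> hvecs n" "pt v = p" "peval (G i) v \<noteq> 0"
      using FG(3)[OF i] by (auto simp: nonvanishing_on_def)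
    then obtain c where "c \<noteq> 0" "v = (\<lambda>j. c * x j)" using x by (metis pt_eqD)
    then show ?thesis using v(3) peval_form_scale[OF FG(2)[OF i]] by auto
  qed
  \<comment> \<open>The coefficients are brought to the common denominator \<open>E\<close>, with
    numerators \<open>c i\<close>.\<close>
  define m E c where "m = (\<Sum>i<N. l i)" and "E = (\<Prod>i<N. G i)" and "c i = F i * (\<Prod>j\<in>{..<N} - {i}. G j)" for i
  have E: "E \<in> forms {..n} m" unfolding E_def m_def by (rule forms_prod) (simp add: FG)
  have c: "c i \<in> forms {..n} m" if "i < N" for i
  proof -
    have "c i \<in> forms {..n} (l i + (\<Sum>j\<in>{..<N} - {i}. l j))"
      unfolding c_def by (intro forms_mult forms_prod FG) (use that in auto)
    then show ?thesis using that by (simp add: m_def sum.remove[of "{..<N}" i])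
  qed
  have Ex: "peval E x \<noteq> 0" using Gx by (simp add: E_def peval_prod)
  then have E0: "\<phi> E \<noteq> 0" using vanishing[OF E] x p by auto
  define Z where "Z = E * P ^ N + (\<Sum>i<N. c i * P ^ i * Q ^ (N - i))"
  have "c i * P ^ i * Q ^ (N - i) \<in> forms {..n} (m + N * k)" if "i < N" for i
  proof -
    have "c i * P ^ i * Q ^ (N - i) \<in> forms {..n} (m + i * k + (N - i) * k)"
      by (intro forms_mult forms_power PQ c that)
    also have "m + i * k + (N - i) * k = m + N * k"
      using that by (simp add: add.assoc flip: add_mult_distrib)
    finally show ?thesis .
  qed
  moreover have "E * P ^ N \<in> forms {..n} (m + N * k)" by (intro forms_mult forms_power PQ E)
  ultimately have "Z \<in> forms {..n} (m + N * k)"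
    unfolding Z_def by (intro forms_add forms_sum) auto
  \<comment> \<open>Where T, Q or E vanishes the product is 0; elsewhere all fractions are given by
    their forms and the integral equation holds. Since \<phi> maps into a domain, it must kill the
    factor \<open>Z\<close>.\<close>
  then have ZTQE: "Z * T * Q * E \<in> forms {..n} (m + N * k + e + k + m)"
    by (intro forms_mult T PQ E)
  have "peval (Z * T * Q * E) v = 0" if v: "v \<in> hvecs n" "pt v \<in> X" for v
  proof (cases "peval T v = 0 \<or> peval Q v = 0 \<or> peval E v = 0")
    case False
    then have nz: "peval T v \<noteq> 0" "peval Q v \<noteq> 0" "\<And>i. i < N \<Longrightarrow> peval (G i) v \<noteq> 0"
      by (auto simp: E_def peval_prod)
    define r where "r = h (pt v)"
    have P: "peval P v = r * peval Q v" using PQ(4)[OF v nz(2)] nz(2) by (simp add: r_def)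
    have cv: "peval (c i) v = a i (pt v) * peval E v" if i: "i < N" for i
    proof -
      have "peval (F i) v = a i (pt v) * peval (G i) v" using FG(4)[OF i v nz(3)[OF i]] nz(3)[OF i] by simp
      moreover have "peval E v = peval (G i) v * (\<Prod>j\<in>{..<N} - {i}. peval (G j) v)"
        using i unfolding E_def peval_prod by (simp add: prod.remove[of "{..<N}" i])
      ultimately show ?thesis by (simp add: c_def peval_simps peval_prod)
    qed
    have trm: "peval (c i * P ^ i * Q ^ (N - i)) v = peval E v * peval Q v ^ N * (a i (pt v) * r ^ i)" if "i < N" for i
    proof -
      have "peval Q v ^ N = peval Q v ^ i * peval Q v ^ (N - i)" using that by (simp flip: power_add)
      then show ?thesis using that by (simp add: peval_simps cv P power_mult_distrib mult_ac)
    qed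
    have "peval (\<Sum>i<N. c i * P ^ i * Q ^ (N - i)) v = peval E v * peval Q v ^ N * (\<Sum>i<N. a i (pt v) * r ^ i)"
      unfolding peval_sum sum_distrib_left by (rule sum.cong) (simp_all add: trm)
    then have "peval Z v = peval E v * peval Q v ^ N * (r ^ N + (\<Sum>i<N. a i (pt v) * r ^ i))"
      by (simp only: Z_def peval_simps ring_distribs) (simp add: P power_mult_distrib mult_ac)
    also have "\<dots> = 0" using T(3)[OF v nz(1)] by (simp add: r_def)
    finally show ?thesis by (simp add: peval_simps)
  qed (auto simp: peval_simps)
  then have "\<phi> (Z * T * Q * E) = 0" using vanishing[OF ZTQE] by blast
  then have "\<phi> Z = 0" using T(2) PQ(3) E0 by simp
  then have eq: "\<phi> E * \<phi> P ^ N + (\<Sum>i<N. \<phi> (c i) * \<phi> P ^ i * \<phi> Q ^ (N - i)) = 0"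
    by (simp add: Z_def)
  have fx: "peval f x = 0" using vanishing[OF f_form] phi_f x p by blast
  obtain C D k' where CD: "C \<in> forms {..n} k'" "D \<in> forms {..n} k'" "peval D x \<noteq> 0" "\<phi> P * \<phi> D = \<phi> Q * \<phi> C"
    using integral_fraction_regular[OF fx Ex E c PQ(3) forms_in_vars[OF PQ(2)] forms_in_vars[OF PQ(1)] eq]
    by blast
  define h' where "h' = ratio n C D"
  have h': "h' (pt v) = peval C v / peval D v" if "v \<in> hvecs n" for v
    unfolding h'_def by (rule ratio_pt[OF CD(1,2) that])
  have h'p: "h' \<in> fractions n X {p}"
    unfolding fractions_def nonvanishing_on_def using CD x h' by blast
  have D0: "\<phi> D \<noteq> 0" using vanishing[OF CD(2)] CD(3) x p by auto
  have PDQC: "P * D - Q * C \<in> forms {..n} (k + k')" by (intro forms_diff forms_mult PQ CD)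
  moreover have "\<phi> (P * D - Q * C) = 0" using CD(4) by simp
  ultimately have zero: "peval P v * peval D v = peval Q v * peval C v" if "v \<in> hvecs n" "pt v \<in> X" for v
    using vanishing that by (fastforce simp: peval_simps)
  have "(\<lambda>x. h x - h' x) \<in> generically_zero n X"
  proof (rule generically_zeroI)
    show "(\<lambda>x. h x - h' x) \<in> fractions n X X"
      using fractions_add[OF h fractions_uminus[OF fractions_point_subset[OF p h'p]]] by simp
    show "Q * D \<in> forms {..n} (k + k')" by (intro forms_mult PQ CD)
    show "\<phi> (Q * D) \<noteq> 0" using PQ(3) D0 by simp
    fix v assume v: "v \<in> hvecs n" "pt v \<in> X" "peval (Q * D) v \<noteq> 0"
    then have nz: "peval Q v \<noteq> 0" "peval D v \<noteq> 0" unfolding peval_simps by simp_all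
    show "h (pt v) - h' (pt v) = 0"
      unfolding PQ(4)[OF v(1,2) nz(1)] h'[OF v(1)]
      using zero[OF v(1,2)] nz by (simp add: frac_eq_eq mult.commute)
  qed
  then show ?thesis using that h'p by blast
qed

theorem normal_variety_if_irreducible:
  assumes "irreducible_closed n X" shows "normal_variety n X"
  unfolding normal_variety_def integrally_closed_in_def
proof (intro conjI ballI impI assms)
  fix p r assume p: "p \<in> X" and r: "r \<in> carrier (function_field n X)"
    and "integral_over (function_field n X) (local_ring_at n X p) r"
  interpret ideal "generically_zero n X" Rat by (rule ideal_generically_zero)
  let ?I = "generically_zero n X" and ?L = "function_field n X"
  let ?q = "\<lambda>h. ?I +>\<^bsub>Rat\<^esub> h"
  interpret q: ring_hom_ring Rat ?L ?q
    unfolding function_field_def by (rule rcos_ring_hom_ring)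
  obtain N c where c: "\<And>i::nat. i < N \<Longrightarrow> c i \<in> local_ring_at n X p"
    and eq: "r [^]\<^bsub>?L\<^esub> N \<oplus>\<^bsub>?L\<^esub> (\<Oplus>\<^bsub>?L\<^esub>i\<in>{..<N}. c i \<otimes>\<^bsub>?L\<^esub> r [^]\<^bsub>?L\<^esub> i) = \<zero>\<^bsub>?L\<^esub>"
    using \<open>integral_over _ _ _\<close> unfolding integral_over_def by blast
  obtain h where h: "h \<in> fractions n X X" "r = ?q h"
    using r by (auto simp: function_field_def FactRing_def A_RCOSETS_def' )
  have "\<forall>i. \<exists>b. i < N \<longrightarrow> b \<in> fractions n X {p} \<and> c i = ?q b"
    using c unfolding local_ring_at_def by blast
  then obtain a where a: "\<And>i. i < N \<Longrightarrow> a i \<in> fractions n X {p}" "\<And>i. i < N \<Longrightarrow> c i = ?q (a i)"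
    by metis
  have aX: "a i \<in> carrier Rat" if "i < N" for i
    using fractions_point_subset[OF p a(1)[OF that]] by simp
  have hX: "h \<in> carrier Rat" using h by simp
  \<comment> \<open>The left side of the equation formed from representatives. Its coset is 0, so it
    lies in \<open>?I\<close>.\<close>
  let ?w = "h [^]\<^bsub>Rat\<^esub> N \<oplus>\<^bsub>Rat\<^esub> (\<Oplus>\<^bsub>Rat\<^esub>i\<in>{..<N}. a i \<otimes>\<^bsub>Rat\<^esub> h [^]\<^bsub>Rat\<^esub> i)"
  have trm: "a i \<otimes>\<^bsub>Rat\<^esub> h [^]\<^bsub>Rat\<^esub> i \<in> carrier Rat" if "i < N" for i
    using m_closed[OF aX[OF that] nat_pow_closed[OF hX]] .
  have sum: "(\<Oplus>\<^bsub>Rat\<^esub>i\<in>{..<N}. a i \<otimes>\<^bsub>Rat\<^esub> h [^]\<^bsub>Rat\<^esub> i) \<in> carrier Rat"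
    using trm by (intro finsum_closed) (auto simp del: Rat_simps)
  have w: "?w \<in> carrier Rat" by (rule a_closed[OF nat_pow_closed[OF hX] sum])
  have "?q ?w = ?q (h [^]\<^bsub>Rat\<^esub> N) \<oplus>\<^bsub>?L\<^esub> ?q (\<Oplus>\<^bsub>Rat\<^esub>i\<in>{..<N}. a i \<otimes>\<^bsub>Rat\<^esub> h [^]\<^bsub>Rat\<^esub> i)"
    by (rule q.hom_add[OF nat_pow_closed[OF hX] sum])
  also have "?q (\<Oplus>\<^bsub>Rat\<^esub>i\<in>{..<N}. a i \<otimes>\<^bsub>Rat\<^esub> h [^]\<^bsub>Rat\<^esub> i)
      = (\<Oplus>\<^bsub>?L\<^esub>i\<in>{..<N}. ?q (a i \<otimes>\<^bsub>Rat\<^esub> h [^]\<^bsub>Rat\<^esub> i))"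
    using ring_hom_cring.hom_finsum[OF rcos_ring_hom_cring[OF cring_Rat],
        of "\<lambda>i. a i \<otimes>\<^bsub>Rat\<^esub> h [^]\<^bsub>Rat\<^esub> i" "{..<N}"] trm
    by (simp add: function_field_def comp_def del: Rat_simps)
  also have "\<dots> = (\<Oplus>\<^bsub>?L\<^esub>i\<in>{..<N}. c i \<otimes>\<^bsub>?L\<^esub> r [^]\<^bsub>?L\<^esub> i)"
  proof (rule q.S.finsum_cong')
    show "(\<lambda>i. c i \<otimes>\<^bsub>?L\<^esub> r [^]\<^bsub>?L\<^esub> i) \<in> {..<N} \<rightarrow> carrier ?L"
      using a(2) h(2) aX hX by (auto simp del: Rat_simps)
    fix i assume i: "i \<in> {..<N}"
    then show "?q (a i \<otimes>\<^bsub>Rat\<^esub> h [^]\<^bsub>Rat\<^esub> i) = c i \<otimes>\<^bsub>?L\<^esub> r [^]\<^bsub>?L\<^esub> i"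
      using q.hom_mult[OF aX nat_pow_closed[OF hX], of i i] q.hom_nat_pow[OF hX, of i] a(2)[of i] h(2)
      by (simp del: Rat_simps)
  qed simp
  also have "?q (h [^]\<^bsub>Rat\<^esub> N) = r [^]\<^bsub>?L\<^esub> N" using q.hom_nat_pow[OF hX] h(2) by simp
  also note eq
  also have "\<zero>\<^bsub>?L\<^esub> = ?I" by (simp add: function_field_def FactRing_def)
  finally have "?w \<in> ?I" by (rule rcos_const_imp_mem[OF w])
  moreover have "?w = (\<lambda>x. h x ^ N + (\<Sum>i<N. a i x * h x ^ i))"
  proof -
    have "(\<Oplus>\<^bsub>Rat\<^esub>i\<in>{..<N}. a i \<otimes>\<^bsub>Rat\<^esub> h [^]\<^bsub>Rat\<^esub> i) = (\<lambda>x. \<Sum>i<N. (a i \<otimes>\<^bsub>Rat\<^esub> h [^]\<^bsub>Rat\<^esub> i) x)"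
      by (rule Rat_finsum) (use trm in auto)
    then show ?thesis by (simp add: Rat_pow)
  qed
  ultimately have integral: "(\<lambda>x. h x ^ N + (\<Sum>i<N. a i x * h x ^ i)) \<in> ?I" by (simp only:)
  obtain h' where h': "h' \<in> fractions n X {p}" "(\<lambda>x. h x - h' x) \<in> ?I"
    by (rule local_ring_integrally_closed[where a = a, OF p h(1) a(1) integral], assumption, rule that)
  have h'X: "h' \<in> carrier Rat" using fractions_point_subset[OF p h'(1)] by simp
  have "h = (\<lambda>x. h x - h' x) \<oplus>\<^bsub>Rat\<^esub> h'" by simp
  also have "\<dots> \<in> ?q h'" by (rule a_rcosI[OF h'(2) a_subset h'X])
  finally have "?q h' = ?q h" by (rule a_repr_independence[OF _ h'X a_subgroup])
  then show "r \<in> local_ring_at n X p"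
    unfolding local_ring_at_def using h'(1) h(2) by auto
qed

end

section \<open>Charts given by inverse polynomial maps\<close>

text \<open>
  The maps \<open>y \<mapsto> (Ep 1, \<dots>, Ep n)\<close> and \<open>z \<mapsto> (Lp 0, \<dots>, Lp (n - 1))\<close> are mutually inverse and, on the
  chart \<open>z\<^sub>0 = 1\<close>, they turn the equation \<open>f = 0\<close> into \<open>y\<^sub>0 = 0\<close>.
\<close>

locale straightened_hypersurface =
  fixes n d :: nat and f :: "'k::field_char_0 mpoly" and Ep Lp :: "nat \<Rightarrow> 'k mpoly" and X :: "'k ppoint set"
  assumes n: "n \<ge> 1"
    and Ep_vars: "in_vars {..<n} (Ep i)"
    and Lp_vars: "in_vars {1..n} (Lp j)"
    and Lp_Ep: "j < n \<Longrightarrow> peval (Lp j) (\<lambda>i. peval (Ep i) y) = y j"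
    and Ep_Lp: "i \<in> {1..n} \<Longrightarrow> peval (Ep i) (\<lambda>j. peval (Lp j) z) = z i"
    and f_form: "f \<in> forms {..n} d"
    and f_chart: "v 0 = 1 \<Longrightarrow> peval f v = peval (Lp 0) v"
    and squarefree_at_infinity: "squarefree (subst (Var(0 := 0)) f)"
    and X_subset: "v \<in> hvecs n \<Longrightarrow> pt v \<in> X \<Longrightarrow> peval f v = 0"
    and X_chart: "v \<in> hvecs n \<Longrightarrow> v 0 = 1 \<Longrightarrow> peval f v = 0 \<Longrightarrow> pt v \<in> X"
begin

text \<open>Homogeneous coordinates of the chart point with parameter y. The value 0 beyond n places
  the point in \<open>hvecs n\<close>.\<close>

definition full_coords :: "nat \<Rightarrow> 'k mpoly" where
  "full_coords i = (if i = 0 then 1 else if i \<le> n then Ep i else 0)"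

text \<open>In the parameters y the equation f = 0 reads y_0 = 0 by
  \<open>peval_f_full_coords\<close>, so setting y_0 to 0 is restriction to the
  hypersurface.\<close>

definition restrict :: "'k mpoly \<Rightarrow> 'k mpoly" where
  "restrict = subst (\<lambda>i. subst (Var(0 := 0)) (full_coords i))"

lemma full_coords_vars: "in_vars {..<n} (full_coords i)"
  by (simp add: full_coords_def Ep_vars)

lemma peval_at_0: "peval (subst (Var(0 := 0)) p) y = peval p (y(0 := 0))"
  by (auto simp: peval_subst peval_simps intro!: arg_cong[of _ _ "peval p"])

lemma peval_restrict: "peval (restrict H) y = peval H (\<lambda>i. peval (full_coords i) (y(0 := 0)))"
  by (simp add: restrict_def peval_subst[of _ H] peval_at_0)

lemma Lp_full_coords: "j < n \<Longrightarrow> peval (Lp j) (\<lambda>i. peval (full_coords i) y) = y j"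
  using Lp_Ep[of j y] peval_cong[OF Lp_vars, of "\<lambda>i. peval (full_coords i) y" "\<lambda>i. peval (Ep i) y" j]
  by (simp add: full_coords_def)

lemma full_coords_0: "peval (full_coords 0) y = 1"
  by (simp add: full_coords_def peval_simps)

lemma peval_f_full_coords: "peval f (\<lambda>i. peval (full_coords i) y) = y 0"
  using f_chart[of "\<lambda>i. peval (full_coords i) y"] Lp_full_coords[of 0 y] n by (simp add: full_coords_0)

lemma full_coords_Lp:
  assumes "w 0 = 1" "i \<le> n" shows "peval (full_coords i) (\<lambda>j. peval (Lp j) w) = w i"
  using assms Ep_Lp[of i w] by (auto simp: full_coords_def peval_simps)

lemma at_infinity_nonzero: "subst (Var(0 := 0)) f \<noteq> 0"
  using squarefree_at_infinity by auto

text \<open>f is not identically zero on z_0 = 0. If z_0 divides f G, then G vanishes there, so G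
  takes over the factor z_0 and it cancels.\<close>

lemma dvd_Var_0_power_cancel: "f dvd Var 0 ^ j * H \<Longrightarrow> f dvd H"
proof (induction j)
  case (Suc j)
  obtain G where G: "Var 0 * (Var 0 ^ j * H) = f * G"
    using Suc.prems by (auto simp: dvd_def mult.assoc)
  have "subst (Var(0 := 0)) f * subst (Var(0 := 0)) G = subst (Var(0 := 0)) (Var 0 * (Var 0 ^ j * H))"
    unfolding G by (simp add: mev_mult)
  also have "\<dots> = 0" by (simp add: mev_mult[of Const] mev_Var)
  finally have "subst (Var(0 := 0)) G = 0" using at_infinity_nonzero by simp
  then obtain G' where "G = Var 0 * G'" using Var_dvd_if_subst_0 by (metis dvdE)
  with G have "Var 0 * (Var 0 ^ j * H) = Var 0 * (f * G')" by (simp add: mult_ac)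
  moreover have "Var 0 \<noteq> (0 :: 'k mpoly)" by (rule Var_neq_0)
  ultimately have "Var 0 ^ j * H = f * G'" by (metis mult_cancel_left)
  then show ?case using Suc.IH by simp
qed simp

text \<open>On the chart H is divisible by y_0, which is f there. Homogenizing the quotient gives f
  G = z_0^j H for some j, and the power of z_0 cancels.\<close>

lemma f_dvd_if_restrict_0:
  assumes H: "H \<in> forms {..n} k" and 0: "restrict H = 0" shows "f dvd H"
proof -
  have "subst (Var(0 := 0)) (subst full_coords H) = restrict H"
    by (rule mpoly_eqI[of UNIV]) (simp_all add: in_vars_def peval_at_0 peval_subst[of full_coords] peval_restrict)
  then have "Var 0 dvd subst full_coords H" using 0 by (intro Var_dvd_if_subst_0) simp
  then obtain S where S: "subst full_coords H = Var 0 * S" by (auto simp: dvd_def)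
  define S' where "S' = subst Lp S"
  have S'V: "in_vars {1..n} S'"
    unfolding S'_def by (rule in_vars_subst[of UNIV]) (simp_all only: Lp_vars, simp add: in_vars_def)
  \<comment> \<open>\<open>K\<close> is at least k, which keeps the truncated difference
    \<open>d + K - k\<close> exact.\<close>
  define K where "K = max (tdeg S') k"
  obtain G where G: "G \<in> forms {..n} K"
    "\<And>v. v 0 \<noteq> 0 \<Longrightarrow> peval G v = v 0 ^ K * peval S' (\<lambda>i. v i / v 0)"
    using homogenize[OF S'V, of K] by (auto simp: K_def)
  have eq: "peval (f * G) v = peval (Var 0 ^ (d + K - k) * H) v" if v: "v 0 \<noteq> 0" for v
  proof -
    define w where "w = (\<lambda>i. v i / v 0)"
    have vw: "v = (\<lambda>i. v 0 * w i)" and w0: "w 0 = 1" using v by (auto simp: w_def)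
    have "peval H w = peval H (\<lambda>i. peval (full_coords i) (\<lambda>j. peval (Lp j) w))"
      by (rule peval_cong[OF forms_in_vars[OF H]]) (simp add: full_coords_Lp w0)
    also have "\<dots> = peval (subst full_coords H) (\<lambda>j. peval (Lp j) w)" by (simp add: peval_subst)
    also have "\<dots> = peval f w * peval S' w"
      by (simp add: S S'_def peval_simps peval_subst f_chart[of w, OF w0])
    finally have Hw: "peval H w = peval f w * peval S' w" .
    have f: "peval f v = v 0 ^ d * peval f w"
      using peval_form_scale[OF f_form, of "v 0" w] vw by simp
    have H: "peval H v = v 0 ^ k * peval H w"
      using peval_form_scale[OF H, of "v 0" w] vw by simp
    have "d + K - k + k = d + K" by (simp add: K_def)
    then have pw: "v 0 ^ d * v 0 ^ K = v 0 ^ (d + K - k) * v 0 ^ k" by (simp flip: power_add)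
    have G: "peval G v = v 0 ^ K * peval S' w" using G(2)[of v] v by (simp add: w_def)
    have "peval (f * G) v = (v 0 ^ d * v 0 ^ K) * (peval f w * peval S' w)"
      by (simp only: peval_simps f G mult_ac)
    also have "\<dots> = peval (Var 0 ^ (d + K - k) * H) v"
      unfolding pw by (simp only: peval_simps H Hw mult_ac)
    finally show ?thesis .
  qed
  \<comment> \<open>\<open>eq\<close> covers only z_0 \<noteq> 0. A further factor z_0 makes both
    sides agree at every point and is cancelled afterwards.\<close>
  have "Var 0 * (f * G) = Var 0 * (Var 0 ^ (d + K - k) * H)"
  proof (rule mpoly_eqI[of UNIV])
    fix v :: "nat \<Rightarrow> 'k"
    show "peval (Var 0 * (f * G)) v = peval (Var 0 * (Var 0 ^ (d + K - k) * H)) v"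
      unfolding peval_simps(2)[of "Var 0"] using eq[of v] by (cases "v 0 = 0") (simp_all add: peval_simps(6))
  qed (simp_all add: in_vars_def)
  moreover have "Var 0 \<noteq> (0 :: 'k mpoly)" by (rule Var_neq_0)
  ultimately have "Var 0 ^ (d + K - k) * H = f * G" by (metis mult_cancel_left)
  then show ?thesis using dvd_Var_0_power_cancel[of "d + K - k" H] by simp
qed

text \<open>A preimage arises by expressing R in z through \<open>Lp\<close> and homogenizing, which
  is possible in every degree from that of the result on.\<close>

lemma restrict_surj:
  assumes "in_vars {1..<n} R" shows "\<exists>K\<^sub>0. \<forall>K\<ge>K\<^sub>0. \<exists>C\<in>forms {..n} K. restrict C = R"
proof -
  define p where "p = subst Lp R"
  have pV: "in_vars {1..n} p"
    unfolding p_def by (rule in_vars_subst[OF assms]) (rule Lp_vars)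
  have "\<exists>C\<in>forms {..n} K. restrict C = R" if K: "K \<ge> tdeg p" for K
  proof -
    obtain C where C: "C \<in> forms {..n} K" "\<And>v. v 0 \<noteq> 0 \<Longrightarrow> peval C v = v 0 ^ K * peval p (\<lambda>i. v i / v 0)"
      using homogenize[OF pV K] by blast
    have "peval (restrict C) y = peval R y" for y
    proof -
      have "peval (restrict C) y = peval p (\<lambda>i. peval (full_coords i) (y(0 := 0)))"
        unfolding peval_restrict by (subst C(2)) (simp_all add: full_coords_0)
      also have "\<dots> = peval R (\<lambda>j. peval (Lp j) (\<lambda>i. peval (full_coords i) (y(0 := 0))))"
        by (simp add: p_def peval_subst)
      also have "\<dots> = peval R y"
        by (rule peval_cong[OF assms]) (simp add: Lp_full_coords)
      finally show ?thesis .
    qed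
    then have "restrict C = R" by (intro mpoly_eqI[of UNIV]) (simp_all add: in_vars_def)
    then show ?thesis using C(1) by blast
  qed
  then show ?thesis by blast
qed

lemma hypersurface_chart: "hypersurface_chart n d f {1..<n} restrict X"
proof unfold_locales
  show "coeff_hom restrict" by (simp add: restrict_def)
  show "restrict (Var 0) = 1" by (simp add: restrict_def mev_simps full_coords_def)
  show "in_vars {1..<n} (restrict H)" if "in_vars {..n} H" for H
    unfolding restrict_def
  proof (rule in_vars_subst[OF that])
    show "in_vars {1..<n} (subst (Var(0 := 0)) (full_coords i))" for i
      by (rule in_vars_subst[OF full_coords_vars]) (auto intro: in_vars_Var)
  qed
  show "restrict f = 0"
    by (rule mpoly_eq_0_if_peval_eq_0) (simp add: peval_restrict peval_f_full_coords)
  fix H :: "'k mpoly" and k assume H: "H \<in> forms {..n} k"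
  show "(\<forall>v\<in>hvecs n. pt v \<in> X \<longrightarrow> peval H v = 0) \<longleftrightarrow> restrict H = 0"
  proof
    assume van: "\<forall>v\<in>hvecs n. pt v \<in> X \<longrightarrow> peval H v = 0"
    show "restrict H = 0"
    proof (rule mpoly_eq_0_if_peval_eq_0)
      fix y
      \<comment> \<open>These points satisfy z_0 = 1 and y_0 = 0, hence lie on \<open>X\<close>, and
        their remaining parameters are arbitrary.\<close>
      let ?v = "\<lambda>i. peval (full_coords i) (y(0 := 0))"
      have v0: "?v 0 = 1" by (rule full_coords_0)
      then have "?v \<noteq> (\<lambda>_. 0)" by (metis zero_neq_one)
      then have v: "?v \<in> hvecs n"
        unfolding hvecs_def aff_def by (simp add: full_coords_def peval_simps)
      have "peval f ?v = 0" by (simp add: peval_f_full_coords)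
      then have "pt ?v \<in> X" by (rule X_chart[OF v v0])
      with van v have "peval H ?v = 0" by blast
      then show "peval (restrict H) y = 0" by (simp only: peval_restrict)
    qed
  next
    assume "restrict H = 0"
    then have "f dvd H" by (rule f_dvd_if_restrict_0[OF H])
    then show "\<forall>v\<in>hvecs n. pt v \<in> X \<longrightarrow> peval H v = 0"
      using X_subset by (auto simp: dvd_def peval_simps)
  qed
qed (fact restrict_surj f_form f_dvd_if_restrict_0 squarefree_at_infinity)+

end

section \<open>Exponential and logarithm on the maximal ideal\<close>

context fin_dim_algebra
begin

lemma mult_scale: "x * scale c y = scale c (x * y)"
  by (metis mult.commute scale_mult)

text \<open>Truncation at \<open>N\<close>, which loses nothing when x^N = 0. For such x it respects
  products and composition, so exp and ln are inverse on \<open>M\<close> because the formal series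
  are.\<close>

definition fps_eval :: "nat \<Rightarrow> 'k fps \<Rightarrow> 'a \<Rightarrow> 'a" where
  "fps_eval N F x = (\<Sum>k<N. scale (fps_nth F k) (x ^ k))"

lemma power_zero_mono: "x ^ N = 0 \<Longrightarrow> N \<le> k \<Longrightarrow> x ^ k = (0 :: 'a)"
  by (metis le_add_diff_inverse mult_zero_left power_add)

lemma fps_eval_diff: "fps_eval N (F - G) x = fps_eval N F x - fps_eval N G x"
  by (simp add: fps_eval_def scale_left_diff_distrib sum_subtractf)

lemma fps_eval_1: "N > 0 \<Longrightarrow> fps_eval N 1 x = 1"
  by (simp add: fps_eval_def if_distribR if_distrib[of "\<lambda>c. scale c _"] cong: if_cong)

lemma fps_eval_X: "x ^ N = 0 \<Longrightarrow> fps_eval N fps_X x = x"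
proof (cases "N \<ge> 2")
  case False
  assume "x ^ N = 0"
  then have "x = 0" using power_zero_mono[of x N 1] False by simp
  then show ?thesis by (simp add: fps_eval_def power_0_left if_distrib[of "scale _"] fps_X_def cong: if_cong)
next
  case True
  then have "(1::nat) \<in> {..<N}" by simp
  then show ?thesis
    by (simp add: fps_eval_def fps_X_def if_distribR if_distrib[of "\<lambda>c. scale c _"] cong: if_cong)
qed

lemma fps_eval_mult:
  assumes "x ^ N = 0" shows "fps_eval N (F * G) x = fps_eval N F x * fps_eval N G x"
proof -
  define g where "g i j = scale (fps_nth F i * fps_nth G j) (x ^ (i + j))" for i j
  have "fps_eval N F x * fps_eval N G x = (\<Sum>i<N. \<Sum>j<N. g i j)"
    by (simp add: fps_eval_def sum_product g_def scale_mult mult_scale power_add mult.commute)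
  also have "\<dots> = (\<Sum>(i, j)\<in>{..<N} \<times> {..<N}. g i j)" by (simp add: sum.cartesian_product)
  \<comment> \<open>Pairs with i + j \<ge> N contribute multiples of x^N = 0.\<close>
  also have "\<dots> = (\<Sum>(i, j)\<in>{(i, j). i + j < N}. g i j)"
    using power_zero_mono[OF assms] by (intro sum.mono_neutral_right) (auto simp: g_def simp flip: not_le)
  also have "\<dots> = (\<Sum>k<N. \<Sum>i\<le>k. g i (k - i))" by (rule sum.triangle_reindex)
  also have "\<dots> = fps_eval N (F * G) x"
    by (simp add: fps_eval_def fps_mult_nth g_def scale_sum_left atLeast0AtMost)
  finally show ?thesis by simp
qed

lemma fps_eval_power:
  assumes "x ^ N = 0" "N > 0" shows "fps_eval N (F ^ k) x = fps_eval N F x ^ k"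
  by (induction k) (simp_all add: fps_eval_1 fps_eval_mult assms)

lemma fps_eval_compose:
  assumes x: "x ^ N = 0" "N > 0" and G: "fps_nth G 0 = 0"
  shows "fps_eval N (F oo G) x = fps_eval N F (fps_eval N G x)"
proof -
  \<comment> \<open>G has no constant term, so G^i starts in degree i and the outer series may be
    cut at \<open>N\<close>.\<close>
  have zero: "fps_nth (G ^ i) k = 0" if "k < i" for i k
    using that G by (rule startsby_zero_power_prefix[rule_format, rotated])
  have "fps_eval N (F oo G) x = (\<Sum>k<N. scale (\<Sum>i=0..k. fps_nth F i * fps_nth (G ^ i) k) (x ^ k))"
    by (simp add: fps_eval_def fps_compose_nth)
  also have "\<dots> = (\<Sum>k<N. scale (\<Sum>i<N. fps_nth F i * fps_nth (G ^ i) k) (x ^ k))"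
    by (intro sum.cong refl arg_cong2[where f = scale] sum.mono_neutral_left) (auto simp: zero)
  also have "\<dots> = (\<Sum>i<N. scale (fps_nth F i) (fps_eval N (G ^ i) x))"
    by (simp add: fps_eval_def scale_sum_left scale_sum_right) (rule sum.swap)
  also have "\<dots> = fps_eval N F (fps_eval N G x)"
    unfolding fps_eval_power[OF x] by (simp add: fps_eval_def)
  finally show ?thesis .
qed

end

section \<open>Nilpotency of the maximal ideal\<close>

context H_pair
begin

lemma ideal_M: "is_ideal M"
  using maximal_ideal by (simp add: is_maximal_ideal_def)

lemma M_closed: "0 \<in> M" "x \<in> M \<Longrightarrow> y \<in> M \<Longrightarrow> x + y \<in> M" "x \<in> M \<Longrightarrow> a * x \<in> M" "x \<in> M \<Longrightarrow> x * a \<in> M"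
  using ideal_M by (auto simp: is_ideal_def mult.commute)

lemma M_scale: "x \<in> M \<Longrightarrow> scale c x \<in> M"
  using M_closed(3)[of x "scale c 1"] by (simp add: scale_mult)

lemma M_diff: "x \<in> M \<Longrightarrow> y \<in> M \<Longrightarrow> x - y \<in> M"
  using M_closed(2)[of x "- 1 * y"] M_closed(3)[of y "-1"] by simp

lemma M_sum: "(\<And>s. s \<in> S \<Longrightarrow> g s \<in> M) \<Longrightarrow> sum g S \<in> M"
  by (induction S rule: infinite_finite_induct) (simp_all add: M_closed)

lemma M_power: "x \<in> M \<Longrightarrow> k > 0 \<Longrightarrow> x ^ k \<in> M"
  by (cases k) (simp_all add: M_closed)

lemma one_notin_M: "1 \<notin> M"
  using M_closed(3)[of 1] maximal_ideal by (auto simp: is_maximal_ideal_def)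

text \<open>If y were not a unit, Zorn's lemma would give a maximal ideal containing the multiples
  of y. By locality it is \<open>M\<close>, so y would lie in \<open>M\<close>.\<close>

lemma unit_if_notin_M:
  assumes y: "y \<notin> M" shows "\<exists>z. y * z = 1"
proof (rule ccontr)
  assume nz: "\<nexists>z. y * z = 1"
  define A where "A = {I. is_ideal I \<and> range ((*) y) \<subseteq> I \<and> 1 \<notin> I}"
  have "is_ideal (range ((*) y))"
    unfolding is_ideal_def by (auto simp: image_def intro: exI[of _ 0])
      (metis distrib_left, metis mult.left_commute)
  then have "range ((*) y) \<in> A" using nz by (auto simp: A_def)
  moreover have "\<Union>C \<in> A" if C: "C \<noteq> {}" "subset.chain A C" for C
  proof -
    have CA: "\<And>I. I \<in> C \<Longrightarrow> is_ideal I \<and> range ((*) y) \<subseteq> I \<and> 1 \<notin> I"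
      using C(2) by (auto simp: A_def subset.chain_def)
    have "x + z \<in> \<Union>C" if xz: "x \<in> \<Union>C" "z \<in> \<Union>C" for x z
    proof -
      obtain I J where IJ: "I \<in> C" "J \<in> C" "x \<in> I" "z \<in> J" using xz by blast
      then consider "I \<subseteq> J" | "J \<subseteq> I" using C(2) by (auto simp: subset.chain_def)
      then have "x + z \<in> I \<or> x + z \<in> J"
        by cases (use IJ CA[OF IJ(1)] CA[OF IJ(2)] in \<open>auto simp: is_ideal_def\<close>)
      then show ?thesis using IJ by blast
    qed
    moreover have "a * x \<in> \<Union>C" if "x \<in> \<Union>C" for a x
      using that CA unfolding is_ideal_def by blast
    moreover have "0 \<in> \<Union>C" using CA C(1) unfolding is_ideal_def by blast
    ultimately have "is_ideal (\<Union>C)" unfolding is_ideal_def by blast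
    then show ?thesis using CA C(1) by (auto simp: A_def)
  qed
  ultimately have "\<exists>J\<in>A. \<forall>I\<in>A. J \<subseteq> I \<longrightarrow> I = J"
    by (intro subset_Zorn_nonempty) auto
  then obtain J where J: "J \<in> A" "\<And>I. I \<in> A \<Longrightarrow> J \<subseteq> I \<Longrightarrow> I = J" by blast
  have "is_maximal_ideal J"
    unfolding is_maximal_ideal_def
  proof (intro conjI allI impI)
    show "is_ideal J" "J \<noteq> UNIV" using J(1) by (auto simp: A_def)
    fix I assume I: "is_ideal I \<and> J \<subseteq> I"
    show "I = J \<or> I = UNIV"
    proof (cases "1 \<in> I")
      case True
      then have "a \<in> I" for a using I by (metis is_ideal_def mult.right_neutral)
      then show ?thesis by auto
    next
      case False
      then have "I \<in> A" using I J(1) by (auto simp: A_def)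
      then show ?thesis using J(2) I by blast
    qed
  qed
  then have "J = M" by (rule local_ring)
  moreover have "y * 1 \<in> J" using J(1) unfolding A_def by blast
  ultimately show False using y by simp
qed

text \<open>With k the least index of a nonzero coefficient, the relation is x^k times the sum of a
  nonzero scalar and an element of \<open>M\<close>. That sum is a unit, so x^k = 0.\<close>

lemma power_zero_if_relation:
  assumes x: "x \<in> M" and c: "c j \<noteq> 0" "j \<le> D" "(\<Sum>i\<le>D. scale (c i) (x ^ i)) = 0"
  shows "x ^ D = 0"
proof -
  define k where "k = (LEAST j. c j \<noteq> 0)"
  have k: "c k \<noteq> 0" "\<And>i. i < k \<Longrightarrow> c i = 0" "k \<le> D"
    unfolding k_def using LeastI[of "\<lambda>j. c j \<noteq> 0" j] c not_less_Least Least_le[of "\<lambda>j. c j \<noteq> 0" j] by auto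
  define y where "y = (\<Sum>i\<in>{..D} - {..k}. scale (c i) (x ^ (i - k)))"
  have "scale (c i) (x ^ i) = x ^ k * scale (c i) (x ^ (i - k))" if "i \<ge> k" for i
    using that by (simp add: mult_scale flip: power_add)
  then have "(\<Sum>i\<in>{..D} - {..k}. scale (c i) (x ^ i)) = x ^ k * y"
    by (simp add: y_def sum_distrib_left)
  moreover have "(\<Sum>i\<le>D. scale (c i) (x ^ i)) = (\<Sum>i\<in>{..k}. scale (c i) (x ^ i)) + (\<Sum>i\<in>{..D} - {..k}. scale (c i) (x ^ i))"
    using k(3) by (subst sum.subset_diff[of "{..k}"]) (auto simp: add.commute)
  moreover have "(\<Sum>i\<in>{..k}. scale (c i) (x ^ i)) = x ^ k * scale (c k) 1"
    using k(2) by (subst sum.remove[of _ k]) (auto simp: mult_scale intro!: sum.neutral)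
  ultimately have 0: "x ^ k * (scale (c k) 1 + y) = 0" using c(3) by (simp add: distrib_left)
  have "y \<in> M" unfolding y_def by (intro M_sum M_scale M_power x) auto
  have "scale (c k) 1 + y \<notin> M"
  proof
    assume "scale (c k) 1 + y \<in> M"
    then have "scale (c k) 1 \<in> M" using M_diff[OF _ \<open>y \<in> M\<close>] by fastforce
    then have "scale (1 / c k) (scale (c k) 1) \<in> M" by (rule M_scale)
    then show False using k(1) one_notin_M by simp
  qed
  then obtain z where "(scale (c k) 1 + y) * z = 1" using unit_if_notin_M by blast
  then have "x ^ k = x ^ k * (scale (c k) 1 + y) * z" by (simp add: mult.assoc)
  then have "x ^ k = 0" using 0 by simp
  then show ?thesis using k(3) power_zero_mono by blast
qed

lemma nilpotent: "\<exists>N>0. \<forall>x\<in>M. x ^ N = 0"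
proof -
  obtain B where B: "finite B" "span B = UNIV" using finite_spanning_set by blast
  \<comment> \<open>Already \<open>x ^ card B\<close> is 0, since 1, x, ...,
    \<open>x ^ card B\<close> are too many powers to be independent. \<open>Suc\<close> makes the
    exponent positive.\<close>
  have "x ^ Suc (card B) = 0" if x: "x \<in> M" for x
  proof -
    let ?D = "card B" and ?P = "(\<lambda>i. x ^ i) ` {..card B}"
    have "x ^ ?D = 0"
    \<comment> \<open>Linear dependence of a set does not see repeated powers; for these x^i - x^j =
      0 is the relation.\<close>
    proof (cases "inj_on (\<lambda>i. x ^ i) {..?D}")
      case True
      have "\<not> card ?P \<le> card B" using True by (simp add: card_image)
      then have "dependent ?P" using independent_span_bound[OF B(1), of ?P] B(2) by auto
      then obtain u where u: "\<exists>v\<in>?P. u v \<noteq> 0" "(\<Sum>v\<in>?P. scale (u v) v) = 0"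
        by (subst (asm) dependent_finite) auto
      have "(\<Sum>i\<le>?D. scale (u (x ^ i)) (x ^ i)) = 0"
        using u(2) by (simp add: sum.reindex[OF True] comp_def)
      moreover obtain j where "j \<le> ?D" "u (x ^ j) \<noteq> 0" using u(1) by auto
      ultimately show ?thesis using power_zero_if_relation[OF x, of "\<lambda>i. u (x ^ i)" j] by blast
    next
      case False
      then obtain i j where ij: "i \<le> ?D" "j \<le> ?D" "i \<noteq> j" "x ^ i = x ^ j" by (auto simp: inj_on_def)
      let ?c = "\<lambda>k. (if k = i then 1 else 0) - (if k = j then 1 else (0::'k))"
      have "(\<Sum>k\<le>?D. scale (?c k) (x ^ k)) = x ^ i - x ^ j"
        using ij by (simp add: scale_left_diff_distrib sum_subtractf if_distribR if_distrib[of "\<lambda>c. scale c _"] cong: if_cong)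
      then show ?thesis using power_zero_if_relation[OF x, of ?c i] ij by simp
    qed
    then show ?thesis by simp
  qed
  then show ?thesis by blast
qed

end

locale H_pair_coords = H_pair scale M U
  for scale :: "'k::field_char_0 \<Rightarrow> 'a::comm_ring_1 \<Rightarrow> 'a" and M U +
  fixes n :: nat and e :: "nat \<Rightarrow> 'a"
  assumes basis: "basis_of scale n e M"
begin

abbreviation "coords_to_ideal \<equiv> ideal_part scale n e"

lemma e_in_M: "i \<in> {1..n} \<Longrightarrow> e i \<in> M"
  using basis span_superset[of "e ` {1..n}"] by (auto simp: basis_of_def)

lemma ideal_part_in_M: "coords_to_ideal v \<in> M"
  unfolding ideal_part_def by (intro M_sum M_scale e_in_M)

lemma ex_coords: assumes "x \<in> M" shows "\<exists>v. x = coords_to_ideal v"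
proof -
  have "x \<in> span (e ` {1..n})" using assms basis by (simp add: basis_of_def)
  then obtain u where "x = (\<Sum>b\<in>e ` {1..n}. scale (u b) b)" by (auto simp: span_finite)
  then have "x = coords_to_ideal (\<lambda>i. u (e i))"
    using basis by (simp add: basis_of_def sum.reindex ideal_part_def)
  then show ?thesis by blast
qed

lemma coords_unique:
  assumes "coords_to_ideal v = coords_to_ideal w" "i \<in> {1..n}" shows "v i = w i"
proof (rule ccontr)
  assume ne: "v i \<noteq> w i"
  have inj: "inj_on e {1..n}" using basis by (simp add: basis_of_def)
  define u where "u b = v (the_inv_into {1..n} e b) - w (the_inv_into {1..n} e b)" for b
  have u: "u (e j) = v j - w j" if "j \<in> {1..n}" for j
    using the_inv_into_f_f[OF inj that] by (simp add: u_def)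
  have "(\<Sum>b\<in>e ` {1..n}. scale (u b) b) = (\<Sum>j=1..n. scale (u (e j)) (e j))"
    by (rule sum.reindex[OF inj, unfolded comp_def])
  also have "\<dots> = (\<Sum>j=1..n. scale (v j - w j) (e j))"
    by (rule sum.cong) (simp_all add: u)
  also have "\<dots> = 0"
    using assms(1) by (simp add: ideal_part_def scale_left_diff_distrib sum_subtractf)
  finally have "(\<Sum>b\<in>e ` {1..n}. scale (u b) b) = 0" .
  moreover have "u (e i) \<noteq> 0" using u[OF assms(2)] ne by simp
  ultimately have "dependent (e ` {1..n})"
    using dependent_finite[of "e ` {1..n}"] assms(2) by blast
  then show False using basis by (simp add: basis_of_def)
qed

section \<open>Exponential and logarithm as inverse maps\<close>

definition nil_index :: nat where
  "nil_index = (SOME N. N > 0 \<and> (\<forall>x\<in>M. x ^ N = 0))"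

lemma nil_index: "nil_index > 0" "x \<in> M \<Longrightarrow> x ^ nil_index = 0"
  using someI_ex[of "\<lambda>N. N > 0 \<and> (\<forall>x\<in>M. x ^ N = 0)"] nilpotent by (auto simp: nil_index_def)

text \<open>The constant term is split off because \<open>fps_eval_compose\<close> and
  \<open>fps_eval_in_M\<close> are about series without one.\<close>

lemma nil_exp_eq: assumes "x \<in> M" shows "nil_exp scale x = 1 + fps_eval nil_index (fps_exp 1 - 1) x"
proof -
  have "nil_exp scale x = fps_eval nil_index (fps_exp 1) x"
    unfolding nil_exp_def fps_eval_def using power_zero_mono[OF nil_index(2)[OF assms]]
    by (intro sum.mono_neutral_cong_left) (auto simp: not_less[symmetric])
  then show ?thesis by (simp add: fps_eval_diff fps_eval_1 nil_index)
qed

lemma nil_ln1p_eq: assumes "x \<in> M" shows "nil_ln1p scale x = fps_eval nil_index (fps_ln 1) x"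
  unfolding nil_ln1p_def fps_eval_def using power_zero_mono[OF nil_index(2)[OF assms]]
  by (intro sum.mono_neutral_cong_left) (auto simp: not_less[symmetric] fps_ln_nth)

lemma fps_eval_in_M: "x \<in> M \<Longrightarrow> fps_nth F 0 = 0 \<Longrightarrow> fps_eval N F x \<in> M"
  unfolding fps_eval_def
proof (rule M_sum)
  fix k assume "x \<in> M" "fps_nth F 0 = 0"
  then show "scale (fps_nth F k) (x ^ k) \<in> M" by (cases "k = 0") (simp_all add: M_closed M_scale M_power)
qed

lemma nil_exp_minus_1_in_M: "x \<in> M \<Longrightarrow> nil_exp scale x - 1 \<in> M"
  by (simp add: nil_exp_eq fps_eval_in_M)

lemma nil_ln1p_in_M: "x \<in> M \<Longrightarrow> nil_ln1p scale x \<in> M"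
  by (simp add: nil_ln1p_eq fps_eval_in_M)

lemma fps_ln_exp: "fps_ln 1 oo (fps_exp 1 - 1) = (fps_X :: 'k fps)"
  and fps_exp_ln: "(fps_exp 1 - 1) oo fps_ln 1 = (fps_X :: 'k fps)"
  by (simp_all add: fps_ln_fps_exp_inv fps_inv fps_inv_right)

lemma ln_exp: assumes "x \<in> M" shows "nil_ln1p scale (nil_exp scale x - 1) = x"
proof -
  have "nil_ln1p scale (nil_exp scale x - 1) = fps_eval nil_index (fps_ln 1) (fps_eval nil_index (fps_exp 1 - 1) x)"
    by (simp add: nil_ln1p_eq nil_exp_minus_1_in_M assms) (simp add: nil_exp_eq assms)
  also have "\<dots> = x"
    using nil_index assms by (simp add: fps_eval_compose[symmetric] fps_ln_exp fps_eval_X)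
  finally show ?thesis .
qed

lemma exp_ln: assumes "x \<in> M" shows "nil_exp scale (nil_ln1p scale x) = 1 + x"
proof -
  have "nil_exp scale (nil_ln1p scale x) = 1 + fps_eval nil_index (fps_exp 1 - 1) (fps_eval nil_index (fps_ln 1) x)"
    by (simp add: nil_exp_eq nil_ln1p_in_M assms) (simp add: nil_ln1p_eq assms)
  also have "\<dots> = 1 + x"
    using nil_index assms by (simp add: fps_eval_compose[symmetric] fps_exp_ln fps_eval_X)
  finally show ?thesis .
qed

subsection \<open>Polynomial maps into the maximal ideal\<close>

text \<open>Closure under the ring operations makes exp and ln polynomial in coordinates without
  explicit formulas. The values lie in \<open>M\<close>, which lacks a unit; hence
  \<open>Suc k\<close> in \<open>poly_map_power\<close> and the condition on the constant term in
  \<open>poly_map_fps_eval\<close>.\<close>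

definition poly_map :: "nat set \<Rightarrow> ((nat \<Rightarrow> 'k) \<Rightarrow> 'a) \<Rightarrow> bool" where
  "poly_map V g \<longleftrightarrow> (\<exists>p. (\<forall>i. in_vars V (p i)) \<and> (\<forall>v. g v = coords_to_ideal (\<lambda>i. peval (p i) v)))"

lemma poly_map_0: "poly_map V (\<lambda>v. 0)"
  unfolding poly_map_def by (rule exI[of _ "\<lambda>_. 0"]) (simp add: ideal_part_def peval_simps)

lemma poly_map_add: assumes "poly_map V g" "poly_map V h" shows "poly_map V (\<lambda>v. g v + h v)"
proof -
  obtain p q where "\<forall>i. in_vars V (p i)" "\<forall>v. g v = coords_to_ideal (\<lambda>i. peval (p i) v)"
    "\<forall>i. in_vars V (q i)" "\<forall>v. h v = coords_to_ideal (\<lambda>i. peval (q i) v)"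
    using assms unfolding poly_map_def by metis
  then show ?thesis
    unfolding poly_map_def
    by (intro exI[of _ "\<lambda>i. p i + q i"])
      (simp add: in_vars_add ideal_part_def peval_simps scale_left_distrib sum.distrib)
qed

lemma poly_map_scale: assumes "poly_map V g" shows "poly_map V (\<lambda>v. scale c (g v))"
proof -
  obtain p where "\<forall>i. in_vars V (p i)" "\<forall>v. g v = coords_to_ideal (\<lambda>i. peval (p i) v)"
    using assms unfolding poly_map_def by metis
  then show ?thesis
    unfolding poly_map_def
    by (intro exI[of _ "\<lambda>i. Const c * p i"])
      (simp add: in_vars_mult ideal_part_def peval_simps scale_sum_right)
qed

lemma poly_map_sum: "(\<And>s. s \<in> S \<Longrightarrow> poly_map V (g s)) \<Longrightarrow> poly_map V (\<lambda>v. \<Sum>s\<in>S. g s v)"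
  by (induction S rule: infinite_finite_induct) (simp_all add: poly_map_0 poly_map_add)

lemma poly_map_coord: assumes "b \<in> M" "i \<in> V" shows "poly_map V (\<lambda>v. scale (v i) b)"
proof -
  obtain c where "b = coords_to_ideal c" using ex_coords assms(1) by blast
  then show ?thesis
    unfolding poly_map_def using assms(2)
    by (intro exI[of _ "\<lambda>j. Var i * Const (c j)"])
      (simp add: in_vars_mult in_vars_Var ideal_part_def peval_simps scale_sum_right)
qed

lemma poly_map_mult: assumes "poly_map V g" "poly_map V h" shows "poly_map V (\<lambda>v. g v * h v)"
proof -
  obtain p q where p: "\<And>i. in_vars V (p i)" "\<And>v. g v = coords_to_ideal (\<lambda>i. peval (p i) v)"
    and q: "\<And>i. in_vars V (q i)" "\<And>v. h v = coords_to_ideal (\<lambda>i. peval (q i) v)"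
    using assms unfolding poly_map_def by metis
  \<comment> \<open>Structure constants of the multiplication of \<open>M\<close> in the basis
    \<open>e\<close>.\<close>
  have "\<exists>c. i \<in> {1..n} \<longrightarrow> e i * e j = coords_to_ideal c" for i j
    using ex_coords[OF M_closed(4)[OF e_in_M]] by blast
  then obtain c where c: "\<And>i j. i \<in> {1..n} \<Longrightarrow> e i * e j = coords_to_ideal (c i j)" by metis
  define r where "r k = (\<Sum>i=1..n. \<Sum>j=1..n. p i * q j * Const (c i j k))" for k
  have "g v * h v = coords_to_ideal (\<lambda>k. peval (r k) v)" for v
  proof -
    have "g v * h v = (\<Sum>i=1..n. \<Sum>j=1..n. scale (peval (p i) v * peval (q j) v) (e i * e j))"
      by (simp add: p(2) q(2) ideal_part_def sum_product scale_mult mult_scale mult.commute)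
    also have "\<dots> = (\<Sum>i=1..n. \<Sum>j=1..n. \<Sum>k=1..n. scale (peval (p i) v * peval (q j) v * c i j k) (e k))"
      by (intro sum.cong refl) (simp add: c ideal_part_def scale_sum_right)
    also have "\<dots> = (\<Sum>i=1..n. \<Sum>k=1..n. \<Sum>j=1..n. scale (peval (p i) v * peval (q j) v * c i j k) (e k))"
      by (intro sum.cong refl sum.swap)
    also have "\<dots> = (\<Sum>k=1..n. \<Sum>i=1..n. \<Sum>j=1..n. scale (peval (p i) v * peval (q j) v * c i j k) (e k))"
      by (rule sum.swap)
    also have "\<dots> = coords_to_ideal (\<lambda>k. peval (r k) v)"
      by (simp add: ideal_part_def r_def peval_sum peval_simps scale_sum_left)
    finally show ?thesis .
  qed
  moreover have "in_vars V (r k)" for k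
    unfolding r_def by (intro in_vars_sum in_vars_mult p q in_vars_Const)
  ultimately show ?thesis unfolding poly_map_def by blast
qed

lemma poly_map_power: "poly_map V g \<Longrightarrow> poly_map V (\<lambda>v. g v ^ Suc k)"
  by (induction k) (simp_all add: poly_map_mult)

lemma poly_map_fps_eval:
  assumes "poly_map V g" "fps_nth F 0 = 0" shows "poly_map V (\<lambda>v. fps_eval N F (g v))"
  unfolding fps_eval_def
proof (rule poly_map_sum)
  fix k
  show "poly_map V (\<lambda>v. scale (fps_nth F k) (g v ^ k))"
    using assms poly_map_scale[OF poly_map_power[OF assms(1)]] by (cases k) (simp_all add: poly_map_0)
qed

lemma poly_map_in_M: "poly_map V g \<Longrightarrow> g v \<in> M"
  using ideal_part_in_M by (auto simp: poly_map_def)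

lemma poly_map_exp: assumes "poly_map V g" shows "poly_map V (\<lambda>v. nil_exp scale (g v) - 1)"
  using poly_map_fps_eval[OF assms, of "fps_exp 1 - 1" nil_index] poly_map_in_M[OF assms]
  by (simp add: nil_exp_eq)

lemma poly_map_ln: assumes "poly_map V g" shows "poly_map V (\<lambda>v. nil_ln1p scale (g v))"
  using poly_map_fps_eval[OF assms, of "fps_ln 1" nil_index] poly_map_in_M[OF assms]
  by (simp add: nil_ln1p_eq)

section \<open>Linear coordinates on the maximal ideal\<close>

definition linear_on_M :: "('a \<Rightarrow> 'k) \<Rightarrow> bool" where
  "linear_on_M \<kappa> \<longleftrightarrow> (\<forall>x\<in>M. \<forall>y\<in>M. \<kappa> (x + y) = \<kappa> x + \<kappa> y) \<and> (\<forall>c. \<forall>x\<in>M. \<kappa> (scale c x) = c * \<kappa> x)"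

lemma linear_on_M_0: "linear_on_M \<kappa> \<Longrightarrow> \<kappa> 0 = 0"
  using M_closed(1) unfolding linear_on_M_def by (metis mult_zero_left scale_zero_left)

lemma linear_on_M_sum:
  assumes "linear_on_M \<kappa>" "\<And>s. s \<in> S \<Longrightarrow> b s \<in> M"
  shows "\<kappa> (\<Sum>s\<in>S. scale (c s) (b s)) = (\<Sum>s\<in>S. c s * \<kappa> (b s))"
  using assms(2)
proof (induction S rule: infinite_finite_induct)
  case (insert s S)
  have "(\<Sum>s\<in>S. scale (c s) (b s)) \<in> M" "scale (c s) (b s) \<in> M"
    using insert by (auto intro: M_sum M_scale)
  then show ?case using insert assms(1) by (simp add: linear_on_M_def)
qed (simp_all add: linear_on_M_0 assms)

lemma poly_map_linear:
  assumes "poly_map V g" "linear_on_M \<kappa>"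
  shows "\<exists>p. in_vars V p \<and> (\<forall>v. \<kappa> (g v) = peval p v)"
proof -
  obtain p where p: "\<And>i. in_vars V (p i)" "\<And>v. g v = coords_to_ideal (\<lambda>i. peval (p i) v)"
    using assms unfolding poly_map_def by metis
  have "\<kappa> (g v) = peval (\<Sum>i=1..n. p i * Const (\<kappa> (e i))) v" for v
  proof -
    have "\<kappa> (g v) = (\<Sum>i=1..n. peval (p i) v * \<kappa> (e i))"
      unfolding p(2) ideal_part_def by (rule linear_on_M_sum[OF assms(2) e_in_M])
    then show ?thesis by (simp add: peval_sum peval_simps)
  qed
  moreover have "in_vars V (\<Sum>i=1..n. p i * Const (\<kappa> (e i)))"
    by (intro in_vars_sum in_vars_mult p in_vars_Const)
  ultimately show ?thesis by blast
qed

text \<open>Two bases are involved: z refers to \<open>e\<close>, in which f is written, and y to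
  \<open>b\<close> with its dual functionals \<kappa>. \<open>Ep\<close> is exp minus 1 from y to z,
  and \<open>Lp\<close> is ln(1 + z) from z to y.\<close>

lemma exp_ln_polynomials:
  assumes b: "\<And>j. j < n \<Longrightarrow> b j \<in> M" and \<kappa>: "\<And>j. j < n \<Longrightarrow> linear_on_M (\<kappa> j)"
    and expand: "\<And>x. x \<in> M \<Longrightarrow> x = (\<Sum>j<n. scale (\<kappa> j x) (b j))"
    and dual: "\<And>j y. j < n \<Longrightarrow> \<kappa> j (\<Sum>i<n. scale (y i) (b i)) = y j"
  obtains Ep Lp where "\<And>i. in_vars {..<n} (Ep i)" "\<And>j. in_vars {1..n} (Lp j)"
    "\<And>j z. j < n \<Longrightarrow> peval (Lp j) z = \<kappa> j (nil_ln1p scale (coords_to_ideal z))"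
    "\<And>j y. j < n \<Longrightarrow> peval (Lp j) (\<lambda>i. peval (Ep i) y) = y j"
    "\<And>i z. i \<in> {1..n} \<Longrightarrow> peval (Ep i) (\<lambda>j. peval (Lp j) z) = z i"
proof -
  have "poly_map {..<n} (\<lambda>y. \<Sum>j<n. scale (y j) (b j))"
    by (intro poly_map_sum poly_map_coord b) auto
  then have "poly_map {..<n} (\<lambda>y. nil_exp scale (\<Sum>j<n. scale (y j) (b j)) - 1)"
    by (rule poly_map_exp)
  then obtain Ep where Ep: "\<And>i. in_vars {..<n} (Ep i)"
    "\<And>y. nil_exp scale (\<Sum>j<n. scale (y j) (b j)) - 1 = coords_to_ideal (\<lambda>i. peval (Ep i) y)"
    unfolding poly_map_def by metis
  have "poly_map {1..n} coords_to_ideal"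
    unfolding ideal_part_def by (intro poly_map_sum poly_map_coord e_in_M)
  then have "\<exists>p. in_vars {1..n} p \<and> (\<forall>z. \<kappa> j (nil_ln1p scale (coords_to_ideal z)) = peval p z)" if "j < n" for j
    using poly_map_linear[OF poly_map_ln \<kappa>[OF that]] by blast
  \<comment> \<open>The polynomial 0 is the default for j \<ge> n, so that the condition on
    variables holds for every j.\<close>
  then have "\<forall>j. \<exists>p. in_vars {1..n} p \<and> (j < n \<longrightarrow> (\<forall>z. \<kappa> j (nil_ln1p scale (coords_to_ideal z)) = peval p z))"
    using in_vars_0 by metis
  then obtain Lp where Lp: "\<And>j. in_vars {1..n} (Lp j)"
    "\<And>j z. j < n \<Longrightarrow> \<kappa> j (nil_ln1p scale (coords_to_ideal z)) = peval (Lp j) z" by metis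
  have LpEp: "peval (Lp j) (\<lambda>i. peval (Ep i) y) = y j" if j: "j < n" for j y
  proof -
    have "(\<Sum>j<n. scale (y j) (b j)) \<in> M" by (intro M_sum M_scale b) auto
    then show ?thesis by (simp add: Lp(2)[OF j, symmetric] Ep(2)[symmetric] ln_exp dual j)
  qed
  have EpLp: "peval (Ep i) (\<lambda>j. peval (Lp j) z) = z i" if i: "i \<in> {1..n}" for i z
  proof -
    let ?x = "nil_ln1p scale (coords_to_ideal z)"
    have "coords_to_ideal (\<lambda>i. peval (Ep i) (\<lambda>j. peval (Lp j) z)) = nil_exp scale (\<Sum>j<n. scale (peval (Lp j) z) (b j)) - 1"
      by (simp add: Ep(2))
    also have "(\<Sum>j<n. scale (peval (Lp j) z) (b j)) = (\<Sum>j<n. scale (\<kappa> j ?x) (b j))"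
      by (intro sum.cong) (simp_all add: Lp(2))
    also have "\<dots> = ?x" using expand[OF nil_ln1p_in_M[OF ideal_part_in_M]] by (rule sym)
    also have "nil_exp scale ?x - 1 = coords_to_ideal z" by (simp add: exp_ln ideal_part_in_M)
    finally show ?thesis by (rule coords_unique[OF _ i])
  qed
  show ?thesis by (rule that) (rule Ep(1) Lp(1) Lp(2)[symmetric] LpEp EpLp; assumption)+
qed

text \<open>The isomorphism \<tau> supplies a basis of \<open>U\<close> with n - 1 elements,
  completed by a vector on which \<pi> is 1. Then \<pi> is the first coordinate, and the equation of
  the hypersurface on the chart becomes y_0 = 0.\<close>

lemma adapted_coordinates:
  assumes n: "n \<ge> 1" and \<pi>: "quotient_projection scale M U \<pi>"
    and bij: "bij_betw \<tau> (aff (n - 1)) U"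
    and add: "\<And>s t. s \<in> aff (n - 1) \<Longrightarrow> t \<in> aff (n - 1) \<Longrightarrow> \<tau> (\<lambda>i. s i + t i) = \<tau> s + \<tau> t"
    and scale: "\<And>c s. s \<in> aff (n - 1) \<Longrightarrow> \<tau> (\<lambda>i. c * s i) = scale c (\<tau> s)"
  obtains b \<kappa> where "\<And>j. j < n \<Longrightarrow> b j \<in> M" "\<And>j. j < n \<Longrightarrow> linear_on_M (\<kappa> j)"
    "\<And>x. x \<in> M \<Longrightarrow> x = (\<Sum>j<n. scale (\<kappa> j x) (b j))"
    "\<And>j y. j < n \<Longrightarrow> \<kappa> j (\<Sum>i<n. scale (y i) (b i)) = y j"
    "\<kappa> 0 = \<pi>"
proof -
  define \<delta> where "\<delta> i = (\<lambda>k. if k = i then 1 else 0 :: 'k)" for i :: nat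
  have \<delta>: "\<delta> i \<in> aff (n - 1)" if "i < n - 1" for i using that by (auto simp: \<delta>_def aff_def)
  have \<tau>_expand: "\<tau> s = (\<Sum>i<n - 1. scale (s i) (\<tau> (\<delta> i)))" if s: "s \<in> aff (n - 1)" for s
  proof -
    have "\<tau> (\<lambda>i. if i < k then s i else 0) = (\<Sum>i<k. scale (s i) (\<tau> (\<delta> i)))" if "k \<le> n - 1" for k
      using that
    proof (induction k)
      case 0
      have "\<tau> (\<lambda>i. 0 * \<delta> 0 i) = 0" using scale[of "\<lambda>_. 0" 0] by (simp add: aff_def)
      then show ?case by simp
    next
      case (Suc k)
      have "(\<lambda>i. if i < Suc k then s i else 0) = (\<lambda>i. (if i < k then s i else 0) + s k * \<delta> k i)"
        by (auto simp: \<delta>_def less_Suc_eq)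
      moreover have "(\<lambda>i. if i < k then s i else 0) \<in> aff (n - 1)" "(\<lambda>i. s k * \<delta> k i) \<in> aff (n - 1)"
        using Suc.prems by (auto simp: aff_def \<delta>_def)
      ultimately show ?case using Suc \<delta>[of k] by (simp add: add scale)
    qed
    from this[of "n - 1"] have "\<tau> (\<lambda>i. if i < n - 1 then s i else 0) = (\<Sum>i<n - 1. scale (s i) (\<tau> (\<delta> i)))"
      by simp
    moreover have "(\<lambda>i. if i < n - 1 then s i else 0) = s" using s by (auto simp: aff_def)
    ultimately show ?thesis by simp
  qed
  have \<pi>_add: "\<pi> (x + y) = \<pi> x + \<pi> y" if "x \<in> M" "y \<in> M" for x y
    using \<pi> that by (auto simp: quotient_projection_def)
  have \<pi>_scale: "\<pi> (scale c x) = c * \<pi> x" if "x \<in> M" for x c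
    using \<pi> that by (auto simp: quotient_projection_def)
  have U: "x \<in> U \<longleftrightarrow> x \<in> M \<and> \<pi> x = 0" for x using \<pi> by (auto simp: quotient_projection_def)
  have \<pi>_lin: "linear_on_M \<pi>" by (simp add: linear_on_M_def \<pi>_add \<pi>_scale)
  have "1 \<in> \<pi> ` M" using \<pi> by (simp add: quotient_projection_def)
  then obtain b\<^sub>0 where b0: "b\<^sub>0 \<in> M" "\<pi> b\<^sub>0 = 1" by auto
  \<comment> \<open>The projection of \<open>M\<close> onto \<open>U\<close> along
    \<open>b\<^sub>0\<close>.\<close>
  define \<rho> where "\<rho> x = x - scale (\<pi> x) b\<^sub>0" for x
  have \<pi>_\<rho>: "\<pi> (\<rho> x) = 0" if "x \<in> M" for x
  proof -
    have "\<pi> (\<rho> x + scale (\<pi> x) b\<^sub>0) = \<pi> (\<rho> x) + \<pi> (scale (\<pi> x) b\<^sub>0)"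
      by (rule \<pi>_add) (auto simp: \<rho>_def intro: M_diff M_scale that b0)
    then show ?thesis using b0 by (simp add: \<rho>_def \<pi>_scale)
  qed
  have \<rho>: "\<rho> x \<in> U" if "x \<in> M" for x
    using that \<pi>_\<rho>[OF that] b0 by (simp add: U) (simp add: \<rho>_def M_diff M_scale)
  have \<rho>_add: "\<rho> (x + y) = \<rho> x + \<rho> y" if "x \<in> M" "y \<in> M" for x y
    using that by (simp add: \<rho>_def \<pi>_add scale_left_distrib)
  have \<rho>_scale: "\<rho> (scale c x) = scale c (\<rho> x)" if "x \<in> M" for x c
    using that by (simp add: \<rho>_def \<pi>_scale scale_right_diff_distrib)
  define \<sigma> where "\<sigma> = the_inv_into (aff (n - 1)) \<tau>"
  have inj: "inj_on \<tau> (aff (n - 1))" and img: "\<tau> ` aff (n - 1) = U" using bij by (auto simp: bij_betw_def)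
  have \<sigma>: "\<sigma> u \<in> aff (n - 1)" "\<tau> (\<sigma> u) = u" if "u \<in> U" for u
    using that img the_inv_into_into[OF inj, of u "aff (n - 1)"] f_the_inv_into_f[OF inj, of u] by (auto simp: \<sigma>_def)
  have \<sigma>_\<tau>: "\<sigma> (\<tau> s) = s" if "s \<in> aff (n - 1)" for s
    using the_inv_into_f_f[OF inj that] by (simp add: \<sigma>_def)
  have aff_add: "(\<lambda>i. s i + t i) \<in> aff (n - 1)" if "s \<in> aff (n - 1)" "t \<in> aff (n - 1)" for s t :: "nat \<Rightarrow> 'k"
    using that by (simp add: aff_def)
  have aff_scale: "(\<lambda>i. c * s i) \<in> aff (n - 1)" if "s \<in> aff (n - 1)" for s :: "nat \<Rightarrow> 'k" and c
    using that by (simp add: aff_def)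
  have \<sigma>_add: "\<sigma> (u + v) = (\<lambda>i. \<sigma> u i + \<sigma> v i)" if "u \<in> U" "v \<in> U" for u v
    using \<sigma>_\<tau>[OF aff_add[OF \<sigma>(1) \<sigma>(1)], of u v] add[OF \<sigma>(1) \<sigma>(1), of u v] \<sigma>(2) that by simp
  have \<sigma>_scale: "\<sigma> (scale c u) = (\<lambda>i. c * \<sigma> u i)" if "u \<in> U" for u c
    using \<sigma>_\<tau>[OF aff_scale[OF \<sigma>(1)], of u c] scale[OF \<sigma>(1), of u c] \<sigma>(2) that by simp
  \<comment> \<open>Index 0 is kept for the direction transversal to \<open>U\<close>, so the basis
    of \<open>U\<close> coming from \<tau> is shifted by one.\<close>
  define b where "b j = (if j = 0 then b\<^sub>0 else \<tau> (\<delta> (j - 1)))" for j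
  define \<kappa> where "\<kappa> j = (if j = 0 then \<pi> else (\<lambda>x. \<sigma> (\<rho> x) (j - 1)))" for j
  have \<tau>\<delta>: "\<tau> (\<delta> i) \<in> U" if "i < n - 1" for i using img \<delta>[OF that] by blast
  have bM: "b j \<in> M" if "j < n" for j
    using that b0 \<tau>\<delta>[of "j - 1"] U_subset by (auto simp: b_def)
  have shift: "(\<Sum>j<n. h j) = h 0 + (\<Sum>i<n - 1. h (Suc i))" for h :: "nat \<Rightarrow> 'a"
    using n sum.lessThan_Suc_shift[of h "n - 1"] by simp
  have lin: "linear_on_M (\<kappa> j)" for j
    by (simp add: \<kappa>_def \<pi>_lin) (simp add: linear_on_M_def \<rho>_add \<rho>_scale \<sigma>_add \<sigma>_scale \<rho>)
  have expand: "x = (\<Sum>j<n. scale (\<kappa> j x) (b j))" if x: "x \<in> M" for x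
  proof -
    have "(\<Sum>j<n. scale (\<kappa> j x) (b j)) = scale (\<pi> x) b\<^sub>0 + (\<Sum>i<n - 1. scale (\<sigma> (\<rho> x) i) (\<tau> (\<delta> i)))"
      unfolding shift by (simp add: \<kappa>_def b_def)
    also have "\<dots> = scale (\<pi> x) b\<^sub>0 + \<rho> x"
      using \<tau>_expand[OF \<sigma>(1)[OF \<rho>[OF x]]] \<sigma>(2)[OF \<rho>[OF x]] by simp
    finally show ?thesis by (simp add: \<rho>_def)
  qed
  have dual: "\<kappa> j (\<Sum>i<n. scale (y i) (b i)) = y j" if j: "j < n" for j y
  proof -
    define s where "s = (\<lambda>i. if i < n - 1 then y (Suc i) else 0)"
    have s: "s \<in> aff (n - 1)" by (simp add: s_def aff_def)
    have eq: "(\<Sum>i<n. scale (y i) (b i)) = scale (y 0) b\<^sub>0 + \<tau> s"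
      unfolding shift \<tau>_expand[OF s] by (simp add: b_def s_def)
    have \<tau>s: "\<tau> s \<in> U" using img s by blast
    then have "\<tau> s \<in> M" "\<pi> (\<tau> s) = 0" by (simp_all add: U)
    then have \<pi>: "\<pi> (scale (y 0) b\<^sub>0 + \<tau> s) = y 0"
      using b0 by (simp add: \<pi>_add \<pi>_scale M_scale)
    then have "\<rho> (scale (y 0) b\<^sub>0 + \<tau> s) = \<tau> s" by (simp add: \<rho>_def)
    then show ?thesis
      unfolding eq using \<pi> \<sigma>_\<tau>[OF s] j by (auto simp: \<kappa>_def s_def)
  qed
  show ?thesis by (rule that) (rule bM lin expand dual; assumption | simp add: \<kappa>_def)+
qed

end

section \<open>The hypersurface of an \<open>H\<close>-pair\<close>

context H_pair_coords
begin

text \<open>A nonzero scalar in \<open>M\<close> would put 1 into \<open>M\<close>.\<close>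

lemma scalar_part_unique:
  assumes "scale a 1 + x = scale c 1 + y" "x \<in> M" "y \<in> M" shows "a = c" "x = y"
proof -
  have "scale (a - c) 1 = y - x"
    using assms(1) by (simp add: scale_left_diff_distrib algebra_simps)
  then have "scale (a - c) 1 \<in> M" using assms by (simp add: M_diff)
  then have "scale (1 / (a - c)) (scale (a - c) 1) \<in> M" by (rule M_scale)
  then show "a = c" using one_notin_M by (cases "a = c") simp_all
  then show "x = y" using assms(1) by simp
qed

lemma from_coords_eq_scale_exp:
  assumes "u \<in> M" "from_coords scale n e v = scale c (nil_exp scale u)"
  shows "v 0 = c" "coords_to_ideal v = scale c (nil_exp scale u - 1)"
proof -
  have "scale (v 0) 1 + coords_to_ideal v = scale c 1 + scale c (nil_exp scale u - 1)"
    using assms(2) by (simp add: from_coords_def flip: scale_right_distrib)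
  note scalar_part_unique[OF this ideal_part_in_M M_scale[OF nil_exp_minus_1_in_M[OF assms(1)]]]
  then show "v 0 = c" "coords_to_ideal v = scale c (nil_exp scale u - 1)" by simp_all
qed

end

theorem corollary1:
  fixes scale :: "'k::{alg_closed_field, field_char_0} \<Rightarrow> 'a::comm_ring_1 \<Rightarrow> 'a"
    and M U :: "'a set"
    and n d :: nat
    and e :: "nat \<Rightarrow> 'a"
    and \<pi> :: "'a \<Rightarrow> 'k"
    and X :: "'k ppoint set"
    and \<alpha> :: "(nat \<Rightarrow> 'k) \<Rightarrow> 'k ppoint \<Rightarrow> 'k ppoint"
    and f :: "'k mpoly"
    and fk :: "nat \<Rightarrow> 'k mpoly"
  assumes "hypersurface n d X"
    and "\<not> hyperplane n X"
    and "induced_additive_action n X \<alpha>"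
    and "H_pair scale M U"
    and "vector_space.dim scale (UNIV :: 'a set) = n + 1"
    and "basis_of scale n e M"
    and "corresponds_to_H_pair scale n e U X \<alpha>"
    and "quotient_projection scale M U \<pi>"
    and "\<And>k. k \<in> {1..d} \<Longrightarrow> fk k \<in> forms {1..n} k"
    and "f = (\<Sum>k=1..d. Var 0 ^ (d - k) * fk k)"
    and "\<And>v. v \<in> aff (n + 1) \<Longrightarrow> v 0 \<noteq> 0 \<Longrightarrow>
           peval f v = v 0 ^ d * \<pi> (nil_ln1p scale (scale (1 / v 0) (ideal_part scale n e v)))"
    and "squarefree (fk d)"
  shows "normal_variety n X"
proof -
  interpret H_pair_coords scale M U n e
    using assms(4,6) by (simp add: H_pair_coords_def H_pair_coords_axioms_def)
  note fk = assms(9) and f_def = assms(10) and f_value = assms(11)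
  have d: "d \<ge> 1" using assms(1) by (simp add: hypersurface_def)
  have U: "x \<in> U \<longleftrightarrow> x \<in> M \<and> \<pi> x = 0" for x using assms(8) by (auto simp: quotient_projection_def)
  \<comment> \<open>For n = 0 the maximal ideal is zero and \<pi> cannot map it onto the
    field.\<close>
  have n: "n \<ge> 1"
  proof (rule ccontr)
    assume "\<not> n \<ge> 1"
    then have "M = {0}" using assms(6) by (simp add: basis_of_def)
    moreover have "\<pi> ` M = UNIV" using assms(8) by (simp add: quotient_projection_def)
    ultimately have "(UNIV :: 'k set) = {\<pi> 0}" by simp
    then show False by (metis UNIV_I singletonD zero_neq_one)
  qed
  obtain \<tau> where \<tau>: "bij_betw \<tau> (aff (n - 1)) U"
    "\<And>s t. s \<in> aff (n - 1) \<Longrightarrow> t \<in> aff (n - 1) \<Longrightarrow> \<tau> (\<lambda>i. s i + t i) = \<tau> s + \<tau> t"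
    "\<And>c s. s \<in> aff (n - 1) \<Longrightarrow> \<tau> (\<lambda>i. c * s i) = scale c (\<tau> s)"
    using assms(7) unfolding corresponds_to_H_pair_def by blast
  obtain b \<kappa> where b\<kappa>: "\<And>j. j < n \<Longrightarrow> b j \<in> M" "\<And>j. j < n \<Longrightarrow> linear_on_M (\<kappa> j)"
    "\<And>x. x \<in> M \<Longrightarrow> x = (\<Sum>j<n. scale (\<kappa> j x) (b j))"
    "\<And>j y. j < n \<Longrightarrow> \<kappa> j (\<Sum>i<n. scale (y i) (b i)) = y j" "\<kappa> 0 = \<pi>"
    by (rule adapted_coordinates[OF n assms(8) \<tau>], assumption+, rule that)
  obtain Ep Lp where EL: "\<And>i. in_vars {..<n} (Ep i)" "\<And>j. in_vars {1..n} (Lp j)"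
    "\<And>j z. j < n \<Longrightarrow> peval (Lp j) z = \<kappa> j (nil_ln1p scale (coords_to_ideal z))"
    "\<And>j y. j < n \<Longrightarrow> peval (Lp j) (\<lambda>i. peval (Ep i) y) = y j"
    "\<And>i z. i \<in> {1..n} \<Longrightarrow> peval (Ep i) (\<lambda>j. peval (Lp j) z) = z i"
    by (rule exp_ln_polynomials[of b \<kappa>], (rule b\<kappa>; assumption)+, rule that)
  have f_form: "f \<in> forms {..n} d"
    unfolding f_def
  proof (rule forms_sum)
    fix k assume k: "k \<in> {1..d}"
    have "Var 0 ^ (d - k) * fk k \<in> forms {..n} ((d - k) * 1 + k)"
      by (intro forms_mult forms_power forms_Var forms_mono[OF fk[OF k]]) auto
    then show "Var 0 ^ (d - k) * fk k \<in> forms {..n} d" using k by simp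
  qed
  have at_infinity: "subst (Var(0 := 0)) f = fk d"
  proof -
    have "subst (Var(0 := 0)) (fk k) = fk k" if "k \<in> {1..d}" for k
      using mev_cong[OF forms_in_vars[OF fk[OF that]], of "Var(0 := 0)" Var Const] by simp
    then have "subst (Var(0 := 0)) f = (\<Sum>k=1..d. 0 ^ (d - k) * fk k)"
      unfolding f_def mev_sum[OF coeff_hom_Const] by (intro sum.cong) (simp_all add: mev_simps)
    \<comment> \<open>Only k = d survives, as the other terms contain a positive power of 0.\<close>
    also have "\<dots> = (\<Sum>k\<in>{d}. 0 ^ (d - k) * fk k)"
      using d by (intro sum.mono_neutral_right) auto
    finally show ?thesis by simp
  qed
  have f_chart: "peval f v = \<pi> (nil_ln1p scale (coords_to_ideal v))" if v: "v 0 = 1" for v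
  proof -
    \<comment> \<open>The formula for f is given on vectors supported on 0, ..., n; cutting off the
      other coordinates changes neither side.\<close>
    let ?v = "\<lambda>i. if i \<le> n then v i else 0"
    have "peval f v = peval f ?v" by (rule peval_cong[OF forms_in_vars[OF f_form]]) simp
    also have "\<dots> = \<pi> (nil_ln1p scale (coords_to_ideal ?v))"
      using f_value[of ?v] v by (simp add: aff_def)
    also have "coords_to_ideal ?v = coords_to_ideal v" by (simp add: ideal_part_def)
    finally show ?thesis .
  qed
  define S where "S = {v \<in> hvecs n. \<exists>c u. c \<noteq> 0 \<and> u \<in> U \<and> from_coords scale n e v = scale c (nil_exp scale u)}"
  have X: "X = pt ` (affine_zariski_closure (n + 1) S \<inter> hvecs n)"
    using assms(7) by (simp add: corresponds_to_H_pair_def S_def)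
  \<comment> \<open>On multiples of exp u with u in \<open>U\<close> the logarithm gives back u,
    which \<pi> kills. Vanishing of f then passes to the Zariski closure.\<close>
  have f_S: "peval f s = 0" if "s \<in> S" for s
  proof -
    obtain c u where cu: "s \<in> hvecs n" "c \<noteq> 0" "u \<in> U" "from_coords scale n e s = scale c (nil_exp scale u)"
      using \<open>s \<in> S\<close> by (auto simp: S_def)
    have u: "u \<in> M" "\<pi> u = 0" using cu(3) by (simp_all add: U)
    note s = from_coords_eq_scale_exp[OF u(1) cu(4)]
    have "peval f s = c ^ d * \<pi> (nil_ln1p scale (nil_exp scale u - 1))"
      using f_value[of s] cu s by (simp add: hvecs_def)
    then show ?thesis using u by (simp add: ln_exp)
  qed
  interpret straightened_hypersurface n d f Ep Lp X
  proof
    show "1 \<le> n" "f \<in> forms {..n} d" by (rule n f_form)+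
    show "squarefree (subst (Var(0 := 0)) f)" unfolding at_infinity by (rule assms(12))
    show "in_vars {..<n} (Ep i)" "in_vars {1..n} (Lp i)" for i by (rule EL)+
    show "peval (Lp j) (\<lambda>i. peval (Ep i) y) = y j" if "j < n" for j y by (rule EL(4)[OF that])
    show "peval (Ep i) (\<lambda>j. peval (Lp j) z) = z i" if "i \<in> {1..n}" for i z by (rule EL(5)[OF that])
    fix v :: "nat \<Rightarrow> 'k"
    show "peval f v = peval (Lp 0) v" if "v 0 = 1"
      using f_chart[of v] that EL(3)[of 0 v] n b\<kappa>(5) by simp
    show "peval f v = 0" if v: "v \<in> hvecs n" "pt v \<in> X"
    proof -
      obtain w where w: "w \<in> affine_zariski_closure (n + 1) S" "pt v = pt w" using v X by auto
      have "in_vars {..<n + 1} f" by (rule in_vars_mono[OF forms_in_vars[OF f_form]]) auto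
      then have "peval f w = 0" using w(1) f_S by (simp add: affine_zariski_closure_def)
      moreover obtain c where "c \<noteq> 0" "w = (\<lambda>i. c * v i)" using w(2) by (rule pt_eqD)
      ultimately show ?thesis by (simp add: peval_form_scale[OF f_form])
    qed
    show "pt v \<in> X" if v: "v \<in> hvecs n" "v 0 = 1" "peval f v = 0"
    proof -
      \<comment> \<open>The logarithm of a chart point with f = 0 lies in \<open>U\<close>, so the
        point belongs to exp \<open>U\<close> itself and not only to the closure of the cone over
        it.\<close>
      define u where "u = nil_ln1p scale (coords_to_ideal v)"
      have "u \<in> U" using v f_chart[of v] by (simp add: U u_def nil_ln1p_in_M ideal_part_in_M)
      moreover have "from_coords scale n e v = scale 1 (nil_exp scale u)"
        using v by (simp add: from_coords_def u_def exp_ln ideal_part_in_M)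
      ultimately have "v \<in> S" using v(1) unfolding S_def by (metis (mono_tags, lifting) mem_Collect_eq one_neq_zero)
      then have "v \<in> affine_zariski_closure (n + 1) S"
        using v(1) by (simp add: affine_zariski_closure_def hvecs_def)
      then show ?thesis using v(1) X by blast
    qed
  qed
  \<comment> \<open>Irreducibility is part of the notion of an additive action.\<close>
  have "irreducible_closed n X"
    using assms(3) by (simp add: induced_additive_action_def additive_action_def)
  then show ?thesis by (rule hypersurface_chart.normal_variety_if_irreducible[OF hypersurface_chart])
qed

end
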